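(* Let $\Pi$ be a finite simplicial complex, $\sigma\in\Pi$ and $d:=\dim\mathrm{St}\,\sigma-\dim\sigma$, where $\dim\mathrm{St}\,\sigma$ denotes the maximum dimension of any $\tau\in\mathrm{St}\,\sigma$. Then for every $j$ $$\mathrm{SC}^j(\sigma)\le\binom{d}{j}.$$ This bound is asymptotically tight: if $\Pi=\Delta_n^{(d)}$ is the $d$-skeleton of the $n$-simplex, $v$ is a vertex of $\Delta_n^{(d)}$, and $d$ and $j$ are fixed, then $$\mathrm{SC}^j(v)\xrightarrow{\,n\to\infty\,}\binom{d}{j}.$$
   Context: Fix a field $k$. A simplicial complex is viewed as a finite poset of its (non-empty) simplices under the face relation; $\mathrm{St}\,\sigma=\{\tau:\sigma\le\tau\}$. A sheaf on a finite poset $\Pi$ is a functor from $\Pi$ to finite-dimensional $k$-vector spaces; the constant sheaf $k_\Pi$ assigns $k$ to every element and $\mathrm{id}_k$ to every relation. For $\pi\in\Pi$, $[\pi]$ is the injective sheaf with $[\pi](\sigma)=k$ if $\sigma\le\pi$ and $0$ otherwise (identity maps between the copies of $k$); every injective sheaf is a direct sum of such sheaves. An injective resolution of a sheaf $F$ is an exact sequence $0\to F\to I^0\to I^1\to\cdots$ with all $I^d$ injective sheaves. It is minimal if for every $d$ the number of indecomposable summands $[\pi]$ of $I^d$ is minimal among all bounded complexes of injective sheaves quasi-isomorphic to $I^\bullet$; the minimal injective resolution exists and is unique up to isomorphism of complexes. Let $I^\bullet$ be the minimal injective resolution of $k_\Pi$ and let $m^j_{k_\Pi}(\pi)$ be the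 multiplicity of $[\pi]$ in $I^j$. Put $m^j(\mathrm{St}\,\sigma):=\sum_{\pi\in\mathrm{St}\,\sigma}m^j_{k_\Pi}(\pi)$. The $j$-th star complexity of $\sigma$ is $\mathrm{SC}^j(\sigma):=m^j(\mathrm{St}\,\sigma)/\#\mathrm{St}\,\sigma$. *)

theory Defs
  imports Complex_Main "Jordan_Normal_Form.Matrix_Kernel"
begin

section \<open>Sheaves on a finite poset\<close>

text \<open>
  A finite poset is a finite set \<open>P\<close> of elements of an ordered type. Every stalk of a sheaf is a
  coordinate space \<open>k\<^sup>n\<close>, given by its dimension, and linear maps are matrices acting on column
  vectors (possibly with zero rows or columns). Up to isomorphism these are all functors from
  \<open>P\<close> to finite-dimensional vector spaces. Values off \<open>P\<close>, and values of restriction maps at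
  pairs that are not related, are irrelevant.
\<close>

record ('p, 'k) sheaf =
  stalk_dim :: "'p \<Rightarrow> nat"
  restr :: "'p \<Rightarrow> 'p \<Rightarrow> 'k mat"

definition sheaf_on :: "'p::order set \<Rightarrow> ('p, 'k::field) sheaf \<Rightarrow> bool" where
  "sheaf_on P F \<longleftrightarrow>
     (\<forall>\<sigma>\<in>P. \<forall>\<tau>\<in>P. \<sigma> \<le> \<tau> \<longrightarrow> restr F \<sigma> \<tau> \<in> carrier_mat (stalk_dim F \<tau>) (stalk_dim F \<sigma>)) \<and>
     (\<forall>\<sigma>\<in>P. restr F \<sigma> \<sigma> = 1\<^sub>m (stalk_dim F \<sigma>)) \<and>
     (\<forall>\<sigma>\<in>P. \<forall>\<tau>\<in>P. \<forall>\<rho>\<in>P. \<sigma> \<le> \<tau> \<longrightarrow> \<tau> \<le> \<rho> \<longrightarrow> restr F \<sigma> \<rho> = restr F \<tau> \<rho> * restr F \<sigma> \<tau>)"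

definition sheaf_hom ::
  "'p::order set \<Rightarrow> ('p, 'k::field) sheaf \<Rightarrow> ('p, 'k) sheaf \<Rightarrow> ('p \<Rightarrow> 'k mat) \<Rightarrow> bool" where
  "sheaf_hom P F G \<phi> \<longleftrightarrow>
     (\<forall>\<sigma>\<in>P. \<phi> \<sigma> \<in> carrier_mat (stalk_dim G \<sigma>) (stalk_dim F \<sigma>)) \<and>
     (\<forall>\<sigma>\<in>P. \<forall>\<tau>\<in>P. \<sigma> \<le> \<tau> \<longrightarrow> \<phi> \<tau> * restr F \<sigma> \<tau> = restr G \<sigma> \<tau> * \<phi> \<sigma>)"

definition sheaf_mono ::
  "'p::order set \<Rightarrow> ('p, 'k::field) sheaf \<Rightarrow> ('p, 'k) sheaf \<Rightarrow> ('p \<Rightarrow> 'k mat) \<Rightarrow> bool" where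
  "sheaf_mono P F G \<phi> \<longleftrightarrow> sheaf_hom P F G \<phi> \<and>
     (\<forall>\<sigma>\<in>P. inj_on (\<lambda>v. \<phi> \<sigma> *\<^sub>v v) (carrier_vec (stalk_dim F \<sigma>)))"

definition sheaf_iso :: "'p::order set \<Rightarrow> ('p, 'k::field) sheaf \<Rightarrow> ('p, 'k) sheaf \<Rightarrow> bool" where
  "sheaf_iso P F G \<longleftrightarrow> (\<exists>\<phi> \<psi>. sheaf_hom P F G \<phi> \<and> sheaf_hom P G F \<psi> \<and>
     (\<forall>\<sigma>\<in>P. \<psi> \<sigma> * \<phi> \<sigma> = 1\<^sub>m (stalk_dim F \<sigma>) \<and> \<phi> \<sigma> * \<psi> \<sigma> = 1\<^sub>m (stalk_dim G \<sigma>)))"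

definition constant_sheaf :: "('p, 'k::field) sheaf" where
  "constant_sheaf = \<lparr>stalk_dim = (\<lambda>_. 1), restr = (\<lambda>_ _. 1\<^sub>m 1)\<rparr>"

text \<open>
  The sheaf \<open>[\<pi>]\<close>. Its restriction map is the \<open>1 \<times> 1\<close> identity if \<open>\<sigma> \<le> \<tau> \<le> \<pi>\<close>; otherwise the
  matrix below has no rows and is the zero map.
\<close>

definition indec_injective :: "'p::order \<Rightarrow> ('p, 'k::field) sheaf" where
  "indec_injective \<pi> =
     (let n = (\<lambda>\<sigma>. if \<sigma> \<le> \<pi> then 1 else 0)
      in \<lparr>stalk_dim = n, restr = (\<lambda>\<sigma> \<tau>. mat (n \<tau>) (n \<sigma>) (\<lambda>_. 1))\<rparr>)"

definition sheaf_direct_sum :: "('p, 'k::field) sheaf list \<Rightarrow> ('p, 'k) sheaf" where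
  "sheaf_direct_sum Fs =
     \<lparr>stalk_dim = (\<lambda>\<sigma>. \<Sum>F\<leftarrow>Fs. stalk_dim F \<sigma>),
      restr = (\<lambda>\<sigma> \<tau>. diag_block_mat (map (\<lambda>F. restr F \<sigma> \<tau>) Fs))\<rparr>"

definition injective_sheaf :: "'p::order set \<Rightarrow> ('p, 'k::field) sheaf \<Rightarrow> bool" where
  "injective_sheaf P I \<longleftrightarrow> sheaf_on P I \<and>
     (\<forall>A B \<iota> \<phi>. sheaf_on P A \<longrightarrow> sheaf_on P B \<longrightarrow> sheaf_mono P A B \<iota> \<longrightarrow> sheaf_hom P A I \<phi> \<longrightarrow>
        (\<exists>\<psi>. sheaf_hom P B I \<psi> \<and> (\<forall>\<sigma>\<in>P. \<psi> \<sigma> * \<iota> \<sigma> = \<phi> \<sigma>)))"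

text \<open>
  The multiplicity of \<open>[\<pi>]\<close> in an injective sheaf; every injective sheaf has a decomposition into
  sheaves \<open>[\<pi>]\<close>, and its multiplicities are determined by the dimensions of the stalks.
\<close>

definition multiplicity_in :: "'p::order set \<Rightarrow> ('p, 'k::field) sheaf \<Rightarrow> 'p \<Rightarrow> nat" where
  "multiplicity_in P I \<pi> =
     (THE m. \<exists>\<pi>s. set \<pi>s \<subseteq> P \<and> sheaf_iso P I (sheaf_direct_sum (map indec_injective \<pi>s)) \<and>
        m = count_list \<pi>s \<pi>)"

definition num_summands :: "'p::order set \<Rightarrow> ('p, 'k::field) sheaf \<Rightarrow> nat" where
  "num_summands P I = (\<Sum>\<pi>\<in>P. multiplicity_in P I \<pi>)"


section \<open>Complexes and minimal injective resolutions\<close>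

text \<open>Complexes are cohomologically graded: \<open>diff C n\<close> is the map from degree \<open>n\<close> to \<open>n + 1\<close>.\<close>

record ('p, 'k) sheaf_complex =
  obj :: "int \<Rightarrow> ('p, 'k) sheaf"
  diff :: "int \<Rightarrow> 'p \<Rightarrow> 'k mat"

definition complex_on :: "'p::order set \<Rightarrow> ('p, 'k::field) sheaf_complex \<Rightarrow> bool" where
  "complex_on P C \<longleftrightarrow>
     (\<forall>n. sheaf_on P (obj C n)) \<and>
     (\<forall>n. sheaf_hom P (obj C n) (obj C (n + 1)) (diff C n)) \<and>
     (\<forall>n. \<forall>\<sigma>\<in>P. diff C (n + 1) \<sigma> * diff C n \<sigma> =
        0\<^sub>m (stalk_dim (obj C (n + 2)) \<sigma>) (stalk_dim (obj C n) \<sigma>))"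

definition zero_sheaf_on :: "'p set \<Rightarrow> ('p, 'k) sheaf \<Rightarrow> bool" where
  "zero_sheaf_on P F \<longleftrightarrow> (\<forall>\<sigma>\<in>P. stalk_dim F \<sigma> = 0)"

definition bounded_complex :: "'p set \<Rightarrow> ('p, 'k) sheaf_complex \<Rightarrow> bool" where
  "bounded_complex P C \<longleftrightarrow> (\<exists>a b. \<forall>n. n < a \<or> b < n \<longrightarrow> zero_sheaf_on P (obj C n))"

definition chain_map ::
  "'p::order set \<Rightarrow> ('p, 'k::field) sheaf_complex \<Rightarrow> ('p, 'k) sheaf_complex \<Rightarrow>
   (int \<Rightarrow> 'p \<Rightarrow> 'k mat) \<Rightarrow> bool" where
  "chain_map P C D f \<longleftrightarrow>
     (\<forall>n. sheaf_hom P (obj C n) (obj D n) (f n)) \<and>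
     (\<forall>n. \<forall>\<sigma>\<in>P. f (n + 1) \<sigma> * diff C n \<sigma> = diff D n \<sigma> * f n \<sigma>)"

definition mat_image :: "'k::field mat \<Rightarrow> 'k vec set" where
  "mat_image A = (\<lambda>v. A *\<^sub>v v) ` carrier_vec (dim_col A)"

text \<open>
  A quasi-isomorphism induces isomorphisms of cohomology sheaves. Since a map of sheaves is an
  isomorphism iff it is one on every stalk, and stalks of cohomology are cocycles modulo
  coboundaries, the two clauses say that the induced map is injective and surjective there.
\<close>

definition quasi_isomorphism ::
  "'p::order set \<Rightarrow> ('p, 'k::field) sheaf_complex \<Rightarrow> ('p, 'k) sheaf_complex \<Rightarrow>
   (int \<Rightarrow> 'p \<Rightarrow> 'k mat) \<Rightarrow> bool" where
  "quasi_isomorphism P C D f \<longleftrightarrow> chain_map P C D f \<and>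
     (\<forall>n. \<forall>\<sigma>\<in>P.
        (\<forall>v\<in>mat_kernel (diff C n \<sigma>).
           f n \<sigma> *\<^sub>v v \<in> mat_image (diff D (n - 1) \<sigma>) \<longrightarrow> v \<in> mat_image (diff C (n - 1) \<sigma>)) \<and>
        (\<forall>w\<in>mat_kernel (diff D n \<sigma>). \<exists>v\<in>mat_kernel (diff C n \<sigma>).
           w - f n \<sigma> *\<^sub>v v \<in> mat_image (diff D (n - 1) \<sigma>)))"

text \<open>
  Two complexes are quasi-isomorphic if they are joined by a finite zigzag of quasi-isomorphisms
  (equivalently, isomorphic in the derived category).
\<close>

definition quasi_isomorphic ::
  "'p::order set \<Rightarrow> ('p, 'k::field) sheaf_complex \<Rightarrow> ('p, 'k) sheaf_complex \<Rightarrow> bool" where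
  "quasi_isomorphic P = equivclp
     (\<lambda>C D. complex_on P C \<and> complex_on P D \<and> (\<exists>f. quasi_isomorphism P C D f))"

text \<open>A resolution is indexed by the integers, with zero sheaves in negative degrees.\<close>

definition injective_resolution ::
  "'p::order set \<Rightarrow> ('p, 'k::field) sheaf \<Rightarrow> ('p \<Rightarrow> 'k mat) \<Rightarrow> ('p, 'k) sheaf_complex \<Rightarrow> bool" where
  "injective_resolution P F \<epsilon> I \<longleftrightarrow>
     complex_on P I \<and>
     (\<forall>n. injective_sheaf P (obj I n)) \<and>
     (\<forall>n<0. zero_sheaf_on P (obj I n)) \<and>
     sheaf_mono P F (obj I 0) \<epsilon> \<and>
     (\<forall>\<sigma>\<in>P. mat_image (\<epsilon> \<sigma>) = mat_kernel (diff I 0 \<sigma>)) \<and>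
     (\<forall>n\<ge>0. \<forall>\<sigma>\<in>P. mat_image (diff I n \<sigma>) = mat_kernel (diff I (n + 1) \<sigma>))"

definition minimal_injective_resolution ::
  "'p::order set \<Rightarrow> ('p, 'k::field) sheaf \<Rightarrow> ('p \<Rightarrow> 'k mat) \<Rightarrow> ('p, 'k) sheaf_complex \<Rightarrow> bool" where
  "minimal_injective_resolution P F \<epsilon> I \<longleftrightarrow>
     injective_resolution P F \<epsilon> I \<and>
     (\<forall>n J. complex_on P J \<longrightarrow> bounded_complex P J \<longrightarrow> (\<forall>i. injective_sheaf P (obj J i)) \<longrightarrow>
        quasi_isomorphic P J I \<longrightarrow> num_summands P (obj I n) \<le> num_summands P (obj J n))"

text \<open>
  The number \<open>m\<^sup>j\<^sub>F(\<pi>)\<close>. The minimal injective resolution exists and is unique up to isomorphism of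
  complexes, so that the multiplicity does not depend on the choice of the resolution; this is
  what the definite description relies on.
\<close>

definition min_mult :: "'p::order set \<Rightarrow> ('p, 'k::field) sheaf \<Rightarrow> nat \<Rightarrow> 'p \<Rightarrow> nat" where
  "min_mult P F j \<pi> =
     (THE m. \<exists>\<epsilon> I. minimal_injective_resolution P F \<epsilon> I \<and> m = multiplicity_in P (obj I (int j)) \<pi>)"


section \<open>Simplicial complexes and star complexity\<close>

text \<open>
  An abstract simplicial complex is its set of non-empty simplices, ordered by inclusion, which is
  the order \<open>\<le>\<close> on sets.
\<close>

definition abstract_simplicial_complex :: "'v set set \<Rightarrow> bool" where
  "abstract_simplicial_complex P \<longleftrightarrow>
     (\<forall>\<sigma>\<in>P. finite \<sigma> \<and> \<sigma> \<noteq> {}) \<and> (\<forall>\<sigma>\<in>P. \<forall>\<tau>. \<tau> \<subseteq> \<sigma> \<longrightarrow> \<tau> \<noteq> {} \<longrightarrow> \<tau> \<in> P)"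

definition simplex_dim :: "'v set \<Rightarrow> nat" where
  "simplex_dim \<sigma> = card \<sigma> - 1"

definition star :: "'p::order set \<Rightarrow> 'p \<Rightarrow> 'p set" where
  "star P \<sigma> = {\<tau>\<in>P. \<sigma> \<le> \<tau>}"

definition star_dim :: "'v set set \<Rightarrow> 'v set \<Rightarrow> nat" where
  "star_dim P \<sigma> = Max (simplex_dim ` star P \<sigma>)"

definition star_complexity :: "'k::field itself \<Rightarrow> 'p::order set \<Rightarrow> nat \<Rightarrow> 'p \<Rightarrow> real" where
  "star_complexity TYPE('k) P j \<sigma> =
     real (\<Sum>\<pi>\<in>star P \<sigma>. min_mult P (constant_sheaf :: ('p, 'k) sheaf) j \<pi>) /
     real (card (star P \<sigma>))"

definition standard_simplex :: "nat \<Rightarrow> nat set set" where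
  "standard_simplex n = {\<sigma>. \<sigma> \<subseteq> {0..n} \<and> \<sigma> \<noteq> {}}"

definition skeleton :: "nat \<Rightarrow> 'v set set \<Rightarrow> 'v set set" where
  "skeleton d P = {\<sigma>\<in>P. simplex_dim \<sigma> \<le> d}"

end

theory Submission
  imports Defs "HOL-Library.Function_Algebras"
begin

text \<open>
  A resolution is minimal iff its differentials vanish on all socles, the socle of a sheaf at \<open>\<pi>\<close> being
  the space of sections over \<open>\<pi>\<close> that restrict to zero on every larger element. Indeed, the multiplicity of
  \<open>[\<pi>]\<close> in an injective sheaf is the dimension of its socle at \<open>\<pi>\<close>. On a complex of injective sheaves,
  taking socles computes the total complex of the cube formed by the stalks at \<open>\<pi> \<union> S\<close>, where \<open>S\<close> runs
  through the sets of vertices outside \<open>\<pi>\<close>, because the restriction maps are surjective on partial socles. The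
  total complex is defined for every complex of sheaves and preserves quasi-isomorphisms, so its cohomology
  is a lower bound for the multiplicities which the minimal resolution attains.

  For the constant sheaf the total complex has in degree \<open>j\<close> the dimension
  \<open>a\<^sub>j(\<pi>) = #{\<tau> \<ge> \<pi> | dim \<tau> = dim \<pi> + j}\<close>. Hence \<open>m\<^sup>j(\<pi>) \<le> a\<^sub>j(\<pi>)\<close>, and counting pairs
  \<open>\<pi> \<le> \<tau>\<close> in the star by \<open>\<tau>\<close> gives the binomial bound. In the \<open>d\<close>-skeleton of a simplex it is asymptotically
  attained by the \<open>\<pi>\<close> of dimension \<open>d - j\<close>: for these \<open>a\<^sub>j\<^sub>+\<^sub>1 = 0\<close>, so that
  \<open>m\<^sup>j(\<pi>) \<ge> a\<^sub>j(\<pi>) - a\<^sub>j\<^sub>-\<^sub>1(\<pi>)\<close>, and \<open>a\<^sub>j\<^sub>-\<^sub>1\<close> grows more slowly than \<open>a\<^sub>j\<close>.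
\<close>

section \<open>Finite-dimensional subspaces of a sequence space\<close>

text \<open>The zigzags in the definition of minimality may pass through complexes that are not
  injective, and taking socles does not preserve quasi-isomorphisms between such complexes.
  Multiplicities therefore cannot be carried along a zigzag directly, whereas the total complex,
  assembled from stalks by iterated mapping cocones, can. One and the same resolution attains the
  resulting lower bound at every \<open>\<pi>\<close>. Hence comparing mere sums over all
  \<open>\<pi>\<close>, which is all that minimality offers, already pins down each single
  multiplicity.

  Stalks, direct sums and total complexes all live in the type \<open>nat \<Rightarrow> 'k\<close>.
  The number of nested cocones is the number of vertices outside \<open>\<pi>\<close>, so the
  recursion has to stay within one type. Linear maps are defined on all sequences, and cohomology
  enters only through its dimension, so that no quotient spaces have to be formed.\<close>

definition scl :: "'k::field \<Rightarrow> (nat \<Rightarrow> 'k) \<Rightarrow> nat \<Rightarrow> 'k" where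
  "scl c f = (\<lambda>i. c * f i)"

lemma scl_apply [simp]: "scl c f i = c * f i"
  by (simp add: scl_def)

lemma uminus_seq_apply [simp]: "(- f) i = - (f i :: 'k::field)"
  by (simp add: fun_Compl_def)

lemma minus_seq_apply [simp]: "(f - g) i = f i - (g i :: 'k::field)"
  by (simp add: fun_diff_def)

interpretation V: vector_space "scl :: 'k::field \<Rightarrow> (nat \<Rightarrow> 'k) \<Rightarrow> nat \<Rightarrow> 'k"
  by unfold_locales (auto simp: fun_eq_iff algebra_simps)

interpretation VP: vector_space_pair
  "scl :: 'k::field \<Rightarrow> (nat \<Rightarrow> 'k) \<Rightarrow> nat \<Rightarrow> 'k" "scl :: 'k \<Rightarrow> (nat \<Rightarrow> 'k) \<Rightarrow> nat \<Rightarrow> 'k"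
  by unfold_locales

abbreviation lin :: "((nat \<Rightarrow> 'k::field) \<Rightarrow> nat \<Rightarrow> 'k) \<Rightarrow> bool" where
  "lin \<equiv> Vector_Spaces.linear scl scl"

lemma linI:
  assumes "\<And>x y. f (x + y) = f x + f y" "\<And>c x. f (scl c x) = scl c (f x)"
  shows "lin f"
  using assms V.vector_space_axioms by (auto simp: Vector_Spaces.linear_iff)

lemmas lin_add = VP.linear_add and lin_diff = VP.linear_diff and lin_zero = VP.linear_0
  and lin_scale = VP.linear_scale and lin_neg = VP.linear_neg

lemma lin_comp: "lin f \<Longrightarrow> lin g \<Longrightarrow> lin (\<lambda>x. g (f x))"
  using Vector_Spaces.linear_compose[of scl scl f scl g] by (simp add: comp_def)

lemma lin_id: "lin (\<lambda>x. x)" and lin_const_0: "lin (\<lambda>x. 0)"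
  by (rule linI; simp)+

text \<open>The coordinate space of dimension \<open>N\<close>, placed among the sequences so that
  spaces of different dimensions share a type.\<close>

definition kn :: "nat \<Rightarrow> (nat \<Rightarrow> 'k::field) set" where
  "kn N = {f. \<forall>i\<ge>N. f i = 0}"

lemma subspace_kn: "V.subspace (kn N)"
  by (auto simp: V.subspace_def kn_def)

definition unit_seq :: "nat \<Rightarrow> nat \<Rightarrow> 'k::field" where
  "unit_seq j = (\<lambda>i. if i = j then 1 else 0)"

lemma unit_seq_inject [simp]: "(unit_seq i :: nat \<Rightarrow> 'k::field) = unit_seq j \<longleftrightarrow> i = j"
  by (auto simp: unit_seq_def fun_eq_iff)

lemma sum_seq_apply: "(sum f A) i = (\<Sum>a\<in>A. (f a) i :: 'k::field)"
  by (induction A rule: infinite_finite_induct) auto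

lemma units_independent:
  fixes A :: "nat set"
  assumes "finite A"
  shows "V.independent (unit_seq ` A :: (nat \<Rightarrow> 'k::field) set)"
proof (rule V.independent_if_scalars_zero)
  show "finite (unit_seq ` A :: (nat \<Rightarrow> 'k) set)" using assms by simp
  fix f :: "(nat \<Rightarrow> 'k) \<Rightarrow> 'k" and x :: "nat \<Rightarrow> 'k"
  assume s: "(\<Sum>x\<in>unit_seq ` A. scl (f x) x) = 0" and x: "x \<in> unit_seq ` A"
  obtain j where j: "j \<in> A" "x = unit_seq j" using x by auto
  have "0 = (\<Sum>x\<in>unit_seq ` A. scl (f x) x) j" using s by simp
  also have "\<dots> = (\<Sum>i\<in>A. f (unit_seq i) * unit_seq i j)"
    by (simp add: sum_seq_apply sum.reindex inj_on_def)
  also have "\<dots> = f x"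
    using j assms by (simp add: unit_seq_def if_distrib[of "\<lambda>z. _ * z"] sum.delta cong: if_cong)
  finally show "f x = 0" by simp
qed

definition coord_space :: "nat set \<Rightarrow> (nat \<Rightarrow> 'k::field) set" where
  "coord_space A = {f. \<forall>i. i \<notin> A \<longrightarrow> f i = 0}"

lemma coord_space_expand:
  assumes "finite A" "x \<in> coord_space A" shows "x = (\<Sum>j\<in>A. scl (x j) (unit_seq j))"
  using assms
  by (auto simp: fun_eq_iff sum_seq_apply unit_seq_def coord_space_def if_distrib sum.delta cong: if_cong)

lemma coord_space_span:
  assumes "finite A" shows "coord_space A \<subseteq> V.span (unit_seq ` A)"
proof
  fix x :: "nat \<Rightarrow> 'a" assume "x \<in> coord_space A"
  from coord_space_expand[OF assms this] have "x = (\<Sum>j\<in>A. scl (x j) (unit_seq j))" .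
  moreover have "(\<Sum>j\<in>A. scl (x j) (unit_seq j)) \<in> V.span (unit_seq ` A)"
    by (intro V.span_sum V.span_scale V.span_base) auto
  ultimately show "x \<in> V.span (unit_seq ` A)" by simp
qed

lemma dim_coord_space:
  assumes "finite A"
  shows "V.dim (coord_space A :: (nat \<Rightarrow> 'k::field) set) = card A"
proof (rule V.dim_unique)
  show "unit_seq ` A \<subseteq> (coord_space A :: (nat \<Rightarrow> 'k) set)"
    by (auto simp: coord_space_def unit_seq_def)
  show "coord_space A \<subseteq> V.span (unit_seq ` A :: (nat \<Rightarrow> 'k) set)"
    using assms by (rule coord_space_span)
  show "V.independent (unit_seq ` A :: (nat \<Rightarrow> 'k) set)"
    using assms by (rule units_independent)
  show "card (unit_seq ` A :: (nat \<Rightarrow> 'k) set) = card A"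
    by (rule card_image) (auto simp: inj_on_def)
qed

lemma kn_eq_coord_space: "kn N = coord_space {..<N}"
  by (auto simp: kn_def coord_space_def)

lemma kn_expand: "x \<in> kn N \<Longrightarrow> x = (\<Sum>j<N. scl (x j) (unit_seq j))"
  by (simp add: kn_eq_coord_space coord_space_expand)

lemma kn_span: "kn N \<subseteq> V.span (unit_seq ` {..<N})"
  by (simp add: kn_eq_coord_space coord_space_span)

lemma dim_kn: "V.dim (kn N :: (nat \<Rightarrow> 'k::field) set) = N"
  by (simp add: kn_eq_coord_space dim_coord_space)

text \<open>The bound by some \<open>kn N\<close> forces independent subsets to be finite, so that
  \<open>V.dim\<close> is the true dimension and not the default value 0 of an infinite
  cardinality.\<close>

definition fd :: "(nat \<Rightarrow> 'k::field) set \<Rightarrow> bool" where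
  "fd S \<longleftrightarrow> V.subspace S \<and> (\<exists>N. S \<subseteq> kn N)"

lemma fd_kn: "fd (kn N)"
  using subspace_kn by (auto simp: fd_def)

lemma fd_subset: "fd S \<Longrightarrow> T \<subseteq> S \<Longrightarrow> V.subspace T \<Longrightarrow> fd T"
  by (auto simp: fd_def)

lemma fd_subspace: "fd S \<Longrightarrow> V.subspace S"
  by (simp add: fd_def)

lemma fd_add: "fd S \<Longrightarrow> x \<in> S \<Longrightarrow> y \<in> S \<Longrightarrow> x + y \<in> S"
  and fd_diff: "fd S \<Longrightarrow> x \<in> S \<Longrightarrow> y \<in> S \<Longrightarrow> x - y \<in> S"
  and fd_zero: "fd S \<Longrightarrow> 0 \<in> S"
  and fd_neg: "fd S \<Longrightarrow> x \<in> S \<Longrightarrow> - x \<in> S"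
  and fd_scl: "fd S \<Longrightarrow> x \<in> S \<Longrightarrow> scl c x \<in> S"
  by (auto simp: fd_def V.subspace_add V.subspace_diff V.subspace_0 V.subspace_neg V.subspace_scale)

lemma fd_0: "fd {0}"
  using fd_kn[of 0] by (auto simp: fd_def kn_def)

lemma fd_independent_finite:
  assumes "fd S" "B \<subseteq> S" "V.independent B" shows "finite B"
proof -
  obtain N where "S \<subseteq> kn N" using assms by (auto simp: fd_def)
  then have "B \<subseteq> V.span (unit_seq ` {..<N})" using assms(2) kn_span by blast
  from V.independent_span_bound[OF _ assms(3) this] show ?thesis by simp
qed

lemma subspace_kernel: "fd S \<Longrightarrow> lin f \<Longrightarrow> fd {x \<in> S. f x = 0}"
  using V.subspace_inter[OF fd_subspace[of S] VP.linear_subspace_kernel[of f]]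
  by (auto intro!: fd_subset[of S] simp: Collect_conj_eq)

lemma subspace_image: "V.subspace S \<Longrightarrow> lin f \<Longrightarrow> V.subspace (f ` S)"
  by (rule VP.linear_subspace_image)

lemma in_span_basis: "fd S \<Longrightarrow> B \<subseteq> S \<Longrightarrow> S \<subseteq> V.span B \<Longrightarrow> V.span B = S"
  by (simp add: V.span_minimal fd_def subset_antisym)

text \<open>Projecting away from one part of a basis shows that the spans of its two parts are independent.\<close>

lemma span_disjoint_parts:
  assumes "V.independent (K \<union> C)" "K \<inter> C = {}" "x \<in> V.span K" "x \<in> V.span C"
  shows "x = 0"
proof -
  define p where "p = VP.construct (K \<union> C) (\<lambda>b. if b \<in> K then b else 0)"
  have lp: "lin p" unfolding p_def by (rule VP.linear_construct[OF assms(1)])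
  have pb: "p b = (if b \<in> K then b else 0)" if "b \<in> K \<union> C" for b
    unfolding p_def using VP.construct_basis[OF assms(1) that] .
  have "p x = x"
    by (rule VP.linear_eq_on_span[OF lp lin_id _ assms(3)]) (simp add: pb)
  moreover have "p x = 0"
    by (rule VP.linear_eq_on_span[OF lp lin_const_0 _ assms(4)]) (use pb assms(2) in auto)
  ultimately show ?thesis by simp
qed

lemma rank_nullity:
  assumes S: "fd S" and f: "lin f"
  shows "V.dim S = V.dim {x \<in> S. f x = 0} + V.dim (f ` S)"
proof -
  let ?K = "{x \<in> S. f x = 0}"
  obtain K where K: "K \<subseteq> ?K" "V.independent K" "?K \<subseteq> V.span K" "card K = V.dim ?K"
    by (rule V.basis_exists)
  have spK: "V.span K = ?K" using in_span_basis[OF subspace_kernel[OF S f] K(1,3)] .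
  obtain B where B: "K \<subseteq> B" "B \<subseteq> S" "V.independent B" "S \<subseteq> V.span B"
    using V.maximal_independent_subset_extend[of K S] K by blast
  have spB: "V.span B = S" using in_span_basis[OF S B(2,4)] .
  have finB: "finite B" using fd_independent_finite[OF S B(2,3)] .
  define C where "C = B - K"
  have BC: "B = K \<union> C" "K \<inter> C = {}" using B(1) by (auto simp: C_def)
  have spC: "V.span C \<subseteq> S" using V.span_mono[of C B] spB BC by auto
  have inj: "inj_on f (V.span C)"
  proof (subst VP.linear_inj_on_iff_eq_0[OF f V.subspace_span], safe)
    fix x assume "x \<in> V.span C" "f x = 0"
    then have "x \<in> V.span K" using spK spC by auto
    then show "x = 0" using span_disjoint_parts[of K C x] \<open>x \<in> V.span C\<close> B(3) BC by auto
  qed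
  have indC: "V.independent (f ` C)"
    using VP.linear_independent_injective_image[OF f _ inj] V.independent_mono[OF B(3)] BC by auto
  have fK: "f ` K \<subseteq> {0}" using K(1) by auto
  have "f ` S = V.span (f ` B)" using VP.linear_span_image[OF f, of B] spB by simp
  also have "\<dots> = V.span (f ` C)"
  proof
    have "f ` B \<subseteq> insert 0 (f ` C)" using fK BC(1) by auto
    from V.span_mono[OF this] show "V.span (f ` B) \<subseteq> V.span (f ` C)" by simp
    show "V.span (f ` C) \<subseteq> V.span (f ` B)" by (rule V.span_mono) (auto simp: BC)
  qed
  finally have "V.dim (f ` S) = card (f ` C)"
    using V.dim_span_eq_card_independent[OF indC] by simp
  also have "\<dots> = card C"
    by (rule card_image) (rule inj_on_subset[OF inj V.span_superset])
  finally have "V.dim (f ` S) = card C" .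
  moreover have "V.dim S = card B" using V.basis_card_eq_dim[OF B(2,4,3)] by simp
  moreover have "card B = card K + card C"
    using finB BC by (simp add: card_Un_disjoint)
  ultimately show ?thesis using K(4) by simp
qed

lemma dim_image_inj:
  assumes "fd S" "lin f" "\<And>x. x \<in> S \<Longrightarrow> f x = 0 \<Longrightarrow> x = 0"
  shows "V.dim (f ` S) = V.dim S"
proof -
  have "{x \<in> S. f x = 0} \<subseteq> {0}" using assms(3) by auto
  then have "V.dim {x \<in> S. f x = 0} \<le> card ({} :: (nat \<Rightarrow> 'a) set)"
    by (intro V.dim_le_card) (auto simp: V.span_empty)
  then show ?thesis using rank_nullity[OF assms(1,2)] by simp
qed

lemma dim_mono_fd:
  assumes "fd S" "T \<subseteq> S" "V.subspace T" shows "V.dim T \<le> V.dim S"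
proof -
  obtain B where B: "B \<subseteq> T" "V.independent B" "T \<subseteq> V.span B" "card B = V.dim T"
    by (rule V.basis_exists)
  obtain C where C: "B \<subseteq> C" "C \<subseteq> S" "V.independent C" "S \<subseteq> V.span C"
    using V.maximal_independent_subset_extend[of B S] B assms by blast
  have "card B \<le> card C" using fd_independent_finite[OF assms(1) C(2,3)] C(1) by (rule card_mono)
  then show ?thesis using B(4) V.basis_card_eq_dim[OF C(2,4,3)] by simp
qed

text \<open>\<open>W\<close> stands for the projection from \<open>Q\<close> to \<open>Q / B\<close>
  followed by coordinates. It is defined on all sequences, with values in \<open>kn m\<close>
  throughout; the construction of hulls uses this to extend coordinates of \<open>Q / B\<close> to
  functionals on a whole stalk.\<close>

lemma exists_quotient_map:
  assumes Q: "fd Q" and B: "V.subspace B" "B \<subseteq> Q"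
  obtains W m where "lin W" "range W \<subseteq> kn m" "W ` Q = kn m" "{x \<in> Q. W x = 0} = B"
proof -
  have fB: "fd B" using fd_subset[OF Q B(2,1)] .
  obtain K where K: "K \<subseteq> B" "V.independent K" "B \<subseteq> V.span K" "card K = V.dim B"
    by (rule V.basis_exists)
  have spK: "V.span K = B" using in_span_basis[OF fB K(1,3)] .
  obtain D where D: "K \<subseteq> D" "D \<subseteq> Q" "V.independent D" "Q \<subseteq> V.span D"
    using V.maximal_independent_subset_extend[of K Q] K B by blast
  have spD: "V.span D = Q" using in_span_basis[OF Q D(2,4)] .
  have finD: "finite D" using fd_independent_finite[OF Q D(2,3)] .
  define m where "m = card (D - K)"
  obtain h where h: "bij_betw h (D - K) {0..<m}"
    using ex_bij_betw_finite_nat[of "D - K"] finD m_def by auto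
  define W where "W = VP.construct D (\<lambda>b. if b \<in> K then 0 else unit_seq (h b))"
  have lW: "lin W" unfolding W_def by (rule VP.linear_construct[OF D(3)])
  have Wb: "W b = (if b \<in> K then 0 else unit_seq (h b))" if "b \<in> D" for b
    unfolding W_def using VP.construct_basis[OF D(3) that] .
  have hD: "h b < m" if "b \<in> D - K" for b using h that by (auto simp: bij_betw_def)
  have imD: "W ` D \<subseteq> kn m" using hD by (force simp: Wb kn_def unit_seq_def)
  have "W x \<in> V.span ((\<lambda>b. if b \<in> K then 0 else unit_seq (h b)) ` D)" for x
    unfolding W_def by (rule VP.construct_in_span[OF D(3)])
  moreover have "V.span ((\<lambda>b. if b \<in> K then 0 else unit_seq (h b)) ` D) \<subseteq> (kn m :: (nat \<Rightarrow> 'a) set)"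
    by (rule V.span_minimal[OF _ subspace_kn]) (use imD Wb in auto)
  ultimately have "range W \<subseteq> kn m" by auto
  moreover have imQ: "W ` Q = kn m"
  proof
    show "W ` Q \<subseteq> kn m" using calculation by auto
    have "unit_seq j \<in> W ` Q" if j: "j < m" for j
    proof -
      obtain b where b: "b \<in> D - K" "h b = j" using h j that
        by (metis atLeastLessThan_iff bij_betw_imp_surj_on imageE zero_le)
      then have "W b = unit_seq j" using Wb by auto
      then show ?thesis using b D(2) by (metis DiffD1 image_eqI subsetD)
    qed
    then have "V.span (unit_seq ` {..<m}) \<subseteq> W ` Q"
      by (intro V.span_minimal subspace_image[OF fd_subspace[OF Q] lW]) auto
    then show "kn m \<subseteq> W ` Q" using kn_span[of m] by blast
  qed
  moreover have dimD: "V.dim Q = card D" using V.basis_card_eq_dim[OF D(2,4,3)] by simp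
  moreover have "{x \<in> Q. W x = 0} = B"
  proof -
    define C where "C = D - K"
    have DC: "D = K \<union> C" "K \<inter> C = {}" using D(1) by (auto simp: C_def)
    have "W x = 0" if "x \<in> B" for x
      by (rule VP.linear_eq_on_span[OF lW lin_const_0, of K]) (use that spK Wb D(1) in auto)
    then have sub: "B \<subseteq> {x \<in> Q. W x = 0}" using B(2) by auto
    \<comment> \<open>The image has dimension \<open>card D - card K\<close>, which leaves
      \<open>card K\<close>, the dimension of \<open>B\<close>, for the kernel.\<close>
    have "V.dim {x \<in> Q. W x = 0} = V.dim B"
      using rank_nullity[OF Q lW] imQ dim_kn[of m, where 'k='a] dimD K(4) m_def finD D(1)
        card_mono[OF finD D(1)]
      by (simp add: card_Diff_subset finite_subset[OF D(1)])
    \<comment> \<open>A kernel vector outside \<open>B\<close> could be added to the basis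
      \<open>K\<close> of \<open>B\<close>, giving more independent vectors in the kernel than its
      dimension permits.\<close>
    moreover have "x \<in> B" if x: "x \<in> {x \<in> Q. W x = 0}" and d: "V.dim {x \<in> Q. W x = 0} = V.dim B" for x
    proof (rule ccontr)
      assume "x \<notin> B"
      then have iK: "V.independent (insert x K)" using V.independent_insertI K(2) spK by blast
      have sK: "insert x K \<subseteq> {x \<in> Q. W x = 0}" using x sub K(1) by auto
      obtain E where E: "insert x K \<subseteq> E" "E \<subseteq> {x \<in> Q. W x = 0}" "V.independent E"
        "{x \<in> Q. W x = 0} \<subseteq> V.span E"
        by (rule V.maximal_independent_subset_extend[OF sK iK])
      have finE: "finite E" using fd_independent_finite[OF subspace_kernel[OF Q lW] E(2,3)] .
      have "x \<notin> K" using \<open>x \<notin> B\<close> K(1) by auto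
      then have "card K < card E"
        using finE E(1) by (intro psubset_card_mono) auto
      then show False using d K(4) V.basis_card_eq_dim[OF E(2,4,3)] by simp
    qed
    ultimately show ?thesis using sub by blast
  qed
  ultimately show ?thesis using that lW by blast
qed

subsection \<open>Pairs of sequences coded as sequences\<close>

text \<open>Interleaving keeps a direct sum inside the type of sequences. A product type would
  change at each level of the recursion that forms total complexes.\<close>

definition pair :: "(nat \<Rightarrow> 'k) \<Rightarrow> (nat \<Rightarrow> 'k) \<Rightarrow> nat \<Rightarrow> 'k" where
  "pair x y = (\<lambda>i. if even i then x (i div 2) else y (i div 2))"
definition proj1 :: "(nat \<Rightarrow> 'k) \<Rightarrow> nat \<Rightarrow> 'k" where "proj1 z = (\<lambda>i. z (2 * i))"
definition proj2 :: "(nat \<Rightarrow> 'k) \<Rightarrow> nat \<Rightarrow> 'k" where "proj2 z = (\<lambda>i. z (2 * i + 1))"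

lemma proj_pair [simp]: "proj1 (pair x y) = x" "proj2 (pair x y) = y"
  by (auto simp: proj1_def proj2_def pair_def)

lemma pair_inject [simp]: "pair x y = pair x' y' \<longleftrightarrow> x = x' \<and> y = y'"
  by (metis proj_pair)

lemma pair_0: "pair 0 0 = (0 :: nat \<Rightarrow> 'k::field)"
  and pair_add: "pair x y + pair x' y' = pair (x + x') (y + y' :: nat \<Rightarrow> 'k)"
  and pair_scl: "scl c (pair x y) = pair (scl c x) (scl c y :: nat \<Rightarrow> 'k)"
  by (auto simp: pair_def fun_eq_iff)

lemma pair_eq_0 [simp]: "pair x y = (0 :: nat \<Rightarrow> 'k::field) \<longleftrightarrow> x = 0 \<and> y = 0"
  by (metis pair_0 pair_inject)

lemma lin_proj1: "lin proj1" and lin_proj2: "lin proj2"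
  by (rule linI; auto simp: proj1_def proj2_def fun_eq_iff)+

lemma lin_pair: "lin f \<Longrightarrow> lin g \<Longrightarrow> lin (\<lambda>x. pair (f x) (g x))"
  by (rule linI) (simp_all add: lin_add[of f] lin_add[of g] lin_scale[of f] lin_scale[of g] pair_add pair_scl)

lemma lin_plus: "lin f \<Longrightarrow> lin g \<Longrightarrow> lin (\<lambda>x. f x + g x)"
  by (rule VP.linear_compose_add)

lemma lin_minus: "lin f \<Longrightarrow> lin g \<Longrightarrow> lin (\<lambda>x. f x - g x)"
  by (rule VP.linear_compose_sub)

definition pair_set :: "(nat \<Rightarrow> 'k::field) set \<Rightarrow> (nat \<Rightarrow> 'k) set \<Rightarrow> (nat \<Rightarrow> 'k) set" where
  "pair_set A B = {pair x y | x y. x \<in> A \<and> y \<in> B}"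

lemma pair_in_pair_set [simp]: "pair x y \<in> pair_set A B \<longleftrightarrow> x \<in> A \<and> y \<in> B"
  by (auto simp: pair_set_def)

lemma pair_setE: "z \<in> pair_set A B \<Longrightarrow> (\<And>x y. z = pair x y \<Longrightarrow> x \<in> A \<Longrightarrow> y \<in> B \<Longrightarrow> thesis) \<Longrightarrow> thesis"
  by (auto simp: pair_set_def)

lemma fd_pair_set:
  assumes "fd A" "fd B" shows "fd (pair_set A B)"
proof -
  obtain M N where MN: "A \<subseteq> kn M" "B \<subseteq> kn N" using assms by (auto simp: fd_def)
  have "pair_set A B \<subseteq> kn (2 * max M N + 2)"
  proof
    fix z assume "z \<in> pair_set A B"
    then obtain x y where z: "z = pair x y" "x \<in> A" "y \<in> B" by (auto simp: pair_set_def)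
    then have "x \<in> kn M" "y \<in> kn N" using MN by auto
    then show "z \<in> kn (2 * max M N + 2)" unfolding z kn_def pair_def by auto
  qed
  moreover have "V.subspace (pair_set A B)"
  proof (rule V.subspaceI)
    show "0 \<in> pair_set A B" using assms by (auto simp: pair_set_def fd_zero intro!: exI[of _ 0])
    show "x + y \<in> pair_set A B" if "x \<in> pair_set A B" "y \<in> pair_set A B" for x y
      using that assms by (auto elim!: pair_setE simp: pair_add fd_add)
    show "scl c x \<in> pair_set A B" if "x \<in> pair_set A B" for x c
      using that assms by (auto elim!: pair_setE simp: pair_scl fd_scl)
  qed
  ultimately show ?thesis by (auto simp: fd_def)
qed

lemma dim_pair_set:
  assumes "fd A" "fd B" shows "V.dim (pair_set A B) = V.dim A + V.dim B"
proof -
  have "proj2 ` pair_set A B = B" using fd_zero[OF assms(1)]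
    by (force simp: pair_set_def image_iff)
  moreover have "{z \<in> pair_set A B. proj2 z = 0} = (\<lambda>x. pair x 0) ` A"
    using fd_zero[OF assms(2)] by (auto elim!: pair_setE)
  moreover have "V.dim ((\<lambda>x. pair x 0) ` A) = V.dim A"
    by (rule dim_image_inj[OF assms(1)]) (auto intro: lin_pair lin_id lin_const_0)
  ultimately show ?thesis using rank_nullity[OF fd_pair_set[OF assms] lin_proj2] by simp
qed

text \<open>As a simplification rule, \<open>scl_apply\<close> would rewrite eta-expanded occurrences of \<^const>\<open>scl\<close>.\<close>

declare scl_apply [simp del]

section \<open>Cochain complexes of subspaces and mapping cocones\<close>

type_synonym 'k seqs = "(nat \<Rightarrow> 'k) set"
type_synonym 'k seqmap = "(nat \<Rightarrow> 'k) \<Rightarrow> nat \<Rightarrow> 'k"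

definition cpx :: "(int \<Rightarrow> 'k::field seqs) \<Rightarrow> (int \<Rightarrow> 'k seqmap) \<Rightarrow> bool" where
  "cpx A d \<longleftrightarrow> (\<forall>n. fd (A n) \<and> lin (d n) \<and> (\<forall>x\<in>A n. d n x \<in> A (n + 1) \<and> d (n + 1) (d n x) = 0))"

definition cmap :: "(int \<Rightarrow> 'k::field seqs) \<Rightarrow> (int \<Rightarrow> 'k seqmap) \<Rightarrow> (int \<Rightarrow> 'k seqs) \<Rightarrow>
    (int \<Rightarrow> 'k seqmap) \<Rightarrow> (int \<Rightarrow> 'k seqmap) \<Rightarrow> bool" where
  "cmap A d B e f \<longleftrightarrow>
     (\<forall>n. lin (f n) \<and> (\<forall>x\<in>A n. f n x \<in> B n \<and> f (n + 1) (d n x) = e n (f n x)))"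

definition qis :: "(int \<Rightarrow> 'k::field seqs) \<Rightarrow> (int \<Rightarrow> 'k seqmap) \<Rightarrow> (int \<Rightarrow> 'k seqs) \<Rightarrow>
    (int \<Rightarrow> 'k seqmap) \<Rightarrow> (int \<Rightarrow> 'k seqmap) \<Rightarrow> bool" where
  "qis A d B e f \<longleftrightarrow> cmap A d B e f \<and>
     (\<forall>n. (\<forall>x\<in>A n. d n x = 0 \<longrightarrow> f n x \<in> e (n - 1) ` B (n - 1) \<longrightarrow> x \<in> d (n - 1) ` A (n - 1)) \<and>
          (\<forall>y\<in>B n. e n y = 0 \<longrightarrow> (\<exists>x\<in>A n. d n x = 0 \<and> y - f n x \<in> e (n - 1) ` B (n - 1))))"

text \<open>For a complex the coboundaries lie in the cocycles, so the truncated subtraction is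
  exact and gives the dimension of cohomology.\<close>

definition hdim :: "(int \<Rightarrow> 'k::field seqs) \<Rightarrow> (int \<Rightarrow> 'k seqmap) \<Rightarrow> int \<Rightarrow> nat" where
  "hdim A d n = V.dim {x \<in> A n. d n x = 0} - V.dim (d (n - 1) ` A (n - 1))"

lemma cpxD:
  assumes "cpx A d"
  shows "fd (A n)" "lin (d n)" "x \<in> A n \<Longrightarrow> d n x \<in> A (n + 1)"
    "x \<in> A n \<Longrightarrow> d (n + 1) (d n x) = 0"
    "x \<in> A (n - 1) \<Longrightarrow> d (n - 1) x \<in> A n" "x \<in> A (n - 1) \<Longrightarrow> d n (d (n - 1) x) = 0"
proof -
  show "fd (A n)" "lin (d n)" "x \<in> A n \<Longrightarrow> d n x \<in> A (n + 1)"
    "x \<in> A n \<Longrightarrow> d (n + 1) (d n x) = 0"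
    using assms by (auto simp: cpx_def)
  have *: "\<And>m x. x \<in> A m \<Longrightarrow> d m x \<in> A (m + 1) \<and> d (m + 1) (d m x) = 0"
    using assms by (auto simp: cpx_def)
  show "x \<in> A (n - 1) \<Longrightarrow> d (n - 1) x \<in> A n" "x \<in> A (n - 1) \<Longrightarrow> d n (d (n - 1) x) = 0"
    using *[of x "n - 1"] by auto
qed

lemma cmapD:
  assumes "cmap A d B e f"
  shows "lin (f n)" "x \<in> A n \<Longrightarrow> f n x \<in> B n" "x \<in> A n \<Longrightarrow> f (n + 1) (d n x) = e n (f n x)"
    "x \<in> A (n - 1) \<Longrightarrow> f n (d (n - 1) x) = e (n - 1) (f (n - 1) x)"
proof -
  have *: "\<And>m x. x \<in> A m \<Longrightarrow> f (m + 1) (d m x) = e m (f m x)"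
    using assms by (auto simp: cmap_def)
  show "lin (f n)" "x \<in> A n \<Longrightarrow> f n x \<in> B n" "x \<in> A n \<Longrightarrow> f (n + 1) (d n x) = e n (f n x)"
    using assms by (auto simp: cmap_def)
  show "x \<in> A (n - 1) \<Longrightarrow> f n (d (n - 1) x) = e (n - 1) (f (n - 1) x)"
    using *[of x "n - 1"] by auto
qed

lemma qisD:
  assumes "qis A d B e f"
  shows "cmap A d B e f"
    "x \<in> A n \<Longrightarrow> d n x = 0 \<Longrightarrow> y \<in> B (n - 1) \<Longrightarrow> f n x = e (n - 1) y \<Longrightarrow>
      \<exists>z\<in>A (n - 1). x = d (n - 1) z"
    "y \<in> B n \<Longrightarrow> e n y = 0 \<Longrightarrow> \<exists>x\<in>A n. \<exists>z\<in>B (n - 1). d n x = 0 \<and> y = f n x + e (n - 1) z"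
proof -
  show "cmap A d B e f" using assms by (simp add: qis_def)
  show "\<exists>z\<in>A (n - 1). x = d (n - 1) z" if "x \<in> A n" "d n x = 0" "y \<in> B (n - 1)" "f n x = e (n - 1) y"
    using assms that unfolding qis_def by (metis (no_types, lifting) imageE imageI)
  show "\<exists>x\<in>A n. \<exists>z\<in>B (n - 1). d n x = 0 \<and> y = f n x + e (n - 1) z" if y: "y \<in> B n" "e n y = 0"
  proof -
    obtain x where x: "x \<in> A n" "d n x = 0" "y - f n x \<in> e (n - 1) ` B (n - 1)"
      using assms y unfolding qis_def by blast
    then obtain z where "z \<in> B (n - 1)" "y - f n x = e (n - 1) z" by auto
    then show ?thesis using x by (metis add.commute diff_add_cancel)
  qed
qed

lemma qisI:
  assumes "cmap A d B e f"
    and "\<And>n x y. x \<in> A n \<Longrightarrow> d n x = 0 \<Longrightarrow> y \<in> B (n - 1) \<Longrightarrow> f n x = e (n - 1) y \<Longrightarrow>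
      \<exists>z\<in>A (n - 1). x = d (n - 1) z"
    and "\<And>n y. y \<in> B n \<Longrightarrow> e n y = 0 \<Longrightarrow>
      \<exists>x\<in>A n. \<exists>z\<in>B (n - 1). d n x = 0 \<and> y = f n x + e (n - 1) z"
  shows "qis A d B e f"
  unfolding qis_def
proof (intro conjI allI ballI impI)
  show "cmap A d B e f" by fact
  show "x \<in> d (n - 1) ` A (n - 1)" if "x \<in> A n" "d n x = 0" "f n x \<in> e (n - 1) ` B (n - 1)" for n x
    using that(3) assms(2)[OF that(1,2)] by blast
  show "\<exists>x\<in>A n. d n x = 0 \<and> y - f n x \<in> e (n - 1) ` B (n - 1)" if "y \<in> B n" "e n y = 0" for n y
  proof -
    have "\<exists>x\<in>A n. \<exists>z\<in>B (n - 1). d n x = 0 \<and> y = f n x + e (n - 1) z"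
      using assms(3) that by blast
    then obtain x z where "x \<in> A n" "z \<in> B (n - 1)" "d n x = 0" "y = f n x + e (n - 1) z"
      by blast
    then show ?thesis by (intro bexI[of _ x]) auto
  qed
qed

lemma cmap_comp:
  assumes f: "cmap A d B e f" and g: "cmap B e C h g"
  shows "cmap A d C h (\<lambda>n x. g n (f n x))"
  unfolding cmap_def
  using lin_comp[OF cmapD(1)[OF f] cmapD(1)[OF g]] cmapD[OF f] cmapD[OF g] by simp

lemma qis_comp:
  assumes A: "cpx A d" and B: "cpx B e" and C: "cpx C h"
    and f: "qis A d B e f" and g: "qis B e C h g"
  shows "qis A d C h (\<lambda>n x. g n (f n x))"
proof (rule qisI)
  note fm = cmapD[OF qisD(1)[OF f]] and gm = cmapD[OF qisD(1)[OF g]]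
  show "cmap A d C h (\<lambda>n x. g n (f n x))" using f g by (blast intro: cmap_comp qisD)
  show "\<exists>z\<in>A (n - 1). x = d (n - 1) z"
    if x: "x \<in> A n" "d n x = 0" "y \<in> C (n - 1)" "g n (f n x) = h (n - 1) y" for n x y
  proof -
    have "e n (f n x) = 0" using lin_zero[OF fm(1)[of "n + 1"]] fm(3)[OF x(1)] x(2) by simp
    then obtain z where "z \<in> B (n - 1)" "f n x = e (n - 1) z"
      using qisD(2)[OF g, of "f n x" n y] x fm(2) by auto
    then show ?thesis using qisD(2)[OF f x(1,2)] by blast
  qed
  show "\<exists>x\<in>A n. \<exists>z\<in>C (n - 1). d n x = 0 \<and> y = g n (f n x) + h (n - 1) z"
    if y: "y \<in> C n" "h n y = 0" for n y
  proof -
    obtain b z where b: "b \<in> B n" "z \<in> C (n - 1)" "e n b = 0" "y = g n b + h (n - 1) z"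
      using qisD(3)[OF g y] by blast
    obtain a w where a: "a \<in> A n" "w \<in> B (n - 1)" "d n a = 0" "b = f n a + e (n - 1) w"
      using qisD(3)[OF f b(1,3)] by blast
    have "y = g n (f n a) + h (n - 1) (g (n - 1) w + z)"
      using a b gm(4)[OF a(2)] cpxD(2)[OF C, of "n - 1"] gm(1)[of n]
      by (simp add: lin_add[where f = "g n"] lin_add[where f = "h (n - 1)"] add.assoc)
    moreover have "g (n - 1) w + z \<in> C (n - 1)"
      using fd_add[OF cpxD(1)[OF C]] gm(2)[OF a(2)] b(2) by blast
    ultimately show ?thesis using a by blast
  qed
qed

text \<open>The map \<open>(z, b) \<mapsto> f z + b\<close> from cocycles and coboundaries onto the cocycles of the target has the
  coboundaries of the source as its kernel.\<close>

lemma hdim_qis: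
  assumes A: "cpx A d" and B: "cpx B e" and f: "qis A d B e f"
  shows "hdim A d n = hdim B e n"
proof -
  note fm = cmapD[OF qisD(1)[OF f]]
  let ?Z = "{x \<in> A n. d n x = 0}" and ?Y = "{x \<in> B n. e n x = 0}"
  let ?I = "d (n - 1) ` A (n - 1)" and ?J = "e (n - 1) ` B (n - 1)"
  have fZ: "fd ?Z" "fd ?Y" using subspace_kernel cpxD A B by blast+
  have IZ: "?I \<subseteq> ?Z" "?J \<subseteq> ?Y" using cpxD[OF A] cpxD[OF B] by auto
  have fI: "fd ?I" "fd ?J"
    using fd_subset[OF fZ(1) IZ(1)] fd_subset[OF fZ(2) IZ(2)]
      subspace_image[OF fd_subspace[OF cpxD(1)[OF A]] cpxD(2)[OF A]]
      subspace_image[OF fd_subspace[OF cpxD(1)[OF B]] cpxD(2)[OF B]] by auto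
  define g where "g = (\<lambda>z. f n (proj1 z) + proj2 z)"
  have lg: "lin g" unfolding g_def
    by (intro lin_plus lin_comp[OF lin_proj1 fm(1)] lin_proj2)
  have fZY: "f n x \<in> ?Y" if "x \<in> ?Z" for x
    using that fm(2)[of x n] fm(3)[of x n] lin_zero[OF fm(1)[of "n+1"]] by auto
  have im: "g ` pair_set ?Z ?J = ?Y"
  proof
    show "g ` pair_set ?Z ?J \<subseteq> ?Y"
    proof
      fix y assume "y \<in> g ` pair_set ?Z ?J"
      then obtain z where z: "z \<in> pair_set ?Z ?J" "y = g z" by blast
      from z(1) obtain a b where "a \<in> ?Z" "b \<in> ?J" "z = pair a b" by (rule pair_setE)
      then have "a \<in> ?Z" "b \<in> ?J" "y = f n a + b" using z(2) by (simp_all add: g_def)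
      then show "y \<in> ?Y" using fd_add[OF fZ(2) fZY, of a b] IZ(2) by blast
    qed
    show "?Y \<subseteq> g ` pair_set ?Z ?J"
    proof
      fix y assume "y \<in> ?Y"
      then obtain x z where "x \<in> A n" "z \<in> B (n - 1)" "d n x = 0" "y = f n x + e (n - 1) z"
        using qisD(3)[OF f] by blast
      then have "y = g (pair x (e (n - 1) z))" "pair x (e (n - 1) z) \<in> pair_set ?Z ?J"
        by (auto simp: g_def)
      then show "y \<in> g ` pair_set ?Z ?J" by blast
    qed
  qed
  have ker: "{z \<in> pair_set ?Z ?J. g z = 0} = (\<lambda>x. pair x (- f n x)) ` ?I"
  proof
    show "{z \<in> pair_set ?Z ?J. g z = 0} \<subseteq> (\<lambda>x. pair x (- f n x)) ` ?I"
    proof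
      fix z assume "z \<in> {z \<in> pair_set ?Z ?J. g z = 0}"
      then obtain a b where ab: "z = pair a b" "a \<in> ?Z" "b \<in> ?J" "f n a + b = 0"
        by (auto simp: g_def elim!: pair_setE)
      then have b: "b = - f n a" by (simp add: eq_neg_iff_add_eq_0 add.commute)
      then have "f n a \<in> ?J" using fd_neg[OF fI(2) ab(3)] by simp
      then obtain y where "y \<in> B (n - 1)" "f n a = e (n - 1) y" by auto
      then have "a \<in> ?I" using qisD(2)[OF f, of a n y] ab(2) by auto
      then show "z \<in> (\<lambda>x. pair x (- f n x)) ` ?I" using ab(1) b by auto
    qed
    show "(\<lambda>x. pair x (- f n x)) ` ?I \<subseteq> {z \<in> pair_set ?Z ?J. g z = 0}"
    proof
      fix z assume "z \<in> (\<lambda>x. pair x (- f n x)) ` ?I"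
      then obtain x where x: "x \<in> ?I" "z = pair x (- f n x)" by auto
      then obtain a where a: "a \<in> A (n - 1)" "x = d (n - 1) a" by auto
      have "f n x = e (n - 1) (f (n - 1) a)" using fm(4)[OF a(1)] a(2) by simp
      then have "f n x \<in> ?J" using fm(2)[OF a(1)] by auto
      then show "z \<in> {z \<in> pair_set ?Z ?J. g z = 0}"
        using x IZ(1) fd_neg[OF fI(2)] by (auto simp: g_def)
    qed
  qed
  have "V.dim ((\<lambda>x. pair x (- f n x)) ` ?I) = V.dim ?I"
    by (rule dim_image_inj[OF fI(1)])
      (auto intro: lin_pair[OF lin_id VP.linear_compose_neg[OF fm(1)]])
  then have "V.dim ?Z + V.dim ?J = V.dim ?I + V.dim ?Y"
    using rank_nullity[OF fd_pair_set[OF fZ(1) fI(2)] lg] dim_pair_set[OF fZ(1) fI(2)]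
    unfolding im ker by simp
  then show ?thesis
    using dim_mono_fd[OF fZ(1) IZ(1) fd_subspace[OF fI(1)]] dim_mono_fd[OF fZ(2) IZ(2) fd_subspace[OF fI(2)]]
    by (simp add: hdim_def)
qed

lemma hdim_le: "cpx A d \<Longrightarrow> hdim A d n \<le> V.dim (A n)"
  unfolding hdim_def
  using dim_mono_fd[of "A n" "{x \<in> A n. d n x = 0}"] subspace_kernel[of "A n" "d n"] cpxD(1,2)[of A d n]
  by (auto dest: fd_subspace intro: le_trans[OF diff_le_self])

lemma hdim_eq_dim:
  assumes "cpx A d" "\<And>x n. x \<in> A n \<Longrightarrow> d n x = 0"
  shows "hdim A d n = V.dim (A n)"
proof -
  have "V.dim (d (n - 1) ` A (n - 1)) \<le> V.dim ({0} :: 'a seqs)"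
    by (rule dim_mono_fd[OF fd_0])
      (use assms subspace_image[OF fd_subspace[OF cpxD(1)[OF assms(1)]] cpxD(2)[OF assms(1)]]
        in \<open>blast+\<close>)
  also have "\<dots> = 0" using V.dim_le_card[of "{0}" "{}"] by simp
  finally have "V.dim (d (n - 1) ` A (n - 1)) = 0" by simp
  moreover have "{x \<in> A n. d n x = 0} = A n" using assms(2) by auto
  ultimately show ?thesis by (simp add: hdim_def)
qed

text \<open>Passing to cohomology loses the ranks of the outgoing and the incoming differential,
  each bounded by the dimension of the neighbouring term. This is the source of the lower bound on
  multiplicities in skeleta.\<close>

lemma dim_le_hdim:
  assumes A: "cpx A d"
  shows "V.dim (A n) \<le> hdim A d n + V.dim (A (n - 1)) + V.dim (A (n + 1))"
proof -
  have "V.dim (A n) = V.dim {x \<in> A n. d n x = 0} + V.dim (d n ` A n)"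
    by (rule rank_nullity[OF cpxD(1,2)[OF A]])
  moreover have "V.dim (d n ` A n) \<le> V.dim (A (n + 1))"
    by (rule dim_mono_fd[OF cpxD(1)[OF A]])
      (use cpxD[OF A] subspace_image[OF fd_subspace[OF cpxD(1)[OF A]] cpxD(2)[OF A]] in auto)
  moreover have "V.dim (A (n - 1)) = V.dim {x \<in> A (n - 1). d (n - 1) x = 0} + V.dim (d (n - 1) ` A (n - 1))"
    by (rule rank_nullity[OF cpxD(1,2)[OF A]])
  ultimately show ?thesis by (simp add: hdim_def)
qed

subsection \<open>Mapping cocones\<close>

definition cocone_obj :: "(int \<Rightarrow> 'k::field seqs) \<Rightarrow> (int \<Rightarrow> 'k seqs) \<Rightarrow> int \<Rightarrow> 'k seqs" where
  "cocone_obj A B n = pair_set (A n) (B (n - 1))"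

text \<open>The mapping cone of \<open>u\<close>, shifted by one degree. The minus sign makes the
  square vanish: its second component is \<open>u d x - e (u x - e y)\<close>.\<close>

definition cocone_diff :: "(int \<Rightarrow> 'k::field seqmap) \<Rightarrow> (int \<Rightarrow> 'k seqmap) \<Rightarrow> (int \<Rightarrow> 'k seqmap) \<Rightarrow>
    int \<Rightarrow> 'k seqmap" where
  "cocone_diff d e u n z = pair (d n (proj1 z)) (u n (proj1 z) - e (n - 1) (proj2 z))"

definition pair_map :: "(int \<Rightarrow> 'k::field seqmap) \<Rightarrow> (int \<Rightarrow> 'k seqmap) \<Rightarrow> int \<Rightarrow> 'k seqmap" where
  "pair_map f g n z = pair (f n (proj1 z)) (g (n - 1) (proj2 z))"

lemma cocone_diff_pair [simp]:
  "cocone_diff d e u n (pair x y) = pair (d n x) (u n x - e (n - 1) y)"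
  by (simp add: cocone_diff_def)

lemma pair_map_pair [simp]: "pair_map f g n (pair x y) = pair (f n x) (g (n - 1) y)"
  by (simp add: pair_map_def)

lemma lin_pair_map: "lin (f n) \<Longrightarrow> lin (g (n - 1)) \<Longrightarrow> lin (pair_map f g n)"
  unfolding pair_map_def by (intro lin_pair lin_comp[OF lin_proj1] lin_comp[OF lin_proj2])

lemma cpx_cocone:
  assumes A: "cpx A d" and B: "cpx B e" and u: "cmap A d B e u"
  shows "cpx (cocone_obj A B) (cocone_diff d e u)"
  unfolding cpx_def
proof (intro allI conjI ballI)
  fix n
  note Ad = cpxD[OF A] and Bd = cpxD[OF B] and ud = cmapD[OF u]
  show "fd (cocone_obj A B n)"
    unfolding cocone_obj_def by (intro fd_pair_set Ad Bd)
  show "lin (cocone_diff d e u n)"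
    unfolding cocone_diff_def
    by (intro lin_pair lin_minus lin_comp[OF lin_proj1] lin_comp[OF lin_proj2] Ad Bd ud)
  fix z assume "z \<in> cocone_obj A B n"
  then obtain x y where z: "z = pair x y" "x \<in> A n" "y \<in> B (n - 1)"
    by (auto simp: cocone_obj_def elim: pair_setE)
  show "cocone_diff d e u n z \<in> cocone_obj A B (n + 1)"
    using z Ad(3) Bd(5) ud(2) fd_diff[OF Bd(1)] by (auto simp: cocone_obj_def)
  show "cocone_diff d e u (n + 1) (cocone_diff d e u n z) = 0"
    using z Ad(4) Bd(6) ud(3) Bd(2)[of n] by (simp add: lin_diff[where f = "e n"])
qed

lemma cmap_pair_map:
  assumes f: "cmap A d A' d' f" and g: "cmap B e B' e' g"
    and comm: "\<And>n x. x \<in> A n \<Longrightarrow> g n (u n x) = u' n (f n x)"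
  shows "cmap (cocone_obj A B) (cocone_diff d e u) (cocone_obj A' B') (cocone_diff d' e' u') (pair_map f g)"
  unfolding cmap_def
proof (intro allI conjI ballI)
  note fd' = cmapD[OF f] and gd = cmapD[OF g]
  fix n
  show "lin (pair_map f g n)" by (intro lin_pair_map fd' gd)
  fix z assume "z \<in> cocone_obj A B n"
  then obtain x y where z: "z = pair x y" "x \<in> A n" "y \<in> B (n - 1)"
    by (auto simp: cocone_obj_def elim: pair_setE)
  show "pair_map f g n z \<in> cocone_obj A' B' n" using z fd'(2) gd(2) by (auto simp: cocone_obj_def)
  show "pair_map f g (n + 1) (cocone_diff d e u n z) = cocone_diff d' e' u' n (pair_map f g n z)"
    using z fd'(3) gd(4) comm gd(1)[of n] by (simp add: lin_diff[where f = "g n"])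
qed

text \<open>In terms of long exact sequences this is the five lemma; here it is a chase with
  elements, which never forms cohomology groups.\<close>

lemma qis_pair_map:
  assumes A: "cpx A d" and B: "cpx B e" and A': "cpx A' d'" and B': "cpx B' e'"
    and u: "cmap A d B e u" and u': "cmap A' d' B' e' u'"
    and f: "qis A d A' d' f" and g: "qis B e B' e' g"
    and comm: "\<And>n x. x \<in> A n \<Longrightarrow> g n (u n x) = u' n (f n x)"
  shows "qis (cocone_obj A B) (cocone_diff d e u) (cocone_obj A' B') (cocone_diff d' e' u') (pair_map f g)"
proof (rule qisI)
  note Ad = cpxD[OF A] and Bd = cpxD[OF B] and ud = cmapD[OF u]
  note Ad' = cpxD[OF A'] and Bd' = cpxD[OF B'] and ud' = cmapD[OF u']
  note fm = cmapD[OF qisD(1)[OF f]] and gm = cmapD[OF qisD(1)[OF g]]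
  note lins = lin_diff[OF Ad(2)] lin_diff[OF Bd(2)] lin_diff[OF ud(1)]
    lin_diff[OF Ad'(2)] lin_diff[OF Bd'(2)] lin_diff[OF ud'(1)] lin_diff[OF fm(1)] lin_diff[OF gm(1)]
    lin_add[OF Ad(2)] lin_add[OF Bd(2)] lin_add[OF ud(1)]
    lin_add[OF Ad'(2)] lin_add[OF Bd'(2)] lin_add[OF ud'(1)] lin_add[OF fm(1)] lin_add[OF gm(1)]
    lin_zero[OF gm(1)] lin_zero[OF fm(1)] lin_zero[OF ud'(1)]
  show "cmap (cocone_obj A B) (cocone_diff d e u) (cocone_obj A' B') (cocone_diff d' e' u') (pair_map f g)"
    by (rule cmap_pair_map[OF qisD(1)[OF f] qisD(1)[OF g]]) (rule comm)
  show "\<exists>z\<in>cocone_obj A B (n - 1). w = cocone_diff d e u (n - 1) z"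
    if w: "w \<in> cocone_obj A B n" "cocone_diff d e u n w = 0" and t: "t \<in> cocone_obj A' B' (n - 1)"
      "pair_map f g n w = cocone_diff d' e' u' (n - 1) t" for n w t
  proof -
    obtain x y where xy: "w = pair x y" "x \<in> A n" "y \<in> B (n - 1)"
      using w by (auto simp: cocone_obj_def elim: pair_setE)
    obtain a b where ab: "t = pair a b" "a \<in> A' (n - 1)" "b \<in> B' (n - 1 - 1)"
      using t by (auto simp: cocone_obj_def elim: pair_setE)
    have 1: "d n x = 0" "u n x = e (n - 1) y" using w(2) xy(1) by auto
    have 2: "f n x = d' (n - 1) a" "g (n - 1) y = u' (n - 1) a - e' (n - 1 - 1) b"
      using t(2) xy(1) ab(1) by auto
    obtain c where c: "c \<in> A (n - 1)" "x = d (n - 1) c"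
      using qisD(2)[OF f xy(2) 1(1) ab(2) 2(1)] by blast
    \<comment> \<open>Although \<open>d c = x\<close>, the image of \<open>c\<close> may differ from
      \<open>a\<close> by a cocycle. Surjectivity of \<open>f\<close> on cohomology supplies a
      cocycle \<open>c1\<close> such that \<open>c2 = c + c1\<close> maps to \<open>a\<close> up to
      a coboundary.\<close>
    have z1: "a - f (n - 1) c \<in> A' (n - 1)" using fd_diff[OF Ad'(1)] ab(2) fm(2) c by blast
    have "d' (n - 1) (a - f (n - 1) c) = 0"
      using 2(1) c fm(4)[OF c(1)] by (simp add: lins)
    then obtain c1 a1 where c1: "c1 \<in> A (n - 1)" "a1 \<in> A' (n - 1 - 1)" "d (n - 1) c1 = 0"
      "a - f (n - 1) c = f (n - 1) c1 + d' (n - 1 - 1) a1"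
      using qisD(3)[OF f z1] by blast
    define c2 where "c2 = c + c1"
    have c2: "c2 \<in> A (n - 1)" "d (n - 1) c2 = x"
      using c c1 fd_add[OF Ad(1)] by (auto simp: c2_def lins)
    have a: "a = f (n - 1) c2 + d' (n - 1 - 1) a1"
      using c1(4) by (simp add: c2_def lins algebra_simps)
    \<comment> \<open>The defect of \<open>pair c2 0\<close> as a primitive of \<open>w\<close>. Its
      image under \<open>g\<close> is a coboundary, so it is itself a coboundary
      \<open>e b1\<close>, and \<open>pair c2 b1\<close> is a primitive of \<open>w\<close>.\<close>
    define y1 where "y1 = u (n - 1) c2 - y"
    have y1: "y1 \<in> B (n - 1)" unfolding y1_def using fd_diff[OF Bd(1)] ud(2) c2 xy by blast
    have ey1: "e (n - 1) y1 = 0"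
      unfolding y1_def using ud(4)[OF c2(1)] 1(2) c2(2) by (simp add: lins)
    have "g (n - 1) y1 = u' (n - 1) (f (n - 1) c2) - (u' (n - 1) a - e' (n - 1 - 1) b)"
      unfolding y1_def using 2(2) comm[OF c2(1)] by (simp add: lins)
    also have "\<dots> = e' (n - 1 - 1) (b - u' (n - 1 - 1) a1)"
      using ud'(4)[OF c1(2)] by (simp add: a lins)
    finally obtain b1 where b1: "b1 \<in> B (n - 1 - 1)" "y1 = e (n - 1 - 1) b1"
      using qisD(2)[OF g y1 ey1] fd_diff[OF Bd'(1) ab(3) ud'(2)[OF c1(2)]] by blast
    have "w = cocone_diff d e u (n - 1) (pair c2 b1)"
      using xy(1) c2(2) b1(2) by (auto simp: y1_def algebra_simps)
    moreover have "pair c2 b1 \<in> cocone_obj A B (n - 1)"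
      using c2(1) b1(1) by (simp add: cocone_obj_def)
    ultimately show ?thesis by blast
  qed
  show "\<exists>w\<in>cocone_obj A B n. \<exists>z\<in>cocone_obj A' B' (n - 1). cocone_diff d e u n w = 0 \<and>
      t = pair_map f g n w + cocone_diff d' e' u' (n - 1) z"
    if t: "t \<in> cocone_obj A' B' n" "cocone_diff d' e' u' n t = 0" for n t
  proof -
    obtain x y where xy: "t = pair x y" "x \<in> A' n" "y \<in> B' (n - 1)"
      using t by (auto simp: cocone_obj_def elim: pair_setE)
    have 1: "d' n x = 0" "u' n x = e' (n - 1) y" using t(2) xy(1) by auto
    obtain a c where a: "a \<in> A n" "c \<in> A' (n - 1)" "d n a = 0" "x = f n a + d' (n - 1) c"
      using qisD(3)[OF f xy(2) 1(1)] by blast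
    have "e n (u n a) = 0" using ud(3)[OF a(1)] a(3) lin_zero[OF ud(1)[of "n + 1"]] by simp
    moreover have "g n (u n a) = e' (n - 1) (y - u' (n - 1) c)"
      using comm[OF a(1)] 1(2) a(4) ud'(4)[OF a(2)] by (simp add: lins algebra_simps)
    ultimately obtain b where b: "b \<in> B (n - 1)" "u n a = e (n - 1) b"
      using qisD(2)[OF g ud(2)[OF a(1)]] fd_diff[OF Bd'(1) xy(3) ud'(2)[OF a(2)]] by blast
    \<comment> \<open>What remains of \<open>y\<close> after the lift \<open>pair a b\<close> and
      the coboundary of \<open>pair c 0\<close> are removed; being a cocycle, it comes from a
      cocycle \<open>b1\<close> of the source up to a coboundary.\<close>
    define y1 where "y1 = y - u' (n - 1) c - g (n - 1) b"
    have y1: "y1 \<in> B' (n - 1)" unfolding y1_def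
      using fd_diff[OF Bd'(1) fd_diff[OF Bd'(1) xy(3) ud'(2)[OF a(2)]] gm(2)[OF b(1)]] .
    have "e' (n - 1) (g (n - 1) b) = g n (u n a)" using gm(4)[OF b(1)] b(2) by simp
    then have "e' (n - 1) y1 = 0"
      unfolding y1_def using \<open>g n (u n a) = _\<close> by (simp add: lins)
    then obtain b1 z where b1: "b1 \<in> B (n - 1)" "z \<in> B' (n - 1 - 1)" "e (n - 1) b1 = 0"
      "y1 = g (n - 1) b1 + e' (n - 1 - 1) z"
      using qisD(3)[OF g y1] by blast
    define w where "w = pair a (b + b1)"
    have "w \<in> cocone_obj A B n" using a b b1 fd_add[OF Bd(1)] by (auto simp: w_def cocone_obj_def)
    moreover have "cocone_diff d e u n w = 0" using a b b1 by (auto simp: w_def lins)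
    \<comment> \<open>The sign of \<open>z\<close> cancels the minus sign in the cocone
      differential.\<close>
    moreover have "pair c (- z) \<in> cocone_obj A' B' (n - 1)"
      using a b1 fd_neg[OF Bd'(1)] by (auto simp: cocone_obj_def)
    moreover have "t = pair_map f g n w + cocone_diff d' e' u' (n - 1) (pair c (- z))"
    proof -
      have "y = g (n - 1) (b + b1) + (u' (n - 1) c - e' (n - 1 - 1) (- z))"
        using b1(4) unfolding y1_def by (simp add: lins lin_neg[OF Bd'(2)] algebra_simps)
      then show ?thesis by (simp add: xy(1) w_def a(4) pair_add)
    qed
    ultimately show ?thesis by blast
  qed
qed

text \<open>A degreewise surjective \<open>u\<close> has its kernel as cocone: the second component
  of a cochain is lifted along \<open>u\<close>, and subtracting the coboundary of the lift removes
  it.\<close>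

lemma qis_kernel_cocone:
  assumes A: "cpx A d" and B: "cpx B e" and u: "cmap A d B e u"
    and surj: "\<And>n y. y \<in> B n \<Longrightarrow> \<exists>x\<in>A n. u n x = y"
  shows "qis (\<lambda>n. {x \<in> A n. u n x = 0}) d (cocone_obj A B) (cocone_diff d e u) (\<lambda>n x. pair x 0)"
proof (rule qisI)
  note Ad = cpxD[OF A] and Bd = cpxD[OF B] and ud = cmapD[OF u]
  note lins = lin_diff[OF Ad(2)] lin_diff[OF Bd(2)] lin_diff[OF ud(1)] lin_zero[OF Bd(2)] lin_zero[OF ud(1)]
  show "cmap (\<lambda>n. {x \<in> A n. u n x = 0}) d (cocone_obj A B) (cocone_diff d e u) (\<lambda>n x. pair x 0)"
    unfolding cmap_def
    by (auto simp: cocone_obj_def lins fd_zero[OF Bd(1)] intro: lin_pair[OF lin_id lin_const_0])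
  show "\<exists>z\<in>{x \<in> A (n - 1). u (n - 1) x = 0}. x = d (n - 1) z"
    if x: "x \<in> {x \<in> A n. u n x = 0}" "d n x = 0" and t: "t \<in> cocone_obj A B (n - 1)"
      "pair x 0 = cocone_diff d e u (n - 1) t" for n x t
  proof -
    obtain a b where ab: "t = pair a b" "a \<in> A (n - 1)" "b \<in> B (n - 1 - 1)"
      using t by (auto simp: cocone_obj_def elim: pair_setE)
    then have 1: "x = d (n - 1) a" "u (n - 1) a = e (n - 1 - 1) b" using t(2) by auto
    \<comment> \<open>The primitive \<open>a\<close> need not lie in the kernel of \<open>u\<close>,
      but \<open>u a = e b\<close>. Subtracting \<open>d c\<close> for a lift \<open>c\<close> of
      \<open>b\<close> moves it into the kernel without changing its differential.\<close>
    obtain c where c: "c \<in> A (n - 1 - 1)" "u (n - 1 - 1) c = b" using surj[OF ab(3)] by blast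
    have "a - d (n - 1 - 1) c \<in> {x \<in> A (n - 1). u (n - 1) x = 0}"
      using fd_diff[OF Ad(1) ab(2) Ad(5)[OF c(1)]] ud(4)[OF c(1)] c 1 by (simp add: lins)
    moreover have "d (n - 1) (a - d (n - 1 - 1) c) = x" using Ad(6)[OF c(1)] 1 by (simp add: lins)
    ultimately show ?thesis by blast
  qed
  show "\<exists>x\<in>{x \<in> A n. u n x = 0}. \<exists>z\<in>cocone_obj A B (n - 1). d n x = 0 \<and>
      t = pair x 0 + cocone_diff d e u (n - 1) z"
    if t: "t \<in> cocone_obj A B n" "cocone_diff d e u n t = 0" for n t
  proof -
    obtain x y where xy: "t = pair x y" "x \<in> A n" "y \<in> B (n - 1)"
      using t by (auto simp: cocone_obj_def elim: pair_setE)
    have 1: "d n x = 0" "u n x = e (n - 1) y" using t(2) xy(1) by auto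
    obtain a where a: "a \<in> A (n - 1)" "u (n - 1) a = y" using surj[OF xy(3)] by blast
    have "x - d (n - 1) a \<in> {x \<in> A n. u n x = 0}"
      using fd_diff[OF Ad(1) xy(2) Ad(5)[OF a(1)]] ud(4)[OF a(1)] a 1 by (simp add: lins)
    moreover have "d n (x - d (n - 1) a) = 0" using 1 Ad(6)[OF a(1)] by (simp add: lins)
    moreover have "t = pair (x - d (n - 1) a) 0 + cocone_diff d e u (n - 1) (pair a 0)"
      using a by (simp add: xy(1) pair_add lins)
    moreover have "pair a 0 \<in> cocone_obj A B (n - 1)"
      using a fd_zero[OF Bd(1)] by (auto simp: cocone_obj_def)
    ultimately show ?thesis by blast
  qed
qed

section \<open>Cubical diagrams of complexes and their total complexes\<close>

text \<open>The map \<open>r s v\<close> goes from the complex at \<open>s\<close> to the complex at \<open>insert v s\<close>, also if \<open>v \<in> s\<close>.\<close>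

definition diagram :: "('v set \<Rightarrow> int \<Rightarrow> 'k::field seqs) \<Rightarrow> ('v set \<Rightarrow> int \<Rightarrow> 'k seqmap) \<Rightarrow>
    ('v set \<Rightarrow> 'v \<Rightarrow> int \<Rightarrow> 'k seqmap) \<Rightarrow> bool" where
  "diagram A d r \<longleftrightarrow> (\<forall>s. cpx (A s) (d s)) \<and>
     (\<forall>s v. cmap (A s) (d s) (A (insert v s)) (d (insert v s)) (r s v)) \<and>
     (\<forall>s v w n. \<forall>x\<in>A s n. r (insert v s) w n (r s v n x) = r (insert w s) v n (r s w n x))"

definition diagram_qis where
  "diagram_qis A d r A' d' r' f \<longleftrightarrow> (\<forall>s. qis (A s) (d s) (A' s) (d' s) (f s)) \<and>
     (\<forall>s v n. \<forall>x\<in>A s n. f (insert v s) n (r s v n x) = r' s v n (f s n x))"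

lemma diagramD:
  assumes "diagram A d r"
  shows "cpx (A s) (d s)" "cmap (A s) (d s) (A (insert v s)) (d (insert v s)) (r s v)"
    "x \<in> A s n \<Longrightarrow> r (insert v s) w n (r s v n x) = r (insert w s) v n (r s w n x)"
  using assms by (auto simp: diagram_def)

lemma diagram_qisD:
  assumes "diagram_qis A d r A' d' r' f"
  shows "qis (A s) (d s) (A' s) (d' s) (f s)"
    "x \<in> A s n \<Longrightarrow> f (insert v s) n (r s v n x) = r' s v n (f s n x)"
  using assms by (auto simp: diagram_qis_def)

text \<open>For distinct \<open>vs\<close> disjoint from \<open>s\<close>, degree \<open>n\<close>
  is the direct sum of \<open>A (s \<union> S) (n - card S)\<close> over all
  \<open>S \<subseteq> set vs\<close>. Building it vertex by vertex reduces every property to that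
  of a single cocone.\<close>

fun tot_obj :: "'v list \<Rightarrow> ('v set \<Rightarrow> int \<Rightarrow> 'k::field seqs) \<Rightarrow> 'v set \<Rightarrow> int \<Rightarrow> 'k seqs" where
  "tot_obj [] A s = A s"
| "tot_obj (v # vs) A s = cocone_obj (tot_obj vs A s) (tot_obj vs A (insert v s))"

fun tot_map :: "'v list \<Rightarrow> ('v set \<Rightarrow> int \<Rightarrow> 'k::field seqmap) \<Rightarrow> 'v set \<Rightarrow> int \<Rightarrow> 'k seqmap" where
  "tot_map [] f s = f s"
| "tot_map (v # vs) f s = pair_map (tot_map vs f s) (tot_map vs f (insert v s))"

fun tot_diff :: "'v list \<Rightarrow> ('v set \<Rightarrow> int \<Rightarrow> 'k::field seqmap) \<Rightarrow> ('v set \<Rightarrow> 'v \<Rightarrow> int \<Rightarrow> 'k seqmap) \<Rightarrow>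
    'v set \<Rightarrow> int \<Rightarrow> 'k seqmap" where
  "tot_diff [] d r s = d s"
| "tot_diff (v # vs) d r s =
     cocone_diff (tot_diff vs d r s) (tot_diff vs d r (insert v s)) (tot_map vs (\<lambda>t. r t v) s)"

text \<open>That each total complex is a complex would be too weak for the induction: the next
  cocone is taken along \<open>tot_map vs (\<lambda>t. r t v) s\<close>, so the total complexes have
  to form a commuting diagram in \<open>s\<close> again.\<close>

lemma diagram_tot:
  assumes "diagram A d r"
  shows "diagram (tot_obj vs A) (tot_diff vs d r) (\<lambda>s w. tot_map vs (\<lambda>t. r t w) s)"
proof (induction vs)
  case Nil
  show ?case using assms by simp
next
  case (Cons v vs)
  note D = diagramD[OF Cons]
  show ?case
    unfolding diagram_def
  proof (intro conjI allI ballI)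
    fix s
    show "cpx (tot_obj (v # vs) A s) (tot_diff (v # vs) d r s)"
      using cpx_cocone[OF D(1) D(1) D(2)] by simp
  next
    fix s w
    show "cmap (tot_obj (v # vs) A s) (tot_diff (v # vs) d r s) (tot_obj (v # vs) A (insert w s))
       (tot_diff (v # vs) d r (insert w s)) (tot_map (v # vs) (\<lambda>t. r t w) s)"
      using cmap_pair_map[where u = "tot_map vs (\<lambda>t. r t v) s" and u' = "tot_map vs (\<lambda>t. r t v) (insert w s)",
        OF D(2)[of s w] D(2)[of "insert v s" w, unfolded insert_commute[of w v s]] D(3)]
      by simp
  next
    fix s u w n x
    assume "x \<in> tot_obj (v # vs) A s n"
    then obtain a b where "x = pair a b" "a \<in> tot_obj vs A s n" "b \<in> tot_obj vs A (insert v s) (n - 1)"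
      by (auto simp: cocone_obj_def elim: pair_setE)
    then show "tot_map (v # vs) (\<lambda>t. r t w) (insert u s) n (tot_map (v # vs) (\<lambda>t. r t u) s n x) =
       tot_map (v # vs) (\<lambda>t. r t u) (insert w s) n (tot_map (v # vs) (\<lambda>t. r t w) s n x)"
      using D(3)[of a s n w u] D(3)[of b "insert v s" "n - 1" w u] by (simp add: insert_commute)
  qed
qed

text \<open>Each cocone preserves quasi-isomorphisms by \<open>qis_pair_map\<close>; compatibility
  with the maps of the diagram is carried along because that lemma asks for it at the next
  vertex.\<close>

lemma diagram_qis_tot:
  assumes A: "diagram A d r" and A': "diagram A' d' r'" and f: "diagram_qis A d r A' d' r' f"
  shows "diagram_qis (tot_obj vs A) (tot_diff vs d r) (\<lambda>s w. tot_map vs (\<lambda>t. r t w) s)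
    (tot_obj vs A') (tot_diff vs d' r') (\<lambda>s w. tot_map vs (\<lambda>t. r' t w) s) (tot_map vs f)"
proof (induction vs)
  case Nil
  show ?case using f by simp
next
  case (Cons v vs)
  note D = diagramD[OF diagram_tot[OF A]] and D' = diagramD[OF diagram_tot[OF A']]
    and F = diagram_qisD[OF Cons]
  show ?case
    unfolding diagram_qis_def
  proof (intro conjI allI ballI)
    fix s
    show "qis (tot_obj (v # vs) A s) (tot_diff (v # vs) d r s) (tot_obj (v # vs) A' s)
        (tot_diff (v # vs) d' r' s) (tot_map (v # vs) f s)"
      using qis_pair_map[OF D(1) D(1) D'(1) D'(1) D(2) D'(2) F(1) F(1) F(2)] by simp
  next
    fix s w n x
    assume "x \<in> tot_obj (v # vs) A s n"
    then obtain a b where "x = pair a b" "a \<in> tot_obj vs A s n" "b \<in> tot_obj vs A (insert v s) (n - 1)"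
      by (auto simp: cocone_obj_def elim: pair_setE)
    then show "tot_map (v # vs) f (insert w s) n (tot_map (v # vs) (\<lambda>t. r t w) s n x) =
       tot_map (v # vs) (\<lambda>t. r' t w) s n (tot_map (v # vs) f s n x)"
      using F(2)[of a s n w] F(2)[of b "insert v s" "n - 1" w] by (simp add: insert_commute)
  qed
qed

lemma hdim_tot_cong:
  assumes "diagram A d r" "diagram A' d' r'" "diagram_qis A d r A' d' r' f"
  shows "hdim (tot_obj vs A s) (tot_diff vs d r s) n = hdim (tot_obj vs A' s) (tot_diff vs d' r' s) n"
  using hdim_qis[OF diagramD(1)[OF diagram_tot[OF assms(1)]] diagramD(1)[OF diagram_tot[OF assms(2)]]
    diagram_qisD(1)[OF diagram_qis_tot[OF assms]]] .

section \<open>Partial socles compute the total complex\<close>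

definition vanishing :: "'v set \<Rightarrow> ('v set \<Rightarrow> int \<Rightarrow> 'k::field seqs) \<Rightarrow>
    ('v set \<Rightarrow> 'v \<Rightarrow> int \<Rightarrow> 'k seqmap) \<Rightarrow> 'v set \<Rightarrow> int \<Rightarrow> 'k seqs" where
  "vanishing W A r s n = {x \<in> A s n. \<forall>w\<in>W. r s w n x = 0}"

text \<open>Surjectivity of restriction on partial socles, one vertex at a time. The empty set is
  excluded because it is no simplex: the cube is zero there, while the stalk at \<open>{v}\<close>
  may be nonzero.\<close>

definition flasque :: "('v set \<Rightarrow> int \<Rightarrow> 'k::field seqs) \<Rightarrow> ('v set \<Rightarrow> 'v \<Rightarrow> int \<Rightarrow> 'k seqmap) \<Rightarrow> bool" where
  "flasque A r \<longleftrightarrow> (\<forall>s v W n. s \<noteq> {} \<longrightarrow> v \<notin> s \<longrightarrow> W \<inter> insert v s = {} \<longrightarrow>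
     (\<forall>y\<in>vanishing W A r (insert v s) n. \<exists>x\<in>vanishing W A r s n. r s v n x = y))"

text \<open>The inclusion of the corner of the cube that belongs to the empty set of added
  vertices.\<close>

fun pad :: "'a list \<Rightarrow> 'k::field seqmap" where
  "pad [] x = x"
| "pad (v # vs) x = pair (pad vs x) 0"

lemma lin_pad: "lin (pad (vs :: 'a list) :: 'b::field seqmap)"
proof (induction vs)
  case Nil
  have "pad ([] :: 'a list) = (\<lambda>x :: nat \<Rightarrow> 'b. x)" by (simp add: fun_eq_iff)
  then show ?case using lin_id by simp
next
  case (Cons v vs)
  have "pad (v # vs) = (\<lambda>x :: nat \<Rightarrow> 'b. pair (pad vs x) 0)" by (simp add: fun_eq_iff)
  then show ?case using lin_pair[OF Cons lin_const_0] by simp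
qed

lemma tot_map_pad:
  assumes "\<And>s n. lin (f s n)"
  shows "tot_map vs f s n (pad vs x) = pad vs (f s n x)"
proof (induction vs arbitrary: s n)
  case (Cons v vs)
  have "lin (tot_map ws f s n)" for ws s n
    by (induction ws arbitrary: s n) (auto intro: lin_pair_map assms)
  then have "tot_map vs f (insert v s) (n - 1) 0 = 0" by (rule lin_zero)
  then show ?case using Cons by simp
qed simp

lemma cpx_vanishing:
  assumes "diagram A d r"
  shows "cpx (vanishing W A r s) (d s)"
  unfolding cpx_def
proof (intro allI conjI ballI)
  note D = cpxD[OF diagramD(1)[OF assms]] and R = cmapD[OF diagramD(2)[OF assms]]
  fix n
  have "V.subspace (A s n \<inter> (\<Inter>w\<in>W. {x. r s w n x = 0}))"
    by (intro V.subspace_inter V.subspace_Inter fd_subspace[OF D(1)])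
      (auto intro: VP.linear_subspace_kernel R(1))
  moreover have "vanishing W A r s n = A s n \<inter> (\<Inter>w\<in>W. {x. r s w n x = 0})"
    by (auto simp: vanishing_def)
  ultimately show "fd (vanishing W A r s n)"
    using fd_subset[OF D(1)[of s n]] by (auto simp: vanishing_def)
  show "lin (d s n)" by (rule D)
  fix x assume x: "x \<in> vanishing W A r s n"
  then have xA: "x \<in> A s n" by (simp add: vanishing_def)
  show "d s (n + 1) (d s n x) = 0" by (rule D(4)[OF xA])
  have "r s w (n + 1) (d s n x) = 0" if "w \<in> W" for w
    using R(3)[OF xA, of w] lin_zero[OF D(2)[of "insert w s" n]] x that
    by (simp add: vanishing_def)
  then show "d s n x \<in> vanishing W A r s (n + 1)"
    using D(3)[OF xA] by (simp add: vanishing_def)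
qed

lemma cmap_vanishing:
  assumes "diagram A d r"
  shows "cmap (vanishing W A r s) (d s) (vanishing W A r (insert v s)) (d (insert v s)) (r s v)"
  unfolding cmap_def
proof (intro allI conjI ballI)
  note R = cmapD[OF diagramD(2)[OF assms]]
  fix n
  show "lin (r s v n)" by (rule R)
  fix x assume x: "x \<in> vanishing W A r s n"
  then have xA: "x \<in> A s n" by (simp add: vanishing_def)
  show "r s v (n + 1) (d s n x) = d (insert v s) n (r s v n x)" by (rule R(3)[OF xA])
  have "r (insert v s) w n (r s v n x) = 0" if "w \<in> W" for w
    using diagramD(3)[OF assms xA, of v w] x that lin_zero[OF R(1)[of "insert w s" v n]]
    by (simp add: vanishing_def)
  then show "r s v n x \<in> vanishing W A r (insert v s) n"
    using R(2)[OF xA] by (simp add: vanishing_def)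
qed

text \<open>Elements vanishing along \<open>v # vs\<close> are the kernel of \<open>r s v\<close>
  among those vanishing along \<open>vs\<close>. By \<open>flasque\<close> this map is onto the
  corresponding elements over \<open>insert v s\<close>, so its kernel is quasi-isomorphic to its
  cocone; the induction hypothesis at \<open>s\<close> and at \<open>insert v s\<close> identifies
  that cocone with the total complex.\<close>

lemma qis_vanishing_tot:
  assumes A: "diagram A d r" and fl: "flasque A r"
  shows "distinct vs \<Longrightarrow> set vs \<inter> s = {} \<Longrightarrow> s \<noteq> {} \<Longrightarrow>
    qis (vanishing (set vs) A r s) (d s) (tot_obj vs A s) (tot_diff vs d r s) (\<lambda>n. pad vs)"
proof (induction vs arbitrary: s)
  case Nil
  have "vanishing {} A r s = A s" by (auto simp: vanishing_def)
  moreover have "qis (A s) (d s) (A s) (d s) (\<lambda>n x. x)"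
  proof (rule qisI)
    note D = cpxD[OF diagramD(1)[OF A]]
    show "\<exists>x\<in>A s n. \<exists>z\<in>A s (n - 1). d s n x = 0 \<and> y = x + d s (n - 1) z"
      if "y \<in> A s n" "d s n y = 0" for n y
      using that fd_zero[OF D(1)[of s "n - 1"]] lin_zero[OF D(2)[of s "n - 1"]]
      by (intro bexI[of _ y] bexI[of _ 0]) auto
  qed (auto simp: cmap_def lin_id)
  ultimately show ?case by (simp add: lin_id)
next
  case (Cons v vs)
  let ?G = "vanishing (set vs) A r"
  note D = diagramD[OF diagram_tot[OF A]]
  have comm: "pad vs (r s v n x) = tot_map vs (\<lambda>t. r t v) s n (pad vs x)" for n x
    using tot_map_pad[of "\<lambda>t. r t v" vs s n x] cmapD(1)[OF diagramD(2)[OF A]] by simp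
  have eq: "vanishing (set (v # vs)) A r s = (\<lambda>n. {x \<in> ?G s n. r s v n x = 0})"
    by (auto simp: vanishing_def)
  have "qis (\<lambda>n. {x \<in> ?G s n. r s v n x = 0}) (d s) (cocone_obj (?G s) (?G (insert v s)))
    (cocone_diff (d s) (d (insert v s)) (r s v)) (\<lambda>n x. pair x 0)"
  proof (rule qis_kernel_cocone)
    show "\<exists>x\<in>?G s n. r s v n x = y" if "y \<in> ?G (insert v s) n" for n y
    proof -
      have "v \<notin> s" "set vs \<inter> insert v s = {}" using Cons.prems by auto
      then show ?thesis using fl that Cons.prems(3) unfolding flasque_def by blast
    qed
  qed (intro cpx_vanishing[OF A] cmap_vanishing[OF A])+
  moreover have "qis (cocone_obj (?G s) (?G (insert v s))) (cocone_diff (d s) (d (insert v s)) (r s v))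
    (tot_obj (v # vs) A s) (tot_diff (v # vs) d r s) (pair_map (\<lambda>n. pad vs) (\<lambda>n. pad vs))"
    unfolding tot_obj.simps tot_diff.simps
    by (rule qis_pair_map[OF cpx_vanishing[OF A] cpx_vanishing[OF A] D(1) D(1)
      cmap_vanishing[OF A] D(2)])
      (use Cons.IH[of s] Cons.IH[of "insert v s"] Cons.prems comm in auto)
  ultimately have "qis (\<lambda>n. {x \<in> ?G s n. r s v n x = 0}) (d s) (tot_obj (v # vs) A s) (tot_diff (v # vs) d r s)
    (\<lambda>n x. pair_map (\<lambda>n. pad vs) (\<lambda>n. pad vs) n (pair x 0))"
    by (rule qis_comp[OF cpx_vanishing[OF A, of "set (v # vs)" s, unfolded eq]
      cpx_cocone[OF cpx_vanishing[OF A] cpx_vanishing[OF A] cmap_vanishing[OF A]]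
      D(1)[of "v # vs" s]])
  moreover have q: "(\<lambda>n x. pair_map (\<lambda>n. pad vs) (\<lambda>n. pad vs) n (pair x 0)) = (\<lambda>n. pad (v # vs))"
    by (intro ext) (simp only: pad.simps pair_map_pair lin_zero[OF lin_pad[of vs]])
  ultimately show ?case unfolding eq by (elim subst[OF q])
qed

lemma hdim_vanishing:
  assumes "diagram A d r" "flasque A r" "distinct vs" "set vs \<inter> s = {}" "s \<noteq> {}"
  shows "hdim (vanishing (set vs) A r s) (d s) n = hdim (tot_obj vs A s) (tot_diff vs d r s) n"
  by (rule hdim_qis[OF cpx_vanishing[OF assms(1)] diagramD(1)[OF diagram_tot[OF assms(1)]]
    qis_vanishing_tot[OF assms]])

text \<open>Dimensions add up in a cocone, and subsets of \<open>v # vs\<close> split according to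
  whether they contain \<open>v\<close>; those that do come from the second component, where the
  degree has dropped by one.\<close>

lemma dim_tot_obj:
  assumes A: "diagram A d r"
    and dim: "\<And>s n. V.dim (A s n) = (if s \<in> P \<and> n = 0 then 1 else 0)"
  shows "distinct vs \<Longrightarrow> set vs \<inter> s = {} \<Longrightarrow>
    V.dim (tot_obj vs A s n) = card {S. S \<subseteq> set vs \<and> int (card S) = n \<and> s \<union> S \<in> P}"
proof (induction vs arbitrary: s n)
  case Nil
  have "{S. S = {} \<and> int (card S) = n \<and> s \<union> S \<in> P} = (if s \<in> P \<and> n = 0 then {{}} else {})" by auto
  then show ?case unfolding tot_obj.simps dim by simp
next
  case (Cons v vs)
  note D = cpxD(1)[OF diagramD(1)[OF diagram_tot[OF A]]]
  let ?L = "\<lambda>s n. {S. S \<subseteq> set vs \<and> int (card S) = n \<and> s \<union> S \<in> P}"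
  have fin: "finite S" if "S \<subseteq> set vs" for S using that finite_subset by auto
  have "{S. S \<subseteq> set (v # vs) \<and> int (card S) = n \<and> s \<union> S \<in> P} =
      ?L s n \<union> insert v ` ?L (insert v s) (n - 1)" (is "?R = ?U")
  proof (intro equalityI subsetI)
    fix S assume S: "S \<in> ?R"
    show "S \<in> ?U"
    proof (cases "v \<in> S")
      case False
      then show ?thesis using S by auto
    next
      case True
      then have "S = insert v (S - {v})" by auto
      moreover have "finite S" using S by (auto intro: finite_subset)
      then have "int (card (S - {v})) = n - 1"
        using S True card_Suc_Diff1[of S v] by simp
      moreover have "insert v s \<union> (S - {v}) = s \<union> S" using True by auto
      ultimately have "S - {v} \<in> ?L (insert v s) (n - 1)" using S by auto
      then show ?thesis using \<open>S = _\<close> by blast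
    qed
  next
    fix S assume "S \<in> ?U"
    then show "S \<in> ?R"
    proof
      assume "S \<in> ?L s n"
      then show ?thesis by auto
    next
      assume "S \<in> insert v ` ?L (insert v s) (n - 1)"
      then obtain T where T: "S = insert v T" "T \<in> ?L (insert v s) (n - 1)" by auto
      then have "v \<notin> T" "finite T" using Cons.prems fin by auto
      then have "int (card S) = n" using T by simp
      moreover have "s \<union> S = insert v s \<union> T" using T by auto
      ultimately show ?thesis using T by auto
    qed
  qed
  moreover have "?L s n \<inter> insert v ` ?L (insert v s) (n - 1) = {}" using Cons.prems by auto
  moreover have "finite (?L s m)" for s m by (rule finite_subset[of _ "Pow (set vs)"]) auto
  moreover have "card (insert v ` ?L (insert v s) (n - 1)) = card (?L (insert v s) (n - 1))"
    by (rule card_image) (use Cons.prems in \<open>auto simp: inj_on_def\<close>)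
  ultimately have "card ?R = card (?L s n) + card (?L (insert v s) (n - 1))"
    by (simp add: card_Un_disjoint)
  moreover have "V.dim (tot_obj (v # vs) A s n) =
      V.dim (tot_obj vs A s n) + V.dim (tot_obj vs A (insert v s) (n - 1))"
    by (simp add: cocone_obj_def dim_pair_set[OF D D])
  ultimately show ?case using Cons by simp
qed

section \<open>Matrices acting on sequences\<close>

text \<open>Entries of \<open>f\<close> from \<open>dim_col A\<close> on are ignored, so that a
  matrix becomes a linear map on all sequences and needs no carrier conditions on its
  argument.\<close>

definition act :: "'k::field mat \<Rightarrow> 'k seqmap" where
  "act A f = (\<lambda>i. if i < dim_row A then \<Sum>j<dim_col A. A $$ (i, j) * f j else 0)"

definition mat_of :: "nat \<Rightarrow> nat \<Rightarrow> 'k::field seqmap \<Rightarrow> 'k mat" where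
  "mat_of n m f = mat n m (\<lambda>(i, j). f (unit_seq j) i)"

lemma lin_act: "lin (act A)"
  by (rule linI) (auto simp: act_def scl_apply fun_eq_iff sum.distrib sum_distrib_left algebra_simps)

lemma act_kn: "A \<in> carrier_mat n m \<Longrightarrow> act A f \<in> kn n"
  by (auto simp: act_def kn_def)

lemma act_one: "f \<in> kn n \<Longrightarrow> act (1\<^sub>m n) f = f"
proof
  fix i assume f: "f \<in> kn n"
  show "act (1\<^sub>m n) f i = f i"
  proof (cases "i < n")
    case True
    then have "(\<Sum>j<n. 1\<^sub>m n $$ (i, j) * f j) = (\<Sum>j<n. if i = j then f j else 0)"
      by (intro sum.cong) auto
    then show ?thesis using True by (simp add: act_def)
  qed (use f in \<open>auto simp: act_def kn_def\<close>)
qed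

lemma act_mult:
  assumes "A \<in> carrier_mat a b" "B \<in> carrier_mat b c"
  shows "act (A * B) f = act A (act B f)"
proof
  fix i show "act (A * B) f i = act A (act B f) i"
  proof (cases "i < a")
    case True
    have "act (A * B) f i = (\<Sum>j<c. (\<Sum>k<b. A $$ (i, k) * B $$ (k, j)) * f j)"
      using True assms by (auto simp: act_def scalar_prod_def atLeast0LessThan)
    also have "\<dots> = (\<Sum>k<b. A $$ (i, k) * (\<Sum>j<c. B $$ (k, j) * f j))"
      unfolding sum_distrib_right by (subst sum.swap) (simp add: sum_distrib_left mult.assoc)
    also have "\<dots> = act A (act B f) i" using True assms by (auto simp: act_def)
    finally show ?thesis .
  qed (use assms in \<open>auto simp: act_def\<close>)
qed

lemma act_zero: "act (0\<^sub>m n m) f = 0"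
  by (auto simp: act_def fun_eq_iff)

lemma act_unit:
  assumes "i < dim_row A" "j < dim_col A" shows "act A (unit_seq j) i = A $$ (i, j)"
proof -
  have "(\<Sum>l<dim_col A. A $$ (i, l) * unit_seq j l) = (\<Sum>l<dim_col A. if l = j then A $$ (i, l) else 0)"
    by (intro sum.cong) (auto simp: unit_seq_def)
  then show ?thesis using assms by (simp add: act_def)
qed

lemma unit_seq_kn: "j < m \<Longrightarrow> unit_seq j \<in> kn m"
  by (auto simp: unit_seq_def kn_def)

lemma act_mat_eqI:
  assumes "A \<in> carrier_mat n m" "B \<in> carrier_mat n m" "\<And>x. x \<in> kn m \<Longrightarrow> act A x = act B x"
  shows "A = B"
proof (rule eq_matI)
  fix i j assume "i < dim_row B" "j < dim_col B"
  then show "A $$ (i, j) = B $$ (i, j)"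
    using act_unit[of i A j] act_unit[of i B j] assms(1,2) assms(3)[OF unit_seq_kn, of j] by auto
qed (use assms in auto)

lemma mat_of_carrier [simp]: "mat_of n m f \<in> carrier_mat n m"
  by (simp add: mat_of_def)

lemma act_mat_of:
  assumes f: "lin f" "\<And>x. x \<in> kn m \<Longrightarrow> f x \<in> kn n" and x: "x \<in> kn m"
  shows "act (mat_of n m f) x = f x"
proof
  fix i
  have "f x = f (\<Sum>j<m. scl (x j) (unit_seq j))" using kn_expand[OF x] by simp
  also have "\<dots> = (\<Sum>j<m. scl (x j) (f (unit_seq j)))"
    by (simp add: VP.linear_sum[OF f(1)] VP.linear_scale[OF f(1)])
  finally have "f x i = (\<Sum>j<m. x j * f (unit_seq j) i)" by (simp add: sum_seq_apply scl_apply)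
  moreover have "f x i = 0" if "i \<ge> n" using f(2)[OF x] that by (auto simp: kn_def)
  ultimately show "act (mat_of n m f) x i = f x i"
    by (auto simp: act_def mat_of_def mult.commute intro!: sum.cong)
qed

section \<open>Passage between vectors and sequences\<close>

definition seq_of_vec :: "'k::field vec \<Rightarrow> nat \<Rightarrow> 'k" where
  "seq_of_vec v = (\<lambda>i. if i < dim_vec v then v $ i else 0)"

lemma seq_of_vec_kn: "v \<in> carrier_vec n \<Longrightarrow> seq_of_vec v \<in> kn n"
  by (auto simp: seq_of_vec_def kn_def)

lemma seq_of_vec_inject:
  "v \<in> carrier_vec n \<Longrightarrow> w \<in> carrier_vec n \<Longrightarrow> seq_of_vec v = seq_of_vec w \<longleftrightarrow> v = w"
  by (auto simp: seq_of_vec_def fun_eq_iff intro!: eq_vecI)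

lemma seq_of_vec_vec: "f \<in> kn n \<Longrightarrow> seq_of_vec (vec n f) = f"
  by (auto simp: seq_of_vec_def kn_def fun_eq_iff)

lemma kn_seq_of_vecE:
  assumes "f \<in> kn n" obtains v where "v \<in> carrier_vec n" "f = seq_of_vec v"
  using seq_of_vec_vec[OF assms] vec_carrier[of n f] by metis

lemma seq_of_vec_zero [simp]: "seq_of_vec (0\<^sub>v n) = 0"
  by (auto simp: seq_of_vec_def fun_eq_iff)

lemma seq_of_vec_diff:
  "v \<in> carrier_vec n \<Longrightarrow> w \<in> carrier_vec n \<Longrightarrow> seq_of_vec (v - w) = seq_of_vec v - seq_of_vec w"
  by (auto simp: seq_of_vec_def fun_eq_iff)

lemma act_seq_of_vec:
  assumes "A \<in> carrier_mat n m" "v \<in> carrier_vec m"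
  shows "act A (seq_of_vec v) = seq_of_vec (A *\<^sub>v v)"
  using assms
  by (auto simp: act_def seq_of_vec_def fun_eq_iff scalar_prod_def atLeast0LessThan intro!: sum.cong)

lemma seq_of_vec_mat_image:
  assumes "A \<in> carrier_mat n m"
  shows "seq_of_vec ` mat_image A = act A ` kn m"
proof -
  have "seq_of_vec ` mat_image A = (\<lambda>v. act A (seq_of_vec v)) ` carrier_vec m"
    using assms by (auto simp: mat_image_def image_image act_seq_of_vec intro!: image_cong)
  also have "\<dots> = act A ` (seq_of_vec ` carrier_vec m)" by (simp add: image_image)
  also have "seq_of_vec ` carrier_vec m = kn m"
    using seq_of_vec_kn kn_seq_of_vecE by blast
  finally show ?thesis .
qed

lemma mat_image_carrier: "A \<in> carrier_mat n m \<Longrightarrow> mat_image A \<subseteq> carrier_vec n"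
  by (auto simp: mat_image_def)

lemma mat_image_iff:
  assumes "A \<in> carrier_mat n m" "v \<in> carrier_vec n"
  shows "v \<in> mat_image A \<longleftrightarrow> seq_of_vec v \<in> act A ` kn m"
  using seq_of_vec_mat_image[OF assms(1)] mat_image_carrier[OF assms(1)] assms(2)
    seq_of_vec_inject[of _ n] by (smt (verit) image_iff subsetD)

lemma mat_kernel_iff:
  assumes "A \<in> carrier_mat n m" "v \<in> carrier_vec m"
  shows "v \<in> mat_kernel A \<longleftrightarrow> act A (seq_of_vec v) = 0"
  using assms seq_of_vec_inject[of "A *\<^sub>v v" n "0\<^sub>v n"]
  by (auto simp: mat_kernel_def act_seq_of_vec)

section \<open>Sheaves acting on sequences\<close>

abbreviation stalk :: "('p, 'k::field) sheaf \<Rightarrow> 'p \<Rightarrow> 'k seqs" where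
  "stalk F s \<equiv> kn (stalk_dim F s)"

abbreviation res :: "('p, 'k::field) sheaf \<Rightarrow> 'p \<Rightarrow> 'p \<Rightarrow> 'k seqmap" where
  "res F s t \<equiv> act (restr F s t)"

lemma sheaf_onD:
  assumes "sheaf_on P F" "s \<in> P"
  shows "t \<in> P \<Longrightarrow> s \<le> t \<Longrightarrow> restr F s t \<in> carrier_mat (stalk_dim F t) (stalk_dim F s)"
    "t \<in> P \<Longrightarrow> s \<le> t \<Longrightarrow> res F s t x \<in> stalk F t"
    "x \<in> stalk F s \<Longrightarrow> res F s s x = x"
    "t \<in> P \<Longrightarrow> s \<le> t \<Longrightarrow> u \<in> P \<Longrightarrow> t \<le> u \<Longrightarrow> res F t u (res F s t x) = res F s u x"
proof -
  show 1: "restr F s t \<in> carrier_mat (stalk_dim F t) (stalk_dim F s)" if "t \<in> P" "s \<le> t" for t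
    using assms that unfolding sheaf_on_def by blast
  show "t \<in> P \<Longrightarrow> s \<le> t \<Longrightarrow> res F s t x \<in> stalk F t" using act_kn[OF 1] by blast
  have "restr F s s = 1\<^sub>m (stalk_dim F s)" using assms unfolding sheaf_on_def by blast
  then show "x \<in> stalk F s \<Longrightarrow> res F s s x = x" by (simp add: act_one)
  assume t: "t \<in> P" "s \<le> t" "u \<in> P" "t \<le> u"
  then have "restr F s u = restr F t u * restr F s t" using assms unfolding sheaf_on_def by blast
  moreover have "restr F t u \<in> carrier_mat (stalk_dim F u) (stalk_dim F t)"
    using assms t unfolding sheaf_on_def by blast
  ultimately show "res F t u (res F s t x) = res F s u x"
    using act_mult 1[OF t(1,2)] by metis
qed

lemma sheaf_onI:
  assumes c: "\<And>s t. s \<in> P \<Longrightarrow> t \<in> P \<Longrightarrow> s \<le> t \<Longrightarrow> restr F s t \<in> carrier_mat (stalk_dim F t) (stalk_dim F s)"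
    and i: "\<And>s x. s \<in> P \<Longrightarrow> x \<in> stalk F s \<Longrightarrow> res F s s x = x"
    and m: "\<And>s t u x. s \<in> P \<Longrightarrow> t \<in> P \<Longrightarrow> u \<in> P \<Longrightarrow> s \<le> t \<Longrightarrow> t \<le> u \<Longrightarrow> x \<in> stalk F s \<Longrightarrow>
      res F t u (res F s t x) = res F s u x"
  shows "sheaf_on P F"
  unfolding sheaf_on_def
proof (intro conjI ballI impI)
  show "restr F s s = 1\<^sub>m (stalk_dim F s)" if "s \<in> P" for s
    by (rule act_mat_eqI[of _ "stalk_dim F s" "stalk_dim F s"]) (use that c i in \<open>auto simp: act_one\<close>)
  show "restr F s u = restr F t u * restr F s t" if "s \<in> P" "t \<in> P" "u \<in> P" "s \<le> t" "t \<le> u" for s t u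
  proof -
    have su: "s \<le> u" using that by order
    show ?thesis
      using c[OF that(1,2,4)] c[OF that(2,3,5)] c[OF that(1,3) su] m[OF that]
      by (intro act_mat_eqI[of _ "stalk_dim F u" "stalk_dim F s"]) (auto simp: act_mult)
  qed
qed (use c in auto)

lemma sheaf_homD:
  assumes "sheaf_hom P F G \<phi>" "s \<in> P"
  shows "\<phi> s \<in> carrier_mat (stalk_dim G s) (stalk_dim F s)" "act (\<phi> s) x \<in> stalk G s"
    "sheaf_on P F \<Longrightarrow> sheaf_on P G \<Longrightarrow> t \<in> P \<Longrightarrow> s \<le> t \<Longrightarrow> act (\<phi> t) (res F s t x) = res G s t (act (\<phi> s) x)"
proof -
  show 1: "\<phi> s \<in> carrier_mat (stalk_dim G s) (stalk_dim F s)" using assms by (auto simp: sheaf_hom_def)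
  then show "act (\<phi> s) x \<in> stalk G s" by (rule act_kn)
  assume t: "sheaf_on P F" "sheaf_on P G" "t \<in> P" "s \<le> t"
  then have "\<phi> t * restr F s t = restr G s t * \<phi> s" using assms by (auto simp: sheaf_hom_def)
  moreover have "\<phi> t \<in> carrier_mat (stalk_dim G t) (stalk_dim F t)"
    using assms t by (auto simp: sheaf_hom_def)
  ultimately show "act (\<phi> t) (res F s t x) = res G s t (act (\<phi> s) x)"
    using 1 sheaf_onD(1)[OF t(1) assms(2) t(3,4)] sheaf_onD(1)[OF t(2) assms(2) t(3,4)] act_mult by metis
qed

lemma sheaf_homI:
  assumes F: "sheaf_on P F" and G: "sheaf_on P G"
    and c: "\<And>s. s \<in> P \<Longrightarrow> \<phi> s \<in> carrier_mat (stalk_dim G s) (stalk_dim F s)"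
    and m: "\<And>s t x. s \<in> P \<Longrightarrow> t \<in> P \<Longrightarrow> s \<le> t \<Longrightarrow> x \<in> stalk F s \<Longrightarrow>
      act (\<phi> t) (res F s t x) = res G s t (act (\<phi> s) x)"
  shows "sheaf_hom P F G \<phi>"
  unfolding sheaf_hom_def
proof (intro conjI ballI impI)
  show "\<phi> t * restr F s t = restr G s t * \<phi> s" if "s \<in> P" "t \<in> P" "s \<le> t" for s t
    using c[OF that(1)] c[OF that(2)] m[OF that] sheaf_onD(1)[OF F that] sheaf_onD(1)[OF G that]
    by (intro act_mat_eqI[of _ "stalk_dim G t" "stalk_dim F s"]) (auto simp: act_mult)
qed (use c in auto)

lemma sheaf_hom_mat_ofI:
  assumes F: "sheaf_on P F" and G: "sheaf_on P G"
    and f: "\<And>s. s \<in> P \<Longrightarrow> lin (f s)" "\<And>s x. s \<in> P \<Longrightarrow> x \<in> stalk F s \<Longrightarrow> f s x \<in> stalk G s"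
      "\<And>s t x. s \<in> P \<Longrightarrow> t \<in> P \<Longrightarrow> s \<le> t \<Longrightarrow> x \<in> stalk F s \<Longrightarrow> f t (res F s t x) = res G s t (f s x)"
  shows "sheaf_hom P F G (\<lambda>s. mat_of (stalk_dim G s) (stalk_dim F s) (f s))"
  using assms by (intro sheaf_homI) (auto simp: act_mat_of sheaf_onD)

lemma sheaf_mono_iff:
  "sheaf_mono P F G \<phi> \<longleftrightarrow> sheaf_hom P F G \<phi> \<and> (\<forall>s\<in>P. \<forall>x\<in>stalk F s. act (\<phi> s) x = 0 \<longrightarrow> x = 0)"
proof -
  have "inj_on (\<lambda>v. \<phi> s *\<^sub>v v) (carrier_vec (stalk_dim F s)) \<longleftrightarrow> (\<forall>x\<in>stalk F s. act (\<phi> s) x = 0 \<longrightarrow> x = 0)"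
    if h: "sheaf_hom P F G \<phi>" and s: "s \<in> P" for s
  proof -
    let ?C = "carrier_vec (stalk_dim F s)"
    note c = sheaf_homD(1)[OF h s]
    have "seq_of_vec ` ?C = stalk F s" using seq_of_vec_kn kn_seq_of_vecE by blast
    moreover have "inj_on seq_of_vec ?C" by (rule inj_onI) (simp add: seq_of_vec_inject)
    ultimately have "inj_on (act (\<phi> s)) (stalk F s) \<longleftrightarrow> inj_on (\<lambda>v. act (\<phi> s) (seq_of_vec v)) ?C"
      using comp_inj_on_iff[of seq_of_vec ?C "act (\<phi> s)"] by (simp add: comp_def)
    also have "\<dots> \<longleftrightarrow> inj_on (\<lambda>v. seq_of_vec (\<phi> s *\<^sub>v v)) ?C"
      by (rule inj_on_cong) (simp add: act_seq_of_vec[OF c])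
    also have "\<dots> \<longleftrightarrow> inj_on (\<lambda>v. \<phi> s *\<^sub>v v) ?C"
      unfolding inj_on_def
      using seq_of_vec_inject[OF mult_mat_vec_carrier[OF c] mult_mat_vec_carrier[OF c]] by blast
    finally show ?thesis
      using VP.linear_inj_on_iff_eq_0[OF lin_act subspace_kn, of "\<phi> s" "stalk_dim F s"] by simp
  qed
  then show ?thesis unfolding sheaf_mono_def by blast
qed

section \<open>The cubical diagram of a complex of sheaves\<close>

text \<open>Extension by zero to all vertex sets: the cube over \<open>\<pi>\<close> can then run
  through every set of vertices outside \<open>\<pi>\<close>, whether or not the union is a
  simplex.\<close>

definition cube_obj :: "'v set set \<Rightarrow> ('v set, 'k::field) sheaf_complex \<Rightarrow> 'v set \<Rightarrow> int \<Rightarrow> 'k seqs" where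
  "cube_obj P C s n = (if s \<in> P then stalk (obj C n) s else {0})"

definition cube_diff :: "'v set set \<Rightarrow> ('v set, 'k::field) sheaf_complex \<Rightarrow> 'v set \<Rightarrow> int \<Rightarrow> 'k seqmap" where
  "cube_diff P C s n = (if s \<in> P then act (diff C n s) else (\<lambda>_. 0))"

definition cube_res :: "'v set set \<Rightarrow> ('v set, 'k::field) sheaf_complex \<Rightarrow> 'v set \<Rightarrow> 'v \<Rightarrow> int \<Rightarrow> 'k seqmap" where
  "cube_res P C s v n = (if s \<in> P \<and> insert v s \<in> P then res (obj C n) s (insert v s) else (\<lambda>_. 0))"

lemma complex_onD:
  assumes "complex_on P C"
  shows "sheaf_on P (obj C n)" "sheaf_hom P (obj C n) (obj C (n + 1)) (diff C n)"
    "s \<in> P \<Longrightarrow> act (diff C (n + 1) s) (act (diff C n s) x) = 0"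
proof -
  show 1: "sheaf_on P (obj C n)" "sheaf_hom P (obj C n) (obj C (n + 1)) (diff C n)" for n
    using assms by (auto simp: complex_on_def)
  show "act (diff C (n + 1) s) (act (diff C n s) x) = 0" if s: "s \<in> P"
  proof -
    have "diff C (n + 1) s * diff C n s = 0\<^sub>m (stalk_dim (obj C (n + 2)) s) (stalk_dim (obj C n) s)"
      using assms s by (simp add: complex_on_def)
    moreover have "diff C (n + 1) s \<in> carrier_mat (stalk_dim (obj C (n + 1 + 1)) s) (stalk_dim (obj C (n + 1)) s)"
      using sheaf_homD(1)[OF 1(2) s] .
    ultimately show ?thesis using act_mult[OF _ sheaf_homD(1)[OF 1(2) s, of n]] act_zero by metis
  qed
qed

lemma diagram_cube:
  assumes P: "abstract_simplicial_complex P" and C: "complex_on P C"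
  shows "diagram (cube_obj P C) (cube_diff P C) (cube_res P C)"
  unfolding diagram_def
proof (intro conjI allI ballI)
  note S = sheaf_onD[OF complex_onD(1)[OF C]] and H = sheaf_homD[OF complex_onD(2)[OF C]]
  fix s :: "'a set"
  show "cpx (cube_obj P C s) (cube_diff P C s)"
    unfolding cpx_def
    by (auto simp: cube_obj_def cube_diff_def fd_kn fd_0 lin_act lin_const_0 H(2) complex_onD(3)[OF C])
  fix v
  show "cmap (cube_obj P C s) (cube_diff P C s) (cube_obj P C (insert v s)) (cube_diff P C (insert v s)) (cube_res P C s v)"
    unfolding cmap_def
  proof (intro allI conjI ballI)
    fix n
    show "lin (cube_res P C s v n)" by (auto simp: cube_res_def lin_act lin_const_0)
    fix x assume x: "x \<in> cube_obj P C s n"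
    show "cube_res P C s v n x \<in> cube_obj P C (insert v s) n"
      using S(2)[of s "insert v s"] fd_zero[OF fd_kn] by (auto simp: cube_res_def cube_obj_def)
    show "cube_res P C s v (n + 1) (cube_diff P C s n x) = cube_diff P C (insert v s) n (cube_res P C s v n x)"
      using H(3)[OF _ complex_onD(1)[OF C] complex_onD(1)[OF C], of s "insert v s" n x] lin_zero[OF lin_act]
        subset_insertI[of s v]
      by (auto simp: cube_res_def cube_diff_def)
  qed
  fix w n x assume x: "x \<in> cube_obj P C s n"
  show "cube_res P C (insert v s) w n (cube_res P C s v n x) = cube_res P C (insert w s) v n (cube_res P C s w n x)"
  \<comment> \<open>If the far corner is a simplex, closure under non-empty faces makes the two
    middle corners simplices and functoriality applies. Otherwise both composites are zero.\<close>
  proof (cases "s \<in> P \<and> insert v (insert w s) \<in> P")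
    case True
    moreover have "s \<subseteq> insert v s" "s \<subseteq> insert w s" "s \<subseteq> insert v (insert w s)" by auto
    moreover from True have "insert v s \<in> P" "insert w s \<in> P"
      using P unfolding abstract_simplicial_complex_def by (metis insert_not_empty subset_insertI insert_commute)+
    ultimately show ?thesis using S(4)[of s "insert v s" "insert v (insert w s)" n x]
        S(4)[of s "insert w s" "insert v (insert w s)" n x]
      by (auto simp: cube_res_def insert_commute)
  next
    case False
    then show ?thesis using x lin_zero[OF lin_act]
      by (auto simp: cube_res_def insert_commute)
  qed
qed

lemma quasi_isomorphism_diagram_qis:
  assumes C: "complex_on P C" and D: "complex_on P D" and f: "quasi_isomorphism P C D f"
  shows "diagram_qis (cube_obj P C) (cube_diff P C) (cube_res P C) (cube_obj P D) (cube_diff P D) (cube_res P D)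
    (\<lambda>s n. if s \<in> P then act (f n s) else (\<lambda>_. 0))"
  unfolding diagram_qis_def
proof (intro conjI allI ballI)
  let ?h = "\<lambda>s n. if s \<in> P then act (f n s) else (\<lambda>_. 0)"
  note CS = complex_onD(1)[OF C] and CH = sheaf_homD[OF complex_onD(2)[OF C]]
  note DS = complex_onD(1)[OF D] and DH = sheaf_homD[OF complex_onD(2)[OF D]]
  have h: "sheaf_hom P (obj C n) (obj D n) (f n)" for n
    using f by (auto simp: quasi_isomorphism_def chain_map_def)
  note F = sheaf_homD[OF h]
  fix s :: "'a set"
  show "qis (cube_obj P C s) (cube_diff P C s) (cube_obj P D s) (cube_diff P D s) (?h s)"
  proof (cases "s \<in> P")
    case False
    then show ?thesis by (auto simp: qis_def cmap_def cube_obj_def cube_diff_def lin_const_0)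
  next
    case s: True
    have eq: "cube_obj P C s = (\<lambda>n. stalk (obj C n) s)" "cube_obj P D s = (\<lambda>n. stalk (obj D n) s)"
      "cube_diff P C s = (\<lambda>n. act (diff C n s))" "cube_diff P D s = (\<lambda>n. act (diff D n s))"
      using s by (auto simp: cube_obj_def cube_diff_def fun_eq_iff)
    have car: "diff C (n - 1) s \<in> carrier_mat (stalk_dim (obj C n) s) (stalk_dim (obj C (n - 1)) s)"
       "diff D (n - 1) s \<in> carrier_mat (stalk_dim (obj D n) s) (stalk_dim (obj D (n - 1)) s)" for n
      using CH(1)[OF s, of "n - 1"] DH(1)[OF s, of "n - 1"] by auto
    show ?thesis unfolding eq
      unfolding qis_def
    proof (intro conjI allI ballI impI)
      show "cmap (\<lambda>n. stalk (obj C n) s) (\<lambda>n. act (diff C n s)) (\<lambda>n. stalk (obj D n) s) (\<lambda>n. act (diff D n s))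
         (?h s)"
        unfolding cmap_def
      proof (intro allI conjI ballI)
        fix n x
        have "f (n + 1) s * diff C n s = diff D n s * f n s"
          using f s by (auto simp: quasi_isomorphism_def chain_map_def)
        then have "act (f (n + 1) s) (act (diff C n s) x) = act (diff D n s) (act (f n s) x)"
          using act_mult[OF F(1)[OF s] CH(1)[OF s]] act_mult[OF DH(1)[OF s] F(1)[OF s]] by metis
        then show "?h s (n + 1) (act (diff C n s) x) =
          act (diff D n s) (?h s n x)" using s by simp
      qed (use s F in \<open>auto simp: lin_act\<close>)
    next
      fix n x
      assume x: "x \<in> stalk (obj C n) s" "act (diff C n s) x = 0"
        "?h s n x \<in> act (diff D (n - 1) s) ` stalk (obj D (n - 1)) s"
      obtain v where v: "v \<in> carrier_vec (stalk_dim (obj C n) s)" "x = seq_of_vec v"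
        using kn_seq_of_vecE[OF x(1)] .
      have "v \<in> mat_kernel (diff C n s)" using mat_kernel_iff[OF CH(1)[OF s] v(1)] x(2) v(2) by simp
      moreover have "f n s *\<^sub>v v \<in> mat_image (diff D (n - 1) s)"
        using mat_image_iff[OF car(2)] x(3) s v act_seq_of_vec[OF F(1)[OF s] v(1)] F(1)[OF s, of n] by simp
      ultimately have "v \<in> mat_image (diff C (n - 1) s)"
        using f s by (auto simp: quasi_isomorphism_def)
      then show "x \<in> act (diff C (n - 1) s) ` stalk (obj C (n - 1)) s"
        using mat_image_iff[OF car(1) v(1)] v(2) by simp
    next
      fix n y
      assume y: "y \<in> stalk (obj D n) s" "act (diff D n s) y = 0"
      obtain w where w: "w \<in> carrier_vec (stalk_dim (obj D n) s)" "y = seq_of_vec w"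
        using kn_seq_of_vecE[OF y(1)] .
      have "w \<in> mat_kernel (diff D n s)" using mat_kernel_iff[OF DH(1)[OF s] w(1)] y(2) w(2) by simp
      then obtain v where v: "v \<in> mat_kernel (diff C n s)" "w - f n s *\<^sub>v v \<in> mat_image (diff D (n - 1) s)"
        using f s unfolding quasi_isomorphism_def by blast
      have vc: "v \<in> carrier_vec (stalk_dim (obj C n) s)"
        using v(1) CH(1)[OF s, of n] by (auto simp: mat_kernel_def)
      have fc: "f n s *\<^sub>v v \<in> carrier_vec (stalk_dim (obj D n) s)"
        by (rule mult_mat_vec_carrier[OF F(1)[OF s] vc])
      have "y - act (f n s) (seq_of_vec v) \<in> act (diff D (n - 1) s) ` stalk (obj D (n - 1)) s"
        using v(2) mat_image_iff[OF car(2), of "w - f n s *\<^sub>v v"] w fc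
        by (simp add: act_seq_of_vec[OF F(1)[OF s] vc] seq_of_vec_diff[OF w(1) fc])
      then show "\<exists>x\<in>stalk (obj C n) s. act (diff C n s) x = 0 \<and>
         y - ?h s n x \<in> act (diff D (n - 1) s) ` stalk (obj D (n - 1)) s"
        using s seq_of_vec_kn[OF vc] mat_kernel_iff[OF CH(1)[OF s] vc] v(1) by auto
    qed
  qed
  fix v n x assume "x \<in> cube_obj P C s n"
  then show "?h (insert v s) n (cube_res P C s v n x) =
    cube_res P D s v n (?h s n x)"
    using F(3)[OF _ CS DS, of s "insert v s" n x] lin_zero[OF lin_act] subset_insertI[of s v]
    by (auto simp: cube_res_def cube_obj_def)
qed

definition cube_hdim :: "'v set set \<Rightarrow> ('v set, 'k::field) sheaf_complex \<Rightarrow> 'v list \<Rightarrow> 'v set \<Rightarrow> int \<Rightarrow> nat" where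
  "cube_hdim P C vs s n = hdim (tot_obj vs (cube_obj P C) s) (tot_diff vs (cube_diff P C) (cube_res P C) s) n"

text \<open>Each link of the zigzag gives an equality, which can be read in either
  direction.\<close>

lemma cube_hdim_quasi_isomorphic:
  assumes P: "abstract_simplicial_complex P" and q: "quasi_isomorphic P C D"
  shows "cube_hdim P C vs s n = cube_hdim P D vs s n"
  using q unfolding quasi_isomorphic_def
proof (induction rule: equivclp_induct)
  case (step D E)
  have "cube_hdim P A vs s n = cube_hdim P B vs s n"
    if "complex_on P A \<and> complex_on P B \<and> (\<exists>f. quasi_isomorphism P A B f)" for A B :: "('a set, 'b) sheaf_complex"
    using that hdim_tot_cong[OF diagram_cube[OF P] diagram_cube[OF P] quasi_isomorphism_diagram_qis]
    unfolding cube_hdim_def by blast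
  then show ?case using step by metis
qed simp

section \<open>Direct sums of indecomposable injective sheaves\<close>

text \<open>The stalk at \<open>s\<close> of the direct sum of the sheaves \<open>[\<pi>]\<close>, \<open>\<pi>\<close> in \<open>ps\<close>, is the space of functions on
  those positions \<open>i\<close> of \<open>ps\<close> with \<open>s \<le> ps ! i\<close>. In the direct sum of matrices these coordinates are
  packed densely; \<open>spread\<close> undoes the packing, after which restriction is truncation of functions.\<close>

lemma lambda_zero [simp]: "(\<lambda>_. 0) = (0 :: nat \<Rightarrow> 'k::zero)"
  by (simp add: fun_eq_iff)

definition labels :: "'p::order list \<Rightarrow> 'p \<Rightarrow> nat set" where
  "labels ps s = {i. i < length ps \<and> s \<le> ps ! i}"

definition truncate :: "nat set \<Rightarrow> 'k::field seqmap" where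
  "truncate A f = (\<lambda>i. if i \<in> A then f i else 0)"

definition scons :: "'k \<Rightarrow> (nat \<Rightarrow> 'k) \<Rightarrow> nat \<Rightarrow> 'k" where
  "scons a f = case_nat a f"

abbreviation (input) shift :: "(nat \<Rightarrow> 'k) \<Rightarrow> nat \<Rightarrow> 'k" where
  "shift f \<equiv> (\<lambda>i. f (Suc i))"

fun spread :: "'p::order list \<Rightarrow> 'p \<Rightarrow> 'k::field seqmap" where
  "spread [] s x = 0"
| "spread (\<pi> # ps) s x =
    (if s \<le> \<pi> then scons (x 0) (spread ps s (shift x)) else scons 0 (spread ps s x))"

fun pack :: "'p::order list \<Rightarrow> 'p \<Rightarrow> 'k::field seqmap" where
  "pack [] s f = 0"
| "pack (\<pi> # ps) s f =
    (if s \<le> \<pi> then scons (f 0) (pack ps s (shift f)) else pack ps s (shift f))"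

abbreviation inj_sum :: "'p::order list \<Rightarrow> ('p, 'k::field) sheaf" where
  "inj_sum ps \<equiv> sheaf_direct_sum (map indec_injective ps)"

lemma lin_truncate: "lin (truncate A)"
  by (rule linI) (auto simp: truncate_def scl_apply fun_eq_iff)

lemma truncate_coord_space: "truncate A f \<in> coord_space A"
  by (auto simp: truncate_def coord_space_def)

lemma truncate_id: "f \<in> coord_space A \<Longrightarrow> truncate A f = f"
  by (auto simp: truncate_def coord_space_def fun_eq_iff)

lemma scons_simps [simp]: "scons a f 0 = a" "scons a f (Suc i) = f i" "shift (scons a f) = f"
  by (auto simp: scons_def)

lemma scons_shift: "a = f 0 \<Longrightarrow> scons a (shift f) = f"
  by (auto simp: scons_def fun_eq_iff split: nat.split)

lemma scons_eqI: "f 0 = a \<Longrightarrow> shift f = g \<Longrightarrow> f = scons a g"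
  by (auto simp: scons_def fun_eq_iff split: nat.split)

lemma scons_lin: "scons a f + scons b g = scons (a + b) (f + g)"
  "scl c (scons a f) = scons (c * a) (scl c f)"
  by (auto simp: scons_def fun_eq_iff scl_apply split: nat.split)

lemma shift_lin: "shift (f + g) = shift f + shift g" "shift (scl c f) = scl c (shift f)"
  by (auto simp: fun_eq_iff scl_apply)

lemma lin_spread: "lin (spread (ps :: 'p::order list) s :: 'k::field seqmap)"
proof (induction ps)
  case Nil
  then show ?case by (intro linI) auto
next
  case (Cons \<pi> ps)
  show ?case
  proof (rule linI)
    fix x y :: "nat \<Rightarrow> 'k"
    have "spread ps s (\<lambda>i. x (Suc i) + y (Suc i)) = spread ps s (shift x) + spread ps s (shift y)"
      using lin_add[OF Cons, of "shift x" "shift y"] by (simp only: plus_fun_def)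
    then show "spread (\<pi> # ps) s (x + y) = spread (\<pi> # ps) s x + spread (\<pi> # ps) s y"
      by (cases "s \<le> \<pi>")
        (simp_all only: spread.simps if_True if_False shift_lin scons_lin plus_fun_apply lin_add[OF Cons] add_0)
  next
    fix c and x :: "nat \<Rightarrow> 'k"
    have "spread ps s (\<lambda>i. c * x (Suc i)) = scl c (spread ps s (shift x))"
      using lin_scale[OF Cons, of c "shift x"] by (simp only: scl_def)
    then show "spread (\<pi> # ps) s (scl c x) = scl c (spread (\<pi> # ps) s x)"
      by (cases "s \<le> \<pi>")
        (simp_all only: spread.simps if_True if_False shift_lin scons_lin scl_apply lin_scale[OF Cons] mult_zero_right)
  qed
qed

lemma lin_pack: "lin (pack (ps :: 'p::order list) s :: 'k::field seqmap)"
proof (induction ps)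
  case Nil
  then show ?case by (intro linI) auto
next
  case (Cons \<pi> ps)
  show ?case
  proof (rule linI)
    fix x y :: "nat \<Rightarrow> 'k"
    have "pack ps s (\<lambda>i. x (Suc i) + y (Suc i)) = pack ps s (shift x) + pack ps s (shift y)"
      using lin_add[OF Cons, of "shift x" "shift y"] by (simp only: plus_fun_def)
    then show "pack (\<pi> # ps) s (x + y) = pack (\<pi> # ps) s x + pack (\<pi> # ps) s y"
      by (cases "s \<le> \<pi>")
        (simp_all only: pack.simps if_True if_False shift_lin scons_lin plus_fun_apply lin_add[OF Cons])
  next
    fix c and x :: "nat \<Rightarrow> 'k"
    have "pack ps s (\<lambda>i. c * x (Suc i)) = scl c (pack ps s (shift x))"
      using lin_scale[OF Cons, of c "shift x"] by (simp only: scl_def)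
    then show "pack (\<pi> # ps) s (scl c x) = scl c (pack (\<pi> # ps) s x)"
      by (cases "s \<le> \<pi>")
        (simp_all only: pack.simps if_True if_False shift_lin scons_lin scl_apply lin_scale[OF Cons])
  qed
qed

lemma stalk_dim_inj_sum [simp]:
  "stalk_dim (sheaf_direct_sum [] :: ('p, 'k::field) sheaf) s = 0"
  "stalk_dim (sheaf_direct_sum (indec_injective \<pi> # map indec_injective ps) :: ('p::order, 'k) sheaf) s =
    (if s \<le> \<pi> then Suc (stalk_dim (inj_sum ps :: ('p, 'k) sheaf) s) else stalk_dim (inj_sum ps :: ('p, 'k) sheaf) s)"
  by (auto simp: sheaf_direct_sum_def indec_injective_def Let_def comp_def)

lemma spread_coord_space: "spread ps s x \<in> coord_space (labels ps s)"
proof (induction ps arbitrary: x)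
  case (Cons \<pi> ps)
  have "spread (\<pi> # ps) s x i = 0" if i: "i \<notin> labels (\<pi> # ps) s" for i
  proof (cases i)
    case (Suc j)
    then have "j \<notin> labels ps s" using i by (auto simp: labels_def)
    then show ?thesis using Cons Suc by (auto simp: coord_space_def)
  qed (use i in \<open>auto simp: labels_def\<close>)
  then show ?case by (auto simp: coord_space_def)
qed (auto simp: coord_space_def)

lemma pack_stalk: "pack ps s f \<in> stalk (inj_sum ps :: ('p::order, 'k::field) sheaf) s"
proof (induction ps arbitrary: f)
  case (Cons \<pi> ps)
  have "scons a g \<in> kn (Suc n)" if "g \<in> kn n" for a :: 'k and g n
    using that by (auto simp: kn_def scons_def split: nat.split)
  then show ?case using Cons by simp
qed (auto simp: kn_def)

lemma pack_spread: "x \<in> stalk (inj_sum ps :: ('p::order, 'k::field) sheaf) s \<Longrightarrow> pack ps s (spread ps s x) = x"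
proof (induction ps arbitrary: x)
  case (Cons \<pi> ps)
  have "shift x \<in> kn n" if "x \<in> kn (Suc n)" for n using that by (auto simp: kn_def)
  then show ?case using Cons by (auto simp: scons_shift)
qed (auto simp: kn_def)

lemma spread_pack: "f \<in> coord_space (labels ps s) \<Longrightarrow> spread ps s (pack ps s f) = f"
proof (induction ps arbitrary: f)
  case (Cons \<pi> ps)
  have "shift f \<in> coord_space (labels ps s)"
    using Cons.prems by (auto simp: coord_space_def labels_def)
  moreover have "f 0 = 0" if "\<not> s \<le> \<pi>"
    using Cons.prems that by (auto simp: coord_space_def labels_def)
  ultimately show ?case using Cons.IH by (auto simp: scons_shift)
qed (auto simp: coord_space_def labels_def fun_eq_iff)

lemma act_diag_block_Cons:
  "act (diag_block_mat (A # As)) x = (\<lambda>i. if i < dim_row A then act A x i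
     else act (diag_block_mat As) (\<lambda>j. x (j + dim_col A)) (i - dim_row A))"
proof
  fix i
  let ?B = "diag_block_mat As"
  have D: "diag_block_mat (A # As) = four_block_mat A (0\<^sub>m (dim_row A) (dim_col ?B)) (0\<^sub>m (dim_row ?B) (dim_col A)) ?B"
    by (simp add: Let_def)
  have sp: "(\<Sum>j<a + b. g j) = (\<Sum>j<a. g j) + (\<Sum>j<b. g (j + a))" for a b :: nat and g :: "nat \<Rightarrow> 'a"
    by (induction b) (auto simp: algebra_simps)
  show "act (diag_block_mat (A # As)) x i = (if i < dim_row A then act A x i
     else act ?B (\<lambda>j. x (j + dim_col A)) (i - dim_row A))"
    unfolding D act_def by (auto simp: sp)
qed

lemma restr_inj_sum: "restr (inj_sum ps) s t = diag_block_mat (map (\<lambda>\<pi>. restr (indec_injective \<pi>) s t) ps)"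
  by (simp add: sheaf_direct_sum_def comp_def)

lemma restr_inj_sum_carrier:
  "restr (inj_sum ps :: ('p::order, 'k::field) sheaf) s t \<in>
     carrier_mat (stalk_dim (inj_sum ps :: ('p, 'k) sheaf) t) (stalk_dim (inj_sum ps :: ('p, 'k) sheaf) s)"
  unfolding restr_inj_sum
  by (rule carrier_matI)
    (simp_all add: dim_diag_block_mat sheaf_direct_sum_def comp_def indec_injective_def Let_def)

lemma truncate_scons:
  "truncate (labels (\<pi> # ps) t) (scons a f) = scons (if t \<le> \<pi> then a else 0) (truncate (labels ps t) f)"
  by (rule scons_eqI) (auto simp: truncate_def labels_def fun_eq_iff)

lemma spread_res:
  assumes "s \<le> t"
  shows "spread ps t (res (inj_sum ps) s t x) = truncate (labels ps t) (spread ps s x)"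
proof (induction ps arbitrary: x)
  case Nil
  show ?case using lin_zero[OF lin_truncate] by simp
next
  case (Cons \<pi> ps)
  let ?A = "restr (indec_injective \<pi>) s t :: 'b mat"
  have res: "res (inj_sum (\<pi> # ps)) s t x = (\<lambda>i. if i < dim_row ?A then act ?A x i
     else res (inj_sum ps) s t (\<lambda>j. x (j + dim_col ?A)) (i - dim_row ?A))"
    unfolding restr_inj_sum unfolding list.map by (rule act_diag_block_Cons)
  \<comment> \<open>The fourth combination cannot occur, since \<open>s \<le> t \<le> \<pi>\<close>
    gives \<open>s \<le> \<pi>\<close>. The leading blocks are of size 1 by 1, 0 by 1 and 0 by
    0.\<close>
  consider "t \<le> \<pi>" "s \<le> \<pi>" | "\<not> t \<le> \<pi>" "s \<le> \<pi>" | "\<not> t \<le> \<pi>" "\<not> s \<le> \<pi>"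
    using assms by (meson order_trans)
  then show ?case
  proof cases
    case 1
    then have "?A = mat 1 1 (\<lambda>_. 1)" by (simp add: indec_injective_def)
    then have "res (inj_sum (\<pi> # ps)) s t x = scons (x 0) (res (inj_sum ps) s t (shift x))"
      unfolding res by (intro scons_eqI) (auto simp: act_def)
    then show ?thesis using 1 Cons by (simp add: truncate_scons)
  next
    case 2
    then have "?A = mat 0 1 (\<lambda>_. 1)" by (simp add: indec_injective_def)
    then have "res (inj_sum (\<pi> # ps)) s t x = res (inj_sum ps) s t (shift x)"
      unfolding res by simp
    then show ?thesis using 2 Cons by (simp add: truncate_scons)
  next
    case 3
    then have "?A = mat 0 0 (\<lambda>_. 1)" by (simp add: indec_injective_def)
    then have "res (inj_sum (\<pi> # ps)) s t x = res (inj_sum ps) s t x"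
      unfolding res by simp
    then show ?thesis using 3 Cons by (simp add: truncate_scons)
  qed
qed

text \<open>\<open>spread\<close> is injective on stalks and turns restriction into truncation;
  functoriality then says that truncations along decreasing sets of labels compose.\<close>

lemma sheaf_on_inj_sum: "sheaf_on P (inj_sum ps :: ('p::order, 'k::field) sheaf)"
proof (rule sheaf_onI)
  let ?D = "inj_sum ps :: ('p, 'k) sheaf"
  show "restr ?D s t \<in> carrier_mat (stalk_dim ?D t) (stalk_dim ?D s)" for s t
    by (rule restr_inj_sum_carrier)
  have inj: "x = y" if "x \<in> stalk ?D s" "y \<in> stalk ?D s" "spread ps s x = spread ps s y" for x y s
    using that pack_spread by metis
  have r: "res ?D s t x \<in> stalk ?D t" for s t x by (rule act_kn[OF restr_inj_sum_carrier])
  show "res ?D s s x = x" if "x \<in> stalk ?D s" for s x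
    by (rule inj[OF r that]) (simp add: spread_res truncate_id spread_coord_space)
  show "res ?D t u (res ?D s t x) = res ?D s u x" if "s \<le> t" "t \<le> u" for s t u x
  proof (rule inj[OF r r])
    have "s \<le> u" using that by order
    moreover have "labels ps u \<subseteq> labels ps t" using that by (auto simp: labels_def)
    ultimately show "spread ps u (res ?D t u (res ?D s t x)) = spread ps u (res ?D s u x)"
      using that by (auto simp: spread_res truncate_def fun_eq_iff)
  qed
qed

section \<open>Splittings of injective sheaves\<close>

text \<open>An isomorphism with a sum of sheaves \<open>[\<pi>]\<close>, expressed in unpacked
  coordinates: \<open>E s\<close> and \<open>U s\<close> are inverse to each other between the stalk
  and the functions on the labels above \<open>s\<close>. Injectivity, socles and lifting of
  sections can then be read off from supports of functions, without block matrices.\<close>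

definition splitting :: "'p::order set \<Rightarrow> ('p, 'k::field) sheaf \<Rightarrow> 'p list \<Rightarrow> ('p \<Rightarrow> 'k seqmap) \<Rightarrow>
    ('p \<Rightarrow> 'k seqmap) \<Rightarrow> bool" where
  "splitting P I ps E U \<longleftrightarrow> set ps \<subseteq> P \<and> (\<forall>s\<in>P. lin (E s) \<and> lin (U s) \<and>
     (\<forall>x\<in>stalk I s. E s x \<in> coord_space (labels ps s) \<and> U s (E s x) = x) \<and>
     (\<forall>f\<in>coord_space (labels ps s). U s f \<in> stalk I s \<and> E s (U s f) = f) \<and>
     (\<forall>t\<in>P. s \<le> t \<longrightarrow> (\<forall>x\<in>stalk I s. E t (res I s t x) = truncate (labels ps t) (E s x))))"

lemma splittingD:
  assumes "splitting P I ps E U"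
  shows "set ps \<subseteq> P" "s \<in> P \<Longrightarrow> lin (E s)" "s \<in> P \<Longrightarrow> lin (U s)"
    "s \<in> P \<Longrightarrow> x \<in> stalk I s \<Longrightarrow> E s x \<in> coord_space (labels ps s)"
    "s \<in> P \<Longrightarrow> x \<in> stalk I s \<Longrightarrow> U s (E s x) = x"
    "s \<in> P \<Longrightarrow> f \<in> coord_space (labels ps s) \<Longrightarrow> U s f \<in> stalk I s"
    "s \<in> P \<Longrightarrow> f \<in> coord_space (labels ps s) \<Longrightarrow> E s (U s f) = f"
    "s \<in> P \<Longrightarrow> t \<in> P \<Longrightarrow> s \<le> t \<Longrightarrow> x \<in> stalk I s \<Longrightarrow> E t (res I s t x) = truncate (labels ps t) (E s x)"
  using assms unfolding splitting_def by blast+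

lemma splitting_inj_sum: "set ps \<subseteq> P \<Longrightarrow> splitting P (inj_sum ps) ps (spread ps) (pack ps)"
  unfolding splitting_def
  by (simp add: lin_spread lin_pack spread_coord_space pack_spread pack_stalk spread_pack spread_res)

lemma splitting_eqI:
  assumes "splitting P I ps E U" "s \<in> P" "x \<in> stalk I s" "y \<in> stalk I s" "E s x = E s y"
  shows "x = y"
  using assms splittingD(5) by metis

lemma splitting_of_iso:
  fixes I :: "('p::order, 'k::field) sheaf"
  assumes I: "sheaf_on P I" and ps: "set ps \<subseteq> P" and iso: "sheaf_iso P I (inj_sum ps)"
  obtains E U where "splitting P I ps E U"
proof -
  let ?D = "inj_sum ps :: ('p, 'k) sheaf"
  obtain \<phi> \<psi> where h: "sheaf_hom P I ?D \<phi>" "sheaf_hom P ?D I \<psi>"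
    and id: "\<And>s. s \<in> P \<Longrightarrow> \<psi> s * \<phi> s = 1\<^sub>m (stalk_dim I s) \<and> \<phi> s * \<psi> s = 1\<^sub>m (stalk_dim ?D s)"
    using iso unfolding sheaf_iso_def by blast
  have id1: "act (\<psi> s) (act (\<phi> s) x) = x" if "s \<in> P" "x \<in> stalk I s" for s x
    using id[OF that(1)] act_mult[OF sheaf_homD(1)[OF h(2) that(1)] sheaf_homD(1)[OF h(1) that(1)]] act_one[OF that(2)]
    by metis
  have id2: "act (\<phi> s) (act (\<psi> s) x) = x" if "s \<in> P" "x \<in> stalk ?D s" for s x
    using id[OF that(1)] act_mult[OF sheaf_homD(1)[OF h(1) that(1)] sheaf_homD(1)[OF h(2) that(1)]] act_one[OF that(2)]
    by metis
  have "splitting P I ps (\<lambda>s x. spread ps s (act (\<phi> s) x)) (\<lambda>s f. act (\<psi> s) (pack ps s f))"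
    unfolding splitting_def
  proof (intro conjI ballI impI)
    show "lin (\<lambda>x. spread ps s (act (\<phi> s) x))" "lin (\<lambda>f. act (\<psi> s) (pack ps s f))" for s
      by (rule lin_comp[OF lin_act lin_spread], rule lin_comp[OF lin_pack lin_act])
    show "act (\<psi> s) (pack ps s (spread ps s (act (\<phi> s) x))) = x" if "s \<in> P" "x \<in> stalk I s" for s x
      using that sheaf_homD(2)[OF h(1)] by (simp add: pack_spread id1)
    show "spread ps s (act (\<phi> s) (act (\<psi> s) (pack ps s f))) = f" if "s \<in> P" "f \<in> coord_space (labels ps s)" for s f
      using that by (simp add: spread_pack id2 pack_stalk)
    show "spread ps t (act (\<phi> t) (res I s t x)) = truncate (labels ps t) (spread ps s (act (\<phi> s) x))"
      if "s \<in> P" "t \<in> P" "s \<le> t" for s t x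
      using that by (simp add: sheaf_homD(3)[OF h(1) _ I sheaf_on_inj_sum] spread_res)
  qed (use ps sheaf_homD(2)[OF h(2)] spread_coord_space in auto)
  then show ?thesis by (rule that)
qed

lemma splitting_res_U:
  assumes I: "sheaf_on P I" and S: "splitting P I ps E U"
    and s: "s \<in> P" "t \<in> P" "s \<le> t" and f: "f \<in> coord_space (labels ps s)"
  shows "res I s t (U s f) = U t (truncate (labels ps t) f)"
proof (rule splitting_eqI[OF S s(2)])
  note D = splittingD[OF S]
  show "res I s t (U s f) \<in> stalk I t" by (rule sheaf_onD(2)[OF I s])
  show "U t (truncate (labels ps t) f) \<in> stalk I t" by (intro D s truncate_coord_space)
  show "E t (res I s t (U s f)) = E t (U t (truncate (labels ps t) f))"
    using D(8)[OF s D(6)[OF s(1) f]] D(7)[OF s(1) f] D(7)[OF s(2) truncate_coord_space] by simp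
qed

lemma iso_of_splitting:
  fixes I :: "('p::order, 'k::field) sheaf"
  assumes I: "sheaf_on P I" and S: "splitting P I ps E U"
  shows "sheaf_iso P I (inj_sum ps)"
proof -
  let ?D = "inj_sum ps :: ('p, 'k) sheaf"
  note D = splittingD[OF S]
  let ?\<phi> = "\<lambda>s. mat_of (stalk_dim ?D s) (stalk_dim I s) (\<lambda>x. pack ps s (E s x))"
  let ?\<psi> = "\<lambda>s. mat_of (stalk_dim I s) (stalk_dim ?D s) (\<lambda>x. U s (spread ps s x))"
  have l: "lin (\<lambda>x. pack ps s (E s x))" "lin (\<lambda>x. U s (spread ps s x))" if "s \<in> P" for s
    using that by (auto intro: lin_comp[OF D(2) lin_pack] lin_comp[OF lin_spread D(3)])
  have m: "U s (spread ps s x) \<in> stalk I s" if "s \<in> P" for s x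
    using that D(6) spread_coord_space by blast
  have "sheaf_hom P I ?D ?\<phi>"
  proof (rule sheaf_hom_mat_ofI[OF I sheaf_on_inj_sum l(1) pack_stalk])
    fix s t x assume s: "s \<in> P" "t \<in> P" "s \<le> t" "x \<in> stalk I s"
    show "pack ps t (E t (res I s t x)) = res ?D s t (pack ps s (E s x))"
      using splitting_res_U[OF sheaf_on_inj_sum splitting_inj_sum[OF D(1)] s(1-3) D(4)[OF s(1,4)]] D(8)[OF s]
      by simp
  qed
  moreover have "sheaf_hom P ?D I ?\<psi>"
  proof (rule sheaf_hom_mat_ofI[OF sheaf_on_inj_sum I l(2) m])
    fix s t x assume s: "s \<in> P" "t \<in> P" "s \<le> t" "x \<in> stalk ?D s"
    show "U t (spread ps t (res ?D s t x)) = res I s t (U s (spread ps s x))"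
      using splitting_res_U[OF I S s(1-3) spread_coord_space] by (simp add: spread_res[OF s(3)])
  qed
  moreover have "?\<psi> s * ?\<phi> s = 1\<^sub>m (stalk_dim I s) \<and> ?\<phi> s * ?\<psi> s = 1\<^sub>m (stalk_dim ?D s)" if s: "s \<in> P" for s
  proof
    show "?\<psi> s * ?\<phi> s = 1\<^sub>m (stalk_dim I s)"
      by (rule act_mat_eqI[of _ "stalk_dim I s" "stalk_dim I s"])
        (auto simp: act_mult[OF mat_of_carrier mat_of_carrier] act_mat_of l s m pack_stalk act_one
          spread_pack D(4,5) intro: mult_carrier_mat[OF mat_of_carrier mat_of_carrier])
    show "?\<phi> s * ?\<psi> s = 1\<^sub>m (stalk_dim ?D s)"
      by (rule act_mat_eqI[of _ "stalk_dim ?D s" "stalk_dim ?D s"])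
        (auto simp: act_mult[OF mat_of_carrier mat_of_carrier] act_mat_of l s m pack_stalk act_one
          pack_spread spread_coord_space D(7) intro: mult_carrier_mat[OF mat_of_carrier mat_of_carrier])
  qed
  ultimately show ?thesis unfolding sheaf_iso_def by blast
qed

section \<open>Socles and multiplicities\<close>

definition socle :: "'p::order set \<Rightarrow> ('p, 'k::field) sheaf \<Rightarrow> 'p \<Rightarrow> 'k seqs" where
  "socle P F \<pi> = {x \<in> stalk F \<pi>. \<forall>t\<in>P. \<pi> < t \<longrightarrow> res F \<pi> t x = 0}"

lemma fd_socle: "fd (socle P F \<pi>)"
proof -
  have "V.subspace (stalk F \<pi> \<inter> (\<Inter>t\<in>{t\<in>P. \<pi> < t}. {x. res F \<pi> t x = 0}))"
    by (intro V.subspace_inter V.subspace_Inter subspace_kn)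
      (auto intro: VP.linear_subspace_kernel lin_act)
  moreover have "socle P F \<pi> = stalk F \<pi> \<inter> (\<Inter>t\<in>{t\<in>P. \<pi> < t}. {x. res F \<pi> t x = 0})"
    by (auto simp: socle_def)
  ultimately show ?thesis using fd_subset[OF fd_kn, of "socle P F \<pi>" "stalk_dim F \<pi>"]
    by (auto simp: socle_def)
qed

text \<open>A coordinate labelled by an element strictly above \<open>\<pi>\<close> survives
  restriction to that element, while one labelled \<open>\<pi>\<close> is lost on every larger
  element.\<close>

lemma mem_socle_iff:
  assumes I: "sheaf_on P I" and S: "splitting P I ps E U" and \<pi>: "\<pi> \<in> P" and x: "x \<in> stalk I \<pi>"
  shows "x \<in> socle P I \<pi> \<longleftrightarrow> E \<pi> x \<in> coord_space {i. i < length ps \<and> ps ! i = \<pi>}"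
proof
  note D = splittingD[OF S]
  assume s: "x \<in> socle P I \<pi>"
  have "E \<pi> x i = 0" if i: "\<not> (i < length ps \<and> ps ! i = \<pi>)" for i
  proof (cases "i \<in> labels ps \<pi>")
    case True
    \<comment> \<open>The label itself is the element at which the restriction of \<open>x\<close>
      is tested.\<close>
    then have lt: "\<pi> < ps ! i" "ps ! i \<in> P" using i D(1) by (auto simp: labels_def)
    then have "truncate (labels ps (ps ! i)) (E \<pi> x) = 0"
      using D(8)[OF \<pi> lt(2) _ x] s lin_zero[OF D(2)[OF lt(2)]] by (auto simp: socle_def)
    then have "truncate (labels ps (ps ! i)) (E \<pi> x) i = 0" by simp
    then show ?thesis using True by (simp add: truncate_def labels_def)
  qed (use D(4)[OF \<pi> x] in \<open>auto simp: coord_space_def\<close>)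
  then show "E \<pi> x \<in> coord_space {i. i < length ps \<and> ps ! i = \<pi>}" by (auto simp: coord_space_def)
next
  note D = splittingD[OF S]
  assume c: "E \<pi> x \<in> coord_space {i. i < length ps \<and> ps ! i = \<pi>}"
  have "res I \<pi> t x = 0" if t: "t \<in> P" "\<pi> < t" for t
  proof -
    have "truncate (labels ps t) (E \<pi> x) = 0"
      using c t by (auto simp: truncate_def coord_space_def labels_def fun_eq_iff)
    then have "E t (res I \<pi> t x) = 0" using D(8)[OF \<pi> t(1) _ x] t by simp
    moreover have "U t (E t (res I \<pi> t x)) = res I \<pi> t x"
      using t by (intro D(5) sheaf_onD(2)[OF I \<pi>]) auto
    ultimately show ?thesis using lin_zero[OF D(3)[OF t(1)]] by simp
  qed
  then show "x \<in> socle P I \<pi>" using x by (auto simp: socle_def)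
qed

lemma dim_socle_splitting:
  assumes I: "sheaf_on P I" and S: "splitting P I ps E U" and \<pi>: "\<pi> \<in> P"
  shows "V.dim (socle P I \<pi>) = count_list ps \<pi>"
proof -
  note D = splittingD[OF S]
  let ?A = "{i. i < length ps \<and> ps ! i = \<pi>}"
  have "E \<pi> ` socle P I \<pi> = coord_space ?A"
  proof
    show "E \<pi> ` socle P I \<pi> \<subseteq> coord_space ?A"
      using mem_socle_iff[OF I S \<pi>] by (auto simp: socle_def)
    show "coord_space ?A \<subseteq> E \<pi> ` socle P I \<pi>"
    proof
      fix f :: "nat \<Rightarrow> 'b" assume f: "f \<in> coord_space ?A"
      then have f': "f \<in> coord_space (labels ps \<pi>)" by (auto simp: coord_space_def labels_def)
      show "f \<in> E \<pi> ` socle P I \<pi>"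
        using mem_socle_iff[OF I S \<pi> D(6)[OF \<pi> f']] D(7)[OF \<pi> f'] f by (metis imageI)
    qed
  qed
  moreover have "V.dim (E \<pi> ` socle P I \<pi>) = V.dim (socle P I \<pi>)"
  proof (rule dim_image_inj[OF fd_socle D(2)[OF \<pi>]])
    fix x assume "x \<in> socle P I \<pi>" "E \<pi> x = 0"
    then show "x = 0" using D(5)[OF \<pi>, of x] lin_zero[OF D(3)[OF \<pi>]] by (auto simp: socle_def)
  qed
  moreover have "count_list ps \<pi> = card ?A"
    by (simp add: count_list_eq_length_filter length_filter_conv_card eq_commute)
  ultimately show ?thesis by (simp add: dim_coord_space)
qed

text \<open>The socle is defined without a decomposition, so every decomposition yields the same
  count and the definite description is justified.\<close>

lemma multiplicity_in_eq_dim_socle: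
  assumes I: "sheaf_on P I" and S: "splitting P I ps E U" and \<pi>: "\<pi> \<in> P"
  shows "multiplicity_in P I \<pi> = V.dim (socle P I \<pi>)"
  unfolding multiplicity_in_def
proof (rule the_equality)
  show "\<exists>ps. set ps \<subseteq> P \<and> sheaf_iso P I (inj_sum ps) \<and> V.dim (socle P I \<pi>) = count_list ps \<pi>"
    using iso_of_splitting[OF I S] splittingD(1)[OF S] dim_socle_splitting[OF I S \<pi>] by blast
  fix m assume "\<exists>ps. set ps \<subseteq> P \<and> sheaf_iso P I (inj_sum ps) \<and> m = count_list ps \<pi>"
  then obtain qs where r: "set qs \<subseteq> P" "sheaf_iso P I (inj_sum qs)" "m = count_list qs \<pi>" by blast
  obtain E' U' where "splitting P I qs E' U'" using splitting_of_iso[OF I r(1,2)] .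
  then show "m = V.dim (socle P I \<pi>)" using dim_socle_splitting[OF I _ \<pi>] r(3) by metis
qed

text \<open>Homomorphisms into a sum of sheaves \<open>[\<pi>]\<close> are families of functionals on the stalks at the \<open>\<pi>\<close>.\<close>

lemma exists_hom_into_splitting:
  assumes M: "sheaf_on P M" and I: "sheaf_on P I" and S: "splitting P I ps E U"
    and w: "\<And>i x y. i < length ps \<Longrightarrow> w i (x + y) = w i x + (w i y :: 'k::field)"
      "\<And>i c x. i < length ps \<Longrightarrow> w i (scl c x) = c * w i x"
  obtains \<psi> where "sheaf_hom P M I \<psi>"
    "\<And>s x i. s \<in> P \<Longrightarrow> x \<in> stalk M s \<Longrightarrow> i \<in> labels ps s \<Longrightarrow> E s (act (\<psi> s) x) i = w i (res M s (ps ! i) x)"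
proof -
  note D = splittingD[OF S]
  define f where "f = (\<lambda>s x i. if i \<in> labels ps s then w i (res M s (ps ! i) x) else 0)"
  have fc: "f s x \<in> coord_space (labels ps s)" for s x by (auto simp: f_def coord_space_def)
  have lf: "lin (f s)" for s
    by (rule linI)
      (auto simp: f_def fun_eq_iff scl_apply lin_add[OF lin_act] lin_scale[OF lin_act] w labels_def)
  have l: "lin (\<lambda>x. U s (f s x))" if "s \<in> P" for s by (rule lin_comp[OF lf D(3)[OF that]])
  have m: "U s (f s x) \<in> stalk I s" if "s \<in> P" for s x using that D(6) fc by blast
  let ?\<psi> = "\<lambda>s. mat_of (stalk_dim I s) (stalk_dim M s) (\<lambda>x. U s (f s x))"
  have "sheaf_hom P M I ?\<psi>"
  proof (rule sheaf_hom_mat_ofI[OF M I l m])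
    fix s t x assume s: "s \<in> P" "t \<in> P" "s \<le> t" "x \<in> stalk M s"
    have "f t (res M s t x) = truncate (labels ps t) (f s x)"
    proof
      fix i
      have "i \<in> labels ps s" "ps ! i \<in> P" "t \<le> ps ! i" if "i \<in> labels ps t"
        using that s D(1) by (auto simp: labels_def)
      then show "f t (res M s t x) i = truncate (labels ps t) (f s x) i"
        using sheaf_onD(4)[OF M s(1) s(2,3), of "ps ! i" x]
        by (auto simp: f_def truncate_def)
    qed
    then show "U t (f t (res M s t x)) = res I s t (U s (f s x))"
      using splitting_res_U[OF I S s(1-3) fc] by simp
  qed
  moreover have "E s (act (?\<psi> s) x) i = w i (res M s (ps ! i) x)"
    if "s \<in> P" "x \<in> stalk M s" "i \<in> labels ps s" for s x i
    using that by (simp add: act_mat_of l m D(7) fc) (simp add: f_def)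
  ultimately show ?thesis by (rule that)
qed

text \<open>A homomorphism into the sum is a family of functionals on the stalks at the labels, so
  extension along a monomorphism is needed only stalkwise, where a linear left inverse
  exists.\<close>

lemma injective_sheaf_splitting:
  assumes I: "sheaf_on P I" and S: "splitting P I ps E U"
  shows "injective_sheaf P I"
  unfolding injective_sheaf_def
proof (intro conjI allI impI)
  show "sheaf_on P I" by fact
  note D = splittingD[OF S]
  fix A B \<iota> \<phi>
  assume A: "sheaf_on P A" and B: "sheaf_on P B" and \<iota>: "sheaf_mono P A B \<iota>" and \<phi>: "sheaf_hom P A I \<phi>"
  have \<iota>h: "sheaf_hom P A B \<iota>" using \<iota> by (simp add: sheaf_mono_def)
  have \<pi>P: "ps ! i \<in> P" if "i < length ps" for i using that D(1) by auto
  have "\<exists>g. lin g \<and> (\<forall>x\<in>stalk A s. g (act (\<iota> s) x) = x)" if "s \<in> P" for s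
  proof -
    have "inj_on (act (\<iota> s)) (stalk A s)"
      using \<iota> that unfolding VP.linear_inj_on_iff_eq_0[OF lin_act subspace_kn] sheaf_mono_iff by blast
    from VP.linear_exists_left_inverse_on[OF lin_act subspace_kn this] show ?thesis by blast
  qed
  then obtain g where g: "\<And>s. s \<in> P \<Longrightarrow> lin (g s)" "\<And>s x. s \<in> P \<Longrightarrow> x \<in> stalk A s \<Longrightarrow> g s (act (\<iota> s) x) = x"
    by metis
  \<comment> \<open>The components of \<open>\<phi>\<close> at the label \<open>ps ! i\<close>,
    extended from the stalk of \<open>A\<close> to that of \<open>B\<close> through the left inverse
    \<open>g\<close>. No compatibility between the left inverses at different elements is
    required.\<close>
  define h where "h = (\<lambda>i y. E (ps ! i) (act (\<phi> (ps ! i)) (g (ps ! i) y)))"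
  have lh: "lin (h i)" if "i < length ps" for i
    unfolding h_def by (rule lin_comp[OF g(1)[OF \<pi>P[OF that]] lin_comp[OF lin_act D(2)[OF \<pi>P[OF that]]]])
  obtain \<psi> where \<psi>: "sheaf_hom P B I \<psi>"
    "\<And>s x i. s \<in> P \<Longrightarrow> x \<in> stalk B s \<Longrightarrow> i \<in> labels ps s \<Longrightarrow> E s (act (\<psi> s) x) i = h i (res B s (ps ! i) x) i"
    by (rule exists_hom_into_splitting[OF B I S, of "\<lambda>i x. h i x i"])
      (auto simp: lin_add[OF lh] lin_scale[OF lh] scl_apply)
  have "\<psi> s * \<iota> s = \<phi> s" if s: "s \<in> P" for s
  proof (rule act_mat_eqI[of _ "stalk_dim I s" "stalk_dim A s"])
    show "\<psi> s * \<iota> s \<in> carrier_mat (stalk_dim I s) (stalk_dim A s)"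
      by (rule mult_carrier_mat[OF sheaf_homD(1)[OF \<psi>(1) s] sheaf_homD(1)[OF \<iota>h s]])
    show "\<phi> s \<in> carrier_mat (stalk_dim I s) (stalk_dim A s)" by (rule sheaf_homD(1)[OF \<phi> s])
    fix x assume x: "x \<in> stalk A s"
    have "act (\<psi> s) (act (\<iota> s) x) = act (\<phi> s) x"
    proof (rule splitting_eqI[OF S s sheaf_homD(2)[OF \<psi>(1) s] sheaf_homD(2)[OF \<phi> s]])
      show "E s (act (\<psi> s) (act (\<iota> s) x)) = E s (act (\<phi> s) x)"
      proof
        fix i
        show "E s (act (\<psi> s) (act (\<iota> s) x)) i = E s (act (\<phi> s) x) i"
        proof (cases "i \<in> labels ps s")
          case True
          let ?p = "ps ! i"
          have p: "?p \<in> P" "s \<le> ?p" "i \<in> labels ps ?p" using True \<pi>P by (auto simp: labels_def)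
          have "E s (act (\<psi> s) (act (\<iota> s) x)) i = h i (res B s ?p (act (\<iota> s) x)) i"
            by (rule \<psi>(2)[OF s sheaf_homD(2)[OF \<iota>h s] True])
          also have "res B s ?p (act (\<iota> s) x) = act (\<iota> ?p) (res A s ?p x)"
            using sheaf_homD(3)[OF \<iota>h s A B p(1,2)] by simp
          also have "h i \<dots> = E ?p (act (\<phi> ?p) (res A s ?p x))"
            unfolding h_def using g(2)[OF p(1) sheaf_onD(2)[OF A s p(1,2)]] by simp
          also have "\<dots> = E ?p (res I s ?p (act (\<phi> s) x))"
            using sheaf_homD(3)[OF \<phi> s A I p(1,2)] by simp
          also have "\<dots> = truncate (labels ps ?p) (E s (act (\<phi> s) x))"
            by (rule D(8)[OF s p(1,2) sheaf_homD(2)[OF \<phi> s]])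
          finally show ?thesis using p(3) by (simp add: truncate_def)
        next
          case False
          then show ?thesis
            using D(4)[OF s sheaf_homD(2)[OF \<psi>(1) s]] D(4)[OF s sheaf_homD(2)[OF \<phi> s]]
            by (simp add: coord_space_def)
        qed
      qed
    qed
    then show "act (\<psi> s * \<iota> s) x = act (\<phi> s) x"
      by (simp add: act_mult[OF sheaf_homD(1)[OF \<psi>(1) s] sheaf_homD(1)[OF \<iota>h s]])
  qed
  then show "\<exists>\<psi>. sheaf_hom P B I \<psi> \<and> (\<forall>\<sigma>\<in>P. \<psi> \<sigma> * \<iota> \<sigma> = \<phi> \<sigma>)" using \<psi>(1) by blast
qed

section \<open>Minimal injective resolutions\<close>

text \<open>Induction downwards from the maximal elements. It propagates information from socles to
  stalks: at each step all proper restrictions are already known to be trivial.\<close>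

lemma finite_poset_induct [consumes 2, case_names above]:
  fixes P :: "'p::order set"
  assumes "finite P" "s \<in> P"
    and step: "\<And>s. s \<in> P \<Longrightarrow> (\<And>t. t \<in> P \<Longrightarrow> s < t \<Longrightarrow> R t) \<Longrightarrow> R s"
  shows "R s"
  using assms(2)
proof (induction "card {t \<in> P. s < t}" arbitrary: s rule: less_induct)
  case less
  show ?case
  proof (rule step[OF less.prems])
    fix t assume t: "t \<in> P" "s < t"
    then have "{u \<in> P. t < u} \<subset> {u \<in> P. s < u}" by auto
    then have "card {u \<in> P. t < u} < card {u \<in> P. s < u}"
      using assms(1) by (intro psubset_card_mono) auto
    then show "R t" using less.hyps t by blast
  qed
qed

text \<open>Applied to \<open>B = 0\<close> this embeds \<open>M\<close> into its injective hull; applied to the image of a differential it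
  yields the next differential of the minimal resolution, without passing to the cokernel.\<close>

lemma exists_hull_of_quotient:
  fixes P :: "'p::order set" and M :: "('p, 'k::field) sheaf"
  assumes P: "finite P" and M: "sheaf_on P M"
    and B: "\<And>s. s \<in> P \<Longrightarrow> V.subspace (B s)" "\<And>s. s \<in> P \<Longrightarrow> B s \<subseteq> stalk M s"
      "\<And>s t x. s \<in> P \<Longrightarrow> t \<in> P \<Longrightarrow> s \<le> t \<Longrightarrow> x \<in> B s \<Longrightarrow> res M s t x \<in> B t"
  obtains ps \<phi> where "set ps \<subseteq> P" "sheaf_hom P M (inj_sum ps) \<phi>"
    "\<And>s x. s \<in> P \<Longrightarrow> x \<in> stalk M s \<Longrightarrow> act (\<phi> s) x = 0 \<longleftrightarrow> x \<in> B s"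
    "\<And>s. s \<in> P \<Longrightarrow> socle P (inj_sum ps) s \<subseteq> act (\<phi> s) ` stalk M s"
    "\<And>\<pi>. \<pi> \<in> set ps \<Longrightarrow> B \<pi> \<noteq> stalk M \<pi>"
proof -
  note MD = sheaf_onD[OF M]
  \<comment> \<open>The preimage in \<open>M\<close> of the socle of \<open>M / B\<close>: the socle
    at \<open>s\<close> is \<open>Q s / B s\<close>.\<close>
  define Q where "Q = (\<lambda>s. {x \<in> stalk M s. \<forall>t\<in>P. s < t \<longrightarrow> res M s t x \<in> B t})"
  have fQ: "fd (Q s)" if s: "s \<in> P" for s
  proof -
    have "V.subspace (stalk M s \<inter> (\<Inter>t\<in>{t\<in>P. s < t}. {x. res M s t x \<in> B t}))"
      by (intro V.subspace_inter V.subspace_Inter subspace_kn)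
        (auto intro!: VP.linear_subspace_linear_preimage lin_act B)
    moreover have "Q s = stalk M s \<inter> (\<Inter>t\<in>{t\<in>P. s < t}. {x. res M s t x \<in> B t})"
      by (auto simp: Q_def)
    ultimately show ?thesis using fd_subset[OF fd_kn, of "Q s" "stalk_dim M s"]
      by (auto simp: Q_def)
  qed
  have BQ: "B s \<subseteq> Q s" if "s \<in> P" for s using that B(2,3) by (auto simp: Q_def)
  have "\<forall>s\<in>P. \<exists>Wm. lin (fst Wm) \<and> range (fst Wm) \<subseteq> kn (snd Wm) \<and> fst Wm ` Q s = kn (snd Wm) \<and>
      {x \<in> Q s. fst Wm x = 0} = B s"
  proof
    fix s assume s: "s \<in> P"
    obtain W m where "lin W" "range W \<subseteq> kn m" "W ` Q s = kn m" "{x \<in> Q s. W x = 0} = B s"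
      using exists_quotient_map[OF fQ[OF s] B(1)[OF s] BQ[OF s]] .
    then show "\<exists>Wm. lin (fst Wm) \<and> range (fst Wm) \<subseteq> kn (snd Wm) \<and> fst Wm ` Q s = kn (snd Wm) \<and>
      {x \<in> Q s. fst Wm x = 0} = B s" by (intro exI[of _ "(W, m)"]) simp
  qed
  from bchoice[OF this] obtain Wm where Wm: "\<forall>s\<in>P. lin (fst (Wm s)) \<and> range (fst (Wm s)) \<subseteq> kn (snd (Wm s)) \<and>
      fst (Wm s) ` Q s = kn (snd (Wm s)) \<and> {x \<in> Q s. fst (Wm s) x = 0} = B s" by (elim exE)
  define W where "W = (\<lambda>s. fst (Wm s))"
  define m where "m = (\<lambda>s. snd (Wm s))"
  have W: "lin (W s)" "W s x \<in> kn (m s)" "W s ` Q s = kn (m s)" "{x \<in> Q s. W s x = 0} = B s" if "s \<in> P" for s x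
    using bspec[OF Wm that] by (auto simp: W_def m_def)
  obtain xs where xs: "set xs = P" "distinct xs" using finite_distinct_list[OF P] by blast
  \<comment> \<open>One summand \<open>[p]\<close> for every coordinate \<open>k < m p\<close> of
    the socle of \<open>M / B\<close> at \<open>p\<close>.\<close>
  define L where "L = concat (map (\<lambda>p. map (Pair p) [0..<m p]) xs)"
  have setL: "set L = {(p, k). p \<in> P \<and> k < m p}" using xs by (auto simp: L_def)
  have distL: "distinct L" unfolding L_def using xs(2)
    by (induction xs) (auto simp: distinct_map inj_on_def)
  define ps where "ps = map fst L"
  have len: "length ps = length L" by (simp add: ps_def)
  have nthL: "ps ! i = fst (L ! i)" "fst (L ! i) \<in> P" "snd (L ! i) < m (fst (L ! i))" if "i < length L" for i
    using that nth_mem[OF that] setL by (auto simp: ps_def)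
  have \<pi>P: "set ps \<subseteq> P" by (auto simp: ps_def setL)
  \<comment> \<open>A coordinate of the socle of \<open>M / B\<close> at the label, extended to the
    whole stalk of \<open>M\<close> there because \<open>W\<close> is defined everywhere. These
    functionals define the map into the hull.\<close>
  define w where "w = (\<lambda>i x. W (fst (L ! i)) x (snd (L ! i)))"
  note S = splitting_inj_sum[OF \<pi>P]
  have wlin: "w i (x + y) = w i x + w i y" "w i (scl c x) = c * w i x" if "i < length ps" for i x y c
  proof -
    have "lin (W (fst (L ! i)))" using that nthL(2) len by (auto intro: W(1))
    then show "w i (x + y) = w i x + w i y" "w i (scl c x) = c * w i x"
      using lin_add[of "W (fst (L ! i))" x y] lin_scale[of "W (fst (L ! i))" c x]
      by (simp_all add: w_def scl_apply)
  qed
  obtain \<phi> where \<phi>: "sheaf_hom P M (inj_sum ps) \<phi>"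
    "\<And>s x i. s \<in> P \<Longrightarrow> x \<in> stalk M s \<Longrightarrow> i \<in> labels ps s \<Longrightarrow>
      spread ps s (act (\<phi> s) x) i = w i (res M s (ps ! i) x)"
    using exists_hom_into_splitting[OF M sheaf_on_inj_sum S, of w] wlin by metis
  have WB: "W s x = 0" if "s \<in> P" "x \<in> B s" for s x using W(4)[OF that(1)] that(2) by auto
  have ker: "act (\<phi> s) x = 0 \<longleftrightarrow> (\<forall>p\<in>P. s \<le> p \<longrightarrow> W p (res M s p x) = 0)"
    if s: "s \<in> P" and x: "x \<in> stalk M s" for s x
  proof
    assume z: "act (\<phi> s) x = 0"
    show "\<forall>p\<in>P. s \<le> p \<longrightarrow> W p (res M s p x) = 0"
    proof (intro ballI impI ext)
      fix p k assume p: "p \<in> P" "s \<le> p"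
      show "W p (res M s p x) k = 0 k"
      proof (cases "k < m p")
        case True
        then have "(p, k) \<in> set L" using setL p by auto
        then obtain i where i: "i < length L" "L ! i = (p, k)" by (auto simp: in_set_conv_nth)
        then have "i \<in> labels ps s" using p nthL(1)[OF i(1)] len by (auto simp: labels_def)
        then have "0 = w i (res M s (ps ! i) x)"
          using \<phi>(2)[OF s x] z lin_zero[OF lin_spread[of ps s]] by (metis zero_fun_apply)
        then show ?thesis using i nthL(1)[OF i(1)] by (simp add: w_def)
      next
        case False
        then show ?thesis using W(2)[OF p(1)] by (simp add: kn_def)
      qed
    qed
  next
    assume a: "\<forall>p\<in>P. s \<le> p \<longrightarrow> W p (res M s p x) = 0"
    show "act (\<phi> s) x = 0"
    proof (rule splitting_eqI[OF S s sheaf_homD(2)[OF \<phi>(1) s] fd_zero[OF fd_kn]])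
      have "spread ps s (act (\<phi> s) x) i = 0" for i
      proof (cases "i \<in> labels ps s")
        case True
        then have "i < length L" "s \<le> fst (L ! i)" using nthL(1) by (auto simp: labels_def len)
        then show ?thesis using \<phi>(2)[OF s x True] a nthL(1,2)[of i] by (simp add: w_def)
      qed (use spread_coord_space[of ps s] in \<open>auto simp: coord_space_def\<close>)
      then show "spread ps s (act (\<phi> s) x) = spread ps s 0"
        unfolding lin_zero[OF lin_spread[of ps s]] by (intro ext) simp
    qed
  qed
  \<comment> \<open>By induction from above, all proper restrictions of \<open>x\<close> lie in
    \<open>B\<close>. Then \<open>x\<close> represents a socle element of \<open>M / B\<close>, and
    there \<open>W s\<close> detects whether it is zero.\<close>
  have kerB: "x \<in> B s" if "s \<in> P" "x \<in> stalk M s" "\<forall>p\<in>P. s \<le> p \<longrightarrow> W p (res M s p x) = 0" for s x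
    using P that
  proof (induction s arbitrary: x rule: finite_poset_induct)
    case (above s)
    have "res M s t x \<in> B t" if t: "t \<in> P" "s < t" for t
    proof (rule above.IH[OF t])
      have st: "s \<le> t" using t by simp
      show "res M s t x \<in> stalk M t" by (rule MD(2)[OF above.hyps t(1) st])
      show "\<forall>p\<in>P. t \<le> p \<longrightarrow> W p (res M t p (res M s t x)) = 0"
        using MD(4)[OF above.hyps t(1) st] above.prems(2) st by (auto dest: order_trans[OF st])
    qed
    then have "x \<in> Q s" using above.prems(1) by (auto simp: Q_def)
    moreover have "W s x = 0" using above.prems above.hyps MD(3)[OF above.hyps] by force
    ultimately show ?case using W(4)[OF above.hyps] by auto
  qed
  show ?thesis
  proof (rule that[OF \<pi>P \<phi>(1)])
    show "act (\<phi> s) x = 0 \<longleftrightarrow> x \<in> B s" if s: "s \<in> P" "x \<in> stalk M s" for s x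
      using ker[OF s] kerB[OF s] WB B(3)[OF s(1)] by blast
    show "socle P (inj_sum ps) s \<subseteq> act (\<phi> s) ` stalk M s" if s: "s \<in> P" for s
    proof
      fix y assume y: "y \<in> socle P (inj_sum ps :: ('p, 'k) sheaf) s"
      then have yD: "y \<in> stalk (inj_sum ps :: ('p, 'k) sheaf) s" by (simp add: socle_def)
      define f where "f = spread ps s y"
      have f: "f i = 0" if "\<not> (i < length L \<and> fst (L ! i) = s)" for i
        using mem_socle_iff[OF sheaf_on_inj_sum S s yD] y that nthL(1)[of i] len
        by (auto simp: f_def coord_space_def)
      \<comment> \<open>The coordinates of \<open>y\<close> at the summands \<open>[s]\<close>,
        indexed by \<open>k\<close>. They lie in the image of \<open>W s\<close> on
        \<open>Q s\<close>, which provides a preimage of \<open>y\<close>; at labels strictly above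
        \<open>s\<close> that preimage restricts into \<open>B\<close> and contributes
        nothing.\<close>
      define g where "g = (\<lambda>k. if k < m s then f (THE i. i < length L \<and> L ! i = (s, k)) else 0)"
      have "g \<in> W s ` Q s" unfolding W(3)[OF s] by (simp add: g_def kn_def)
      then obtain x where x: "x \<in> Q s" "W s x = g" by blast
      then have xM: "x \<in> stalk M s" by (simp add: Q_def)
      have "act (\<phi> s) x = y"
      proof (rule splitting_eqI[OF S s sheaf_homD(2)[OF \<phi>(1) s] yD], rule ext)
        fix i
        show "spread ps s (act (\<phi> s) x) i = spread ps s y i"
        proof (cases "i \<in> labels ps s")
          case False
          then show ?thesis
            using spread_coord_space[of ps s "act (\<phi> s) x"] spread_coord_space[of ps s y]
            by (simp add: coord_space_def)
        next
          case True
          then have i: "i < length L" "s \<le> fst (L ! i)" using nthL(1) by (auto simp: labels_def len)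
          have eq: "spread ps s (act (\<phi> s) x) i = W (fst (L ! i)) (res M s (fst (L ! i)) x) (snd (L ! i))"
            using \<phi>(2)[OF s xM True] nthL(1)[OF i(1)] by (simp add: w_def)
          show ?thesis
          proof (cases "fst (L ! i) = s")
            case fs: True
            have "(THE i'. i' < length L \<and> L ! i' = (s, snd (L ! i))) = i"
              by (rule the_equality)
                (use i fs nth_eq_iff_index_eq[OF distL, of _ i] in \<open>auto simp: prod_eq_iff\<close>)
            then have "g (snd (L ! i)) = f i" using nthL(3)[OF i(1)] fs by (simp add: g_def)
            then show ?thesis using eq fs MD(3)[OF s xM] x(2) by (simp add: f_def)
          next
            case fs: False
            then have "res M s (fst (L ! i)) x \<in> B (fst (L ! i))"
              using x(1) i nthL(2)[OF i(1)] by (auto simp: Q_def)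
            then have "W (fst (L ! i)) (res M s (fst (L ! i)) x) = 0" using WB nthL(2)[OF i(1)] by blast
            then show ?thesis using eq f fs by (simp add: f_def)
          qed
        qed
      qed
      then show "y \<in> act (\<phi> s) ` stalk M s" using xM by blast
    qed
    \<comment> \<open>Where \<open>B\<close> is the whole stalk, \<open>W\<close> vanishes on
      \<open>Q \<pi>\<close>, so there is no coordinate to index a summand. This is what makes the
      resolution terminate.\<close>
    show "B \<pi> \<noteq> stalk M \<pi>" if \<pi>: "\<pi> \<in> set ps" for \<pi>
    proof
      assume eq: "B \<pi> = stalk M \<pi>"
      obtain k where k: "\<pi> \<in> P" "k < m \<pi>" using \<pi> setL by (auto simp: ps_def)
      then have "unit_seq k \<in> W \<pi> ` Q \<pi>" using W(3) unit_seq_kn by blast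
      then obtain x where x: "x \<in> Q \<pi>" "W \<pi> x = unit_seq k" by auto
      then have "x \<in> B \<pi>" using eq by (simp add: Q_def)
      then have "unit_seq k = (0 :: nat \<Rightarrow> 'k)" using WB k(1) x(2) by metis
      then have "unit_seq k k = (0 :: 'k)" by (metis zero_fun_apply)
      then show False by (simp add: unit_seq_def)
    qed
  qed
qed

text \<open>Injectivity gives a retraction \<open>\<psi>\<close> of the embedding
  \<open>\<iota>\<close> into the hull. The socle of the hull lies in the image of
  \<open>\<iota>\<close>, where \<open>\<psi>\<close> is injective; a map injective on socles is
  injective, so \<open>\<psi>\<close> is an isomorphism.\<close>

lemma exists_splitting_of_injective:
  fixes P :: "'p::order set" and I :: "('p, 'k::field) sheaf"
  assumes P: "finite P" and I: "injective_sheaf P I"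
  obtains ps E U where "splitting P I ps E U"
proof -
  have IS: "sheaf_on P I" using I by (simp add: injective_sheaf_def)
  obtain ps \<iota> where ps: "set ps \<subseteq> P" and \<iota>: "sheaf_hom P I (inj_sum ps) \<iota>"
    and ker: "\<And>s x. s \<in> P \<Longrightarrow> x \<in> stalk I s \<Longrightarrow> act (\<iota> s) x = 0 \<longleftrightarrow> x \<in> {0}"
    and soc: "\<And>s. s \<in> P \<Longrightarrow> socle P (inj_sum ps) s \<subseteq> act (\<iota> s) ` stalk I s"
    by (rule exists_hull_of_quotient[OF P IS, of "\<lambda>_. {0}"])
      (auto simp: V.subspace_single_0 fd_zero[OF fd_kn] lin_zero[OF lin_act])
  let ?D = "inj_sum ps :: ('p, 'k) sheaf"
  have "sheaf_mono P I ?D \<iota>" using \<iota> ker by (auto simp: sheaf_mono_iff)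
  moreover have "sheaf_hom P I I (\<lambda>s. 1\<^sub>m (stalk_dim I s))"
    by (rule sheaf_homI[OF IS IS]) (auto simp: act_one sheaf_onD(2)[OF IS])
  ultimately obtain \<psi> where \<psi>: "sheaf_hom P ?D I \<psi>" "\<And>s. s \<in> P \<Longrightarrow> \<psi> s * \<iota> s = 1\<^sub>m (stalk_dim I s)"
    using I IS sheaf_on_inj_sum unfolding injective_sheaf_def by blast
  have \<psi>\<iota>: "act (\<psi> s) (act (\<iota> s) x) = x" if "s \<in> P" "x \<in> stalk I s" for s x
    using \<psi>(2)[OF that(1)] act_mult[OF sheaf_homD(1)[OF \<psi>(1) that(1)] sheaf_homD(1)[OF \<iota> that(1)]]
      act_one[OF that(2)] by metis
  \<comment> \<open>If every proper restriction of a kernel element is zero, the element lies in the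
    socle, hence in the image of \<open>\<iota>\<close>, on which \<open>\<psi>\<close> has no
    kernel.\<close>
  have inj: "y = 0" if "s \<in> P" "y \<in> stalk ?D s" "act (\<psi> s) y = 0" for s y
    using P that
  proof (induction s arbitrary: y rule: finite_poset_induct)
    case (above s)
    have "res ?D s t y = 0" if t: "t \<in> P" "s < t" for t
    proof (rule above.IH[OF t])
      have st: "s \<le> t" using t by simp
      show "res ?D s t y \<in> stalk ?D t" by (rule sheaf_onD(2)[OF sheaf_on_inj_sum above.hyps t(1) st])
      show "act (\<psi> t) (res ?D s t y) = 0"
        using sheaf_homD(3)[OF \<psi>(1) above.hyps sheaf_on_inj_sum IS t(1) st, of y] above.prems(2)
          lin_zero[OF lin_act] by metis
    qed
    then have "y \<in> socle P ?D s" using above.prems(1) by (auto simp: socle_def)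
    then obtain x where x: "x \<in> stalk I s" "y = act (\<iota> s) x" using soc[OF above.hyps] by blast
    then have "x = 0" using \<psi>\<iota>[OF above.hyps x(1)] above.prems(2) by simp
    then show ?case using x lin_zero[OF lin_act] by metis
  qed
  have \<iota>\<psi>: "act (\<iota> s) (act (\<psi> s) y) = y" if s: "s \<in> P" "y \<in> stalk ?D s" for s y
  proof -
    have "act (\<psi> s) (act (\<iota> s) (act (\<psi> s) y) - y) = 0"
      using \<psi>\<iota>[OF s(1) sheaf_homD(2)[OF \<psi>(1) s(1)]] by (simp add: lin_diff[OF lin_act])
    moreover have "act (\<iota> s) (act (\<psi> s) y) - y \<in> stalk ?D s"
      by (intro fd_diff[OF fd_kn] sheaf_homD(2)[OF \<iota> s(1)] s(2))
    ultimately show ?thesis using inj[OF s(1)] by (metis eq_iff_diff_eq_0)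
  qed
  have "sheaf_iso P I ?D"
    unfolding sheaf_iso_def
  proof (intro exI conjI ballI)
    fix s assume s: "s \<in> P"
    note c = sheaf_homD(1)[OF \<iota> s] sheaf_homD(1)[OF \<psi>(1) s]
    show "\<psi> s * \<iota> s = 1\<^sub>m (stalk_dim I s)" by (rule \<psi>(2)[OF s])
    show "\<iota> s * \<psi> s = 1\<^sub>m (stalk_dim ?D s)"
    proof (rule act_mat_eqI[of _ "stalk_dim ?D s" "stalk_dim ?D s"])
      show "\<iota> s * \<psi> s \<in> carrier_mat (stalk_dim ?D s) (stalk_dim ?D s)" by (rule mult_carrier_mat[OF c])
      show "act (\<iota> s * \<psi> s) x = act (1\<^sub>m (stalk_dim ?D s)) x" if "x \<in> stalk ?D s" for x
        by (simp add: act_mult[OF c] act_one[OF that] \<iota>\<psi>[OF s that])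
    qed simp
  qed (fact \<iota> \<psi>(1))+
  then show ?thesis using splitting_of_iso[OF IS ps] that by blast
qed

lemma mat_image_eq_kernelI:
  assumes A: "A \<in> carrier_mat n m" and B: "B \<in> carrier_mat l n"
    and eq: "\<And>x. x \<in> kn n \<Longrightarrow> x \<in> act A ` kn m \<longleftrightarrow> act B x = 0"
  shows "mat_image A = mat_kernel B"
proof -
  have "v \<in> mat_image A \<longleftrightarrow> v \<in> mat_kernel B" if "v \<in> carrier_vec n" for v
    using mat_image_iff[OF A that] mat_kernel_iff[OF B that] eq[OF seq_of_vec_kn[OF that]] by simp
  moreover have "mat_kernel B \<subseteq> carrier_vec n" using B by (auto simp: mat_kernel_def)
  ultimately show ?thesis using mat_image_carrier[OF A] by blast
qed

lemma hom_image_stable: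
  assumes "sheaf_on P F" "sheaf_on P G" "sheaf_hom P F G \<phi>"
  shows "\<And>s. V.subspace (act (\<phi> s) ` stalk F s)"
    "\<And>s. s \<in> P \<Longrightarrow> act (\<phi> s) ` stalk F s \<subseteq> stalk G s"
    "\<And>s t x. s \<in> P \<Longrightarrow> t \<in> P \<Longrightarrow> s \<le> t \<Longrightarrow> x \<in> act (\<phi> s) ` stalk F s \<Longrightarrow> res G s t x \<in> act (\<phi> t) ` stalk F t"
proof -
  show "V.subspace (act (\<phi> s) ` stalk F s)" for s by (rule subspace_image[OF subspace_kn lin_act])
  show "act (\<phi> s) ` stalk F s \<subseteq> stalk G s" if "s \<in> P" for s using sheaf_homD(2)[OF assms(3) that] by auto
  show "res G s t x \<in> act (\<phi> t) ` stalk F t" if s: "s \<in> P" "t \<in> P" "s \<le> t" and x: "x \<in> act (\<phi> s) ` stalk F s" for s t x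
  proof -
    obtain y where y: "y \<in> stalk F s" "x = act (\<phi> s) y" using x by blast
    have "res G s t x = act (\<phi> t) (res F s t y)"
      using sheaf_homD(3)[OF assms(3) s(1) assms(1,2) s(2,3), of y] y by simp
    then show ?thesis using sheaf_onD(2)[OF assms(1) s, of y] by blast
  qed
qed

text \<open>Every term is the hull of the preceding term modulo the image of the incoming map. A
  hull has its socle inside the image of the map to it, and this image is the kernel of the next
  differential.\<close>

lemma exists_resolution_socle_zero:
  fixes P :: "'p::order set" and F :: "('p, 'k::field) sheaf"
  assumes P: "finite P" and F: "sheaf_on P F"
  obtains \<epsilon> I where "injective_resolution P F \<epsilon> I" "bounded_complex P I"
    "\<And>n \<pi> x. \<pi> \<in> P \<Longrightarrow> x \<in> socle P (obj I n) \<pi> \<Longrightarrow> act (diff I n \<pi>) x = 0"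
proof -
  let ?D = "\<lambda>ps. inj_sum ps :: ('p, 'k) sheaf"
  \<comment> \<open>A state consists of the labels \<open>ps\<close> of the current term and the
    image \<open>B\<close> of the map into it.\<close>
  define good where "good = (\<lambda>X :: 'p list \<times> ('p \<Rightarrow> 'k seqs). case X of (ps, B) \<Rightarrow> set ps \<subseteq> P \<and>
    (\<forall>s\<in>P. V.subspace (B s) \<and> B s \<subseteq> stalk (?D ps) s \<and>
      socle P (inj_sum ps) s \<subseteq> B s \<and>
      (\<forall>t\<in>P. s \<le> t \<longrightarrow> (\<forall>x\<in>B s. res (inj_sum ps) s t x \<in> B t))))"
  \<comment> \<open>The last clause confines the labels of the next term to the elements at which
    \<open>B\<close> is still a proper subspace; boundedness rests on it.\<close>
  define next_rel where "next_rel = (\<lambda>(X :: 'p list \<times> ('p \<Rightarrow> 'k seqs)) (Y :: 'p list \<times> ('p \<Rightarrow> 'k seqs)) \<phi>.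
    sheaf_hom P (inj_sum (fst X)) (inj_sum (fst Y)) \<phi> \<and>
    (\<forall>s\<in>P. \<forall>x\<in>stalk (?D (fst X)) s. act (\<phi> s) x = 0 \<longleftrightarrow> x \<in> snd X s) \<and>
    snd Y = (\<lambda>s. act (\<phi> s) ` stalk (?D (fst X)) s) \<and>
    (\<forall>\<pi>\<in>set (fst Y). snd X \<pi> \<noteq> stalk (?D (fst X)) \<pi>))"
  obtain ps0 \<epsilon> where 0: "set ps0 \<subseteq> P" "sheaf_hom P F (inj_sum ps0) \<epsilon>"
    "\<And>s x. s \<in> P \<Longrightarrow> x \<in> stalk F s \<Longrightarrow> act (\<epsilon> s) x = 0 \<longleftrightarrow> x \<in> {0}"
    "\<And>s. s \<in> P \<Longrightarrow> socle P (inj_sum ps0) s \<subseteq> act (\<epsilon> s) ` stalk F s"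
    by (rule exists_hull_of_quotient[OF P F, of "\<lambda>_. {0}"])
      (auto simp: V.subspace_single_0 fd_zero[OF fd_kn] lin_zero[OF lin_act])
  let ?B0 = "\<lambda>s. act (\<epsilon> s) ` stalk F s"
  have "\<exists>X. \<forall>n. (good (X n) \<and> (n = 0 \<longrightarrow> X n = (ps0, ?B0))) \<and> (\<exists>\<phi>. next_rel (X n) (X (Suc n)) \<phi>)"
  proof (rule dependent_nat_choice)
    have "good (ps0, ?B0)"
      using 0(1,4) hom_image_stable[OF F sheaf_on_inj_sum 0(2)] by (simp add: good_def)
    then show "\<exists>X. good X \<and> (0 = (0::nat) \<longrightarrow> X = (ps0, ?B0))" by blast
    fix X :: "'p list \<times> ('p \<Rightarrow> 'k seqs)" and n :: nat
    assume "good X \<and> (n = 0 \<longrightarrow> X = (ps0, ?B0))"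
    then obtain ps B where X: "X = (ps, B)" "good (ps, B)" by (cases X) auto
    obtain qs \<phi> where r: "set qs \<subseteq> P" "sheaf_hom P (inj_sum ps) (inj_sum qs) \<phi>"
      "\<And>s x. s \<in> P \<Longrightarrow> x \<in> stalk (?D ps) s \<Longrightarrow> act (\<phi> s) x = 0 \<longleftrightarrow> x \<in> B s"
      "\<And>s. s \<in> P \<Longrightarrow> socle P (inj_sum qs) s \<subseteq> act (\<phi> s) ` stalk (?D ps) s"
      "\<And>\<pi>. \<pi> \<in> set qs \<Longrightarrow> B \<pi> \<noteq> stalk (?D ps) \<pi>"
      by (rule exists_hull_of_quotient[OF P sheaf_on_inj_sum, of B ps]) (use X(2) in \<open>auto simp: good_def\<close>)
    let ?Y = "(qs, \<lambda>s. act (\<phi> s) ` stalk (?D ps) s)"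
    have "good ?Y"
      using r(1,4) hom_image_stable[OF sheaf_on_inj_sum sheaf_on_inj_sum r(2)] by (simp add: good_def)
    moreover have "next_rel X ?Y \<phi>" using r X by (auto simp: next_rel_def)
    ultimately show "\<exists>Y. (good Y \<and> (Suc n = 0 \<longrightarrow> Y = (ps0, ?B0))) \<and> (\<exists>\<phi>. next_rel X Y \<phi>)" by blast
  qed
  then obtain X where X: "\<And>n. good (X n)" "X 0 = (ps0, ?B0)" "\<And>n. \<exists>\<phi>. next_rel (X n) (X (Suc n)) \<phi>" by blast
  from X(3) obtain \<phi> where \<phi>: "\<And>n. next_rel (X n) (X (Suc n)) (\<phi> n)" by metis
  define J where "J = (\<lambda>n. ?D (fst (X n)))"
  define B where "B = (\<lambda>n. snd (X n))"
  have J: "sheaf_on P (J n)" for n by (simp add: J_def sheaf_on_inj_sum)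
  have h: "sheaf_hom P (J n) (J (Suc n)) (\<phi> n)" for n using \<phi>[of n] by (simp add: next_rel_def J_def)
  have ker: "act (\<phi> n s) x = 0 \<longleftrightarrow> x \<in> B n s" if "s \<in> P" "x \<in> stalk (J n) s" for n s x
    using \<phi>[of n] that by (simp add: next_rel_def J_def B_def)
  have im: "B (Suc n) s = act (\<phi> n s) ` stalk (J n) s" for n s
    using \<phi>[of n] by (simp add: next_rel_def J_def B_def)
  have B0: "B 0 s = act (\<epsilon> s) ` stalk F s" for s using X(2) by (simp add: B_def)
  have BJ: "B n s \<subseteq> stalk (J n) s" "socle P (J n) s \<subseteq> B n s" if "s \<in> P" for n s
    using X(1)[of n] that by (auto simp: good_def J_def B_def split: prod.splits)
  \<comment> \<open>Induction on the number of elements above \<open>s\<close>. Elements strictly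
    above \<open>s\<close> have fewer elements above them, so none of them is a label of the next
    term; that term vanishes strictly above \<open>s\<close>, its stalk at \<open>s\<close> is all
    socle, and the socle lies in \<open>B\<close>.\<close>
  have vanish: "B n s = stalk (J n) s" if "s \<in> P" "card {t \<in> P. s < t} \<le> n" for n s
    using that
  proof (induction n arbitrary: s)
    case 0
    then have "{t \<in> P. s < t} = {}" using P by simp
    then have "socle P (J 0) s = stalk (J 0) s" by (auto simp: socle_def)
    then show ?case using BJ[OF 0(1), of 0] by blast
  next
    case (Suc n)
    have "res (J (Suc n)) s t x = 0" if t: "t \<in> P" "s < t" for t x
    proof -
      have no: "\<not> t \<le> \<pi>" if "\<pi> \<in> set (fst (X (Suc n)))" for \<pi>
      proof
        assume "t \<le> \<pi>"
        have \<pi>: "\<pi> \<in> P" using X(1)[of "Suc n"] that by (auto simp: good_def split: prod.splits)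
        have "s < \<pi>" using t \<open>t \<le> \<pi>\<close> by order
        then have "{u \<in> P. \<pi> < u} \<subset> {u \<in> P. s < u}" using \<pi> by auto
        then have "card {u \<in> P. \<pi> < u} < card {u \<in> P. s < u}" using P by (intro psubset_card_mono) auto
        then have "B n \<pi> = stalk (J n) \<pi>" using Suc \<pi> by simp
        then show False using \<phi>[of n] that by (simp add: next_rel_def J_def B_def)
      qed
      have "stalk_dim (?D ps) t = 0" if "\<And>\<pi>. \<pi> \<in> set ps \<Longrightarrow> \<not> t \<le> \<pi>" for ps
        using that by (induction ps) auto
      then have "stalk_dim (J (Suc n)) t = 0" using no by (simp add: J_def)
      then have "res (J (Suc n)) s t x \<in> kn 0" using sheaf_onD(2)[OF J Suc.prems(1) t(1), of "Suc n" x] t by simp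
      then show ?thesis by (simp add: kn_def fun_eq_iff)
    qed
    then have "socle P (J (Suc n)) s = stalk (J (Suc n)) s" by (auto simp: socle_def)
    then show ?case using BJ[OF Suc.prems(1), of "Suc n"] by blast
  qed
  \<comment> \<open>No element has more than \<open>card P\<close> elements above it, so in degrees
    beyond \<open>card P\<close> no labels are left.\<close>
  have Jzero: "stalk_dim (J n) s = 0" if s: "s \<in> P" "card P < n" for n s
  proof -
    obtain k where k: "n = Suc k" "card P \<le> k" using s(2) by (cases n) auto
    have none: "set (fst (X n)) = {}"
    proof (rule ccontr)
      assume "set (fst (X n)) \<noteq> {}"
      then obtain \<pi> where \<pi>: "\<pi> \<in> set (fst (X n))" by (meson all_not_in_conv)
      then have \<pi>P: "\<pi> \<in> P" using X(1)[of n] by (auto simp: good_def split: prod.splits)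
      have "card {t \<in> P. \<pi> < t} \<le> k" using card_mono[OF P, of "{t \<in> P. \<pi> < t}"] k(2) by auto
      then have "B k \<pi> = stalk (J k) \<pi>" using vanish[OF \<pi>P] by blast
      then show False using \<phi>[of k] \<pi> k(1) by (simp add: next_rel_def J_def B_def)
    qed
    then show ?thesis by (simp add: J_def)
  qed
  \<comment> \<open>The map from degree -1 has no columns but as many rows as the stalk in degree 0;
    all other differentials in negative degrees have neither.\<close>
  define I where "I = \<lparr>obj = (\<lambda>n. if n < 0 then inj_sum [] else J (nat n)),
    diff = (\<lambda>n s. if n < 0 then 0\<^sub>m (if n = -1 then stalk_dim (J 0) s else 0) 0 else \<phi> (nat n) s)\<rparr>"
  have objI: "n \<ge> 0 \<Longrightarrow> obj I n = J (nat n)" "n < 0 \<Longrightarrow> obj I n = inj_sum []" for n by (auto simp: I_def)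
  have diffI: "n \<ge> 0 \<Longrightarrow> diff I n s = \<phi> (nat n) s" for n s by (simp add: I_def)
  have nat1: "nat (n + 1) = Suc (nat n)" if "n \<ge> 0" for n using that by (simp add: nat_add_distrib)
  have sI: "sheaf_on P (obj I n)" for n using sheaf_on_inj_sum[of P "[]"] by (cases "n < 0") (auto simp: objI J)
  have dneg: "act (diff I n s) x = 0" if "n < 0" for n s x using that by (simp add: I_def act_zero)
  have hI: "sheaf_hom P (obj I n) (obj I (n + 1)) (diff I n)" for n
  proof (cases "n < 0")
    case True
    have "diff I n s \<in> carrier_mat (stalk_dim (obj I (n + 1)) s) (stalk_dim (obj I n) s)" for s
      using True by (auto simp: I_def)
    then show ?thesis using dneg[OF True] lin_zero[OF lin_act] by (intro sheaf_homI[OF sI sI]) auto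
  next
    case False
    have "diff I n = \<phi> (nat n)" using False by (simp add: I_def)
    then show ?thesis using h[of "nat n"] False by (simp add: objI nat1)
  qed
  have im_ker: "act (diff I (n + 1) s) x = 0 \<longleftrightarrow> x \<in> act (diff I n s) ` stalk (obj I n) s"
    if "s \<in> P" "n \<ge> 0" "x \<in> stalk (obj I (n + 1)) s" for n s x
    using that ker[OF that(1), of x "Suc (nat n)"] by (simp add: objI diffI nat1 im)
  have cI: "complex_on P I"
    unfolding complex_on_def
  proof (intro conjI allI ballI)
    fix n s assume s: "s \<in> P"
    have c: "diff I (n + 1) s \<in> carrier_mat (stalk_dim (obj I (n + 2)) s) (stalk_dim (obj I (n + 1)) s)"
      using sheaf_homD(1)[OF hI s, of "n + 1"] by (simp add: add.assoc)
    note c' = sheaf_homD(1)[OF hI s, of n]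
    have "act (diff I (n + 1) s) (act (diff I n s) x) = 0" if "x \<in> stalk (obj I n) s" for x
    proof (cases "n < 0")
      case True
      then show ?thesis using dneg lin_zero[OF lin_act] by metis
    next
      case False
      then show ?thesis using im_ker[OF s, of n "act (diff I n s) x"] sheaf_homD(2)[OF hI s, of n x] that by simp
    qed
    then show "diff I (n + 1) s * diff I n s = 0\<^sub>m (stalk_dim (obj I (n + 2)) s) (stalk_dim (obj I n) s)"
      by (intro act_mat_eqI[OF mult_carrier_mat[OF c c']]) (auto simp: act_mult[OF c c'] act_zero)
  qed (rule sI hI)+
  have inj: "injective_sheaf P (obj I n)" for n
  proof (cases "n < 0")
    case True
    then show ?thesis using injective_sheaf_splitting[OF sheaf_on_inj_sum splitting_inj_sum[of "[]" P]]
      by (simp add: objI)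
  next
    case False
    have "set (fst (X (nat n))) \<subseteq> P" using X(1)[of "nat n"] by (auto simp: good_def split: prod.splits)
    then show ?thesis using False injective_sheaf_splitting[OF sheaf_on_inj_sum splitting_inj_sum]
      by (simp add: objI J_def)
  qed
  have "injective_resolution P F \<epsilon> I"
    unfolding injective_resolution_def
  proof (intro conjI allI impI ballI)
    show "complex_on P I" "injective_sheaf P (obj I n)" for n by (fact cI inj)+
    show "zero_sheaf_on P (obj I n)" if "n < 0" for n using that by (simp add: zero_sheaf_on_def objI)
    have J0: "obj I 0 = inj_sum ps0" using X(2) by (simp add: objI J_def)
    then show "sheaf_mono P F (obj I 0) \<epsilon>" using 0(2,3) by (simp add: sheaf_mono_iff)
    fix s assume s: "s \<in> P"
    show "mat_image (\<epsilon> s) = mat_kernel (diff I 0 s)"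
      by (rule mat_image_eq_kernelI[OF _ sheaf_homD(1)[OF hI s]])
        (use sheaf_homD(1)[OF 0(2) s] ker[OF s, of _ 0] in \<open>auto simp: J0[symmetric] objI diffI B0\<close>)
    show "mat_image (diff I n s) = mat_kernel (diff I (n + 1) s)" if "0 \<le> n" for n
      by (rule mat_image_eq_kernelI[OF sheaf_homD(1)[OF hI s] sheaf_homD(1)[OF hI s]])
        (use im_ker[OF s that] in auto)
  qed
  moreover have "bounded_complex P I"
    unfolding bounded_complex_def
    by (rule exI[of _ 0], rule exI[of _ "int (card P)"])
      (auto simp: zero_sheaf_on_def objI intro!: Jzero)
  moreover have "act (diff I n \<pi>) x = 0" if \<pi>: "\<pi> \<in> P" "x \<in> socle P (obj I n) \<pi>" for n \<pi> x
  proof (cases "n < 0")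
    case False
    then show ?thesis using \<pi> BJ[OF \<pi>(1), of "nat n"] ker[OF \<pi>(1), of x "nat n"] by (auto simp: objI diffI)
  qed (rule dneg)
  ultimately show ?thesis by (rule that)
qed

section \<open>Multiplicities as cohomology of cubical diagrams\<close>

text \<open>In the coordinates of a splitting a section over \<open>insert v s\<close> is a function
  on labels above \<open>insert v s\<close>. The same function, read on the larger set of labels
  above \<open>s\<close>, is the lift.\<close>

lemma flasque_cube:
  fixes P :: "'v set set" and J :: "('v set, 'k::field) sheaf_complex"
  assumes P: "finite P" "abstract_simplicial_complex P" and J: "complex_on P J"
    and inj: "\<And>n. injective_sheaf P (obj J n)"
  shows "flasque (cube_obj P J) (cube_res P J)"
  unfolding flasque_def
proof (intro allI impI ballI)
  fix s v W n y
  assume s: "s \<noteq> {}" and v: "v \<notin> s" and W: "W \<inter> insert v s = {}"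
    and y: "y \<in> vanishing W (cube_obj P J) (cube_res P J) (insert v s) n"
  note JS = complex_onD(1)[OF J]
  let ?I = "obj J n" and ?t = "insert v s"
  show "\<exists>x\<in>vanishing W (cube_obj P J) (cube_res P J) s n. cube_res P J s v n x = y"
  proof (cases "?t \<in> P")
    case False
    then have "y = 0" using y by (simp add: vanishing_def cube_obj_def)
    moreover have "0 \<in> cube_obj P J s n" by (simp add: cube_obj_def fd_zero[OF fd_kn])
    moreover have "cube_res P J s w n 0 = 0" for w by (simp add: cube_res_def lin_zero[OF lin_act])
    ultimately show ?thesis by (intro bexI[of _ 0]) (auto simp: vanishing_def)
  next
    case t: True
    then have sP: "s \<in> P" using s P(2) unfolding abstract_simplicial_complex_def by (meson subset_insertI)
    obtain ps E U where S: "splitting P ?I ps E U" using exists_splitting_of_injective[OF P(1) inj] .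
    note D = splittingD[OF S]
    have yt: "y \<in> stalk ?I ?t" using y t by (simp add: vanishing_def cube_obj_def)
    define f where "f = E ?t y"
    have ft: "f \<in> coord_space (labels ps ?t)" unfolding f_def by (rule D(4)[OF t yt])
    then have fs: "f \<in> coord_space (labels ps s)" by (auto simp: coord_space_def labels_def)
    have st: "s \<le> ?t" by auto
    define x where "x = U s f"
    have xs: "x \<in> stalk ?I s" unfolding x_def by (rule D(6)[OF sP fs])
    have "res ?I s ?t x = U ?t (truncate (labels ps ?t) f)"
      unfolding x_def by (rule splitting_res_U[OF JS S sP t st fs])
    also have "\<dots> = y" using truncate_id[OF ft] D(5)[OF t yt] by (simp add: f_def)
    finally have "cube_res P J s v n x = y" using sP t by (simp add: cube_res_def)
    moreover have "cube_res P J s w n x = 0" if w: "w \<in> W" for w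
    proof (cases "insert w s \<in> P")
      case wP: True
      \<comment> \<open>A label in the support lies above \<open>insert v s\<close>; if it also lies
        above \<open>insert w s\<close>, it lies above their union, which is then a simplex. But
        \<open>y\<close> restricts to zero there.\<close>
      have "truncate (labels ps (insert w s)) f = 0"
      proof (rule ext, rule ccontr)
        fix i assume "truncate (labels ps (insert w s)) f i \<noteq> 0 i"
        then have i: "f i \<noteq> 0" "i \<in> labels ps (insert w s)" by (auto simp: truncate_def split: if_splits)
        then have it: "i \<in> labels ps ?t" using ft by (auto simp: coord_space_def)
        let ?u = "insert w ?t"
        have iu: "?u \<subseteq> ps ! i" "i < length ps" using i(2) it by (auto simp: labels_def)
        then have uP: "?u \<in> P"
          using D(1) P(2) unfolding abstract_simplicial_complex_def by (metis insert_not_empty nth_mem subsetD)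
        have tu: "?t \<le> ?u" by auto
        have "cube_res P J ?t w n y = 0" using y w by (simp add: vanishing_def)
        then have "res ?I ?t ?u y = 0" using t uP by (simp add: cube_res_def)
        then have "truncate (labels ps ?u) f = 0"
          using D(8)[OF t uP tu yt] lin_zero[OF D(2)[OF uP]] by (simp add: f_def)
        then have "truncate (labels ps ?u) f i = 0" by simp
        then show False using i(1) iu by (simp add: truncate_def labels_def)
      qed
      then have "res ?I s (insert w s) x = 0"
        using splitting_res_U[OF JS S sP wP _ fs] lin_zero[OF D(3)[OF wP]] by (simp add: x_def subset_insertI)
      then show ?thesis by (simp add: cube_res_def)
    qed (simp add: cube_res_def)
    ultimately show ?thesis using xs sP
      by (intro bexI[of _ x]) (auto simp: vanishing_def cube_obj_def)
  qed
qed

text \<open>Restriction to any \<open>t\<close> strictly above \<open>\<pi>\<close> factors through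
  \<open>insert w \<pi>\<close> for a vertex \<open>w\<close> of \<open>t\<close> outside
  \<open>\<pi>\<close>, so one-vertex extensions suffice to test membership in the socle.\<close>

lemma vanishing_cube_eq_socle:
  assumes P: "abstract_simplicial_complex P" and J: "complex_on P J" and \<pi>: "\<pi> \<in> P"
  shows "vanishing (\<Union>P - \<pi>) (cube_obj P J) (cube_res P J) \<pi> n = socle P (obj J n) \<pi>"
proof (intro equalityI subsetI)
  note S = sheaf_onD[OF complex_onD(1)[OF J] \<pi>]
  fix x assume x: "x \<in> vanishing (\<Union>P - \<pi>) (cube_obj P J) (cube_res P J) \<pi> n"
  have "res (obj J n) \<pi> t x = 0" if t: "t \<in> P" "\<pi> < t" for t
  proof -
    obtain w where w: "w \<in> t" "w \<notin> \<pi>" using t by auto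
    then have wt: "insert w \<pi> \<subseteq> t" using t by auto
    then have wP: "insert w \<pi> \<in> P" using P t(1) unfolding abstract_simplicial_complex_def by (metis insert_not_empty)
    have "cube_res P J \<pi> w n x = 0" using x w t by (auto simp: vanishing_def)
    then have "res (obj J n) \<pi> (insert w \<pi>) x = 0" using \<pi> wP by (simp add: cube_res_def)
    then show ?thesis using S(4)[OF wP subset_insertI t(1) wt, of n x] lin_zero[OF lin_act] by metis
  qed
  then show "x \<in> socle P (obj J n) \<pi>"
    using x \<pi> by (simp add: socle_def vanishing_def cube_obj_def)
next
  fix x assume x: "x \<in> socle P (obj J n) \<pi>"
  have "cube_res P J \<pi> w n x = 0" if "w \<in> \<Union>P - \<pi>" for w
    using x that by (auto simp: cube_res_def socle_def)
  then show "x \<in> vanishing (\<Union>P - \<pi>) (cube_obj P J) (cube_res P J) \<pi> n"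
    using x \<pi> by (simp add: socle_def vanishing_def cube_obj_def)
qed

text \<open>The socles at \<open>\<pi>\<close> form a complex whose cohomology is that of the cube
  and whose terms have the multiplicities as dimensions. Cohomology is no larger than the terms,
  with equality if the differentials are zero.\<close>

lemma multiplicity_in_cube:
  fixes P :: "'v set set" and J :: "('v set, 'k::field) sheaf_complex"
  assumes P: "finite P" "abstract_simplicial_complex P" and J: "complex_on P J"
    and inj: "\<And>n. injective_sheaf P (obj J n)"
    and \<pi>: "\<pi> \<in> P" and vs: "distinct vs" "set vs = \<Union>P - \<pi>"
  shows "cube_hdim P J vs \<pi> n \<le> multiplicity_in P (obj J n) \<pi>"
    "(\<And>n x. x \<in> socle P (obj J n) \<pi> \<Longrightarrow> act (diff J n \<pi>) x = 0) \<Longrightarrow>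
      cube_hdim P J vs \<pi> n = multiplicity_in P (obj J n) \<pi>"
proof -
  note JS = complex_onD(1)[OF J]
  obtain ps E U where S: "splitting P (obj J n) ps E U" using exists_splitting_of_injective[OF P(1) inj] .
  have m: "multiplicity_in P (obj J n) \<pi> = V.dim (socle P (obj J n) \<pi>)"
    by (rule multiplicity_in_eq_dim_socle[OF JS S \<pi>])
  note D = diagram_cube[OF P(2) J]
  have disj: "set vs \<inter> \<pi> = {}" using vs(2) by blast
  have ne: "\<pi> \<noteq> {}" using P(2) \<pi> by (auto simp: abstract_simplicial_complex_def)
  let ?G = "vanishing (\<Union>P - \<pi>) (cube_obj P J) (cube_res P J) \<pi>"
  have G: "?G = (\<lambda>n. socle P (obj J n) \<pi>)"
    using vanishing_cube_eq_socle[OF P(2) J \<pi>] by blast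
  have h: "cube_hdim P J vs \<pi> n = hdim ?G (cube_diff P J \<pi>) n"
    using hdim_vanishing[OF D flasque_cube[OF P J inj] vs(1) disj ne] vs(2)
    by (simp add: cube_hdim_def)
  have c: "cpx ?G (cube_diff P J \<pi>)" by (rule cpx_vanishing[OF D])
  show "cube_hdim P J vs \<pi> n \<le> multiplicity_in P (obj J n) \<pi>"
    using hdim_le[OF c, of n] unfolding h m G .
  assume z: "\<And>n x. x \<in> socle P (obj J n) \<pi> \<Longrightarrow> act (diff J n \<pi>) x = 0"
  have "hdim ?G (cube_diff P J \<pi>) n = V.dim (?G n)"
    by (rule hdim_eq_dim[OF c]) (use z \<pi> in \<open>simp add: G cube_diff_def\<close>)
  then show "cube_hdim P J vs \<pi> n = multiplicity_in P (obj J n) \<pi>" unfolding h m G .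
qed

section \<open>Resolutions as quasi-isomorphisms from a sheaf in degree zero\<close>

definition concentrated :: "('p::order, 'k::field) sheaf \<Rightarrow> ('p, 'k) sheaf_complex" where
  "concentrated F = \<lparr>obj = (\<lambda>n. if n = 0 then F else inj_sum []),
     diff = (\<lambda>n s. 0\<^sub>m (if n = -1 then stalk_dim F s else 0) (if n = 0 then stalk_dim F s else 0))\<rparr>"

lemma complex_on_concentrated:
  assumes F: "sheaf_on P F"
  shows "complex_on P (concentrated F)"
proof -
  have o: "sheaf_on P (obj (concentrated F) n)" for n
    using F sheaf_on_inj_sum[of P "[]"] by (auto simp: concentrated_def)
  have d: "diff (concentrated F) n s \<in> carrier_mat (stalk_dim (obj (concentrated F) (n + 1)) s)
      (stalk_dim (obj (concentrated F) n) s)" for n s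
    by (auto simp: concentrated_def)
  have z: "act (diff (concentrated F) n s) x = 0" for n s x
    by (simp add: concentrated_def act_zero)
  show ?thesis
    unfolding complex_on_def
  proof (intro conjI allI ballI)
    show "sheaf_hom P (obj (concentrated F) n) (obj (concentrated F) (n + 1)) (diff (concentrated F) n)" for n
      using d z lin_zero[OF lin_act] by (intro sheaf_homI[OF o o]) auto
    fix n s
    have d2: "diff (concentrated F) (n + 1) s \<in> carrier_mat (stalk_dim (obj (concentrated F) (n + 2)) s)
      (stalk_dim (obj (concentrated F) (n + 1)) s)"
      using d[of "n + 1" s] by (simp add: add.assoc)
    show "diff (concentrated F) (n + 1) s * diff (concentrated F) n s =
        0\<^sub>m (stalk_dim (obj (concentrated F) (n + 2)) s) (stalk_dim (obj (concentrated F) n) s)"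
      by (rule act_mat_eqI[OF mult_carrier_mat[OF d2 d]]) (auto simp: act_mult[OF d2 d] z act_zero)
  qed (rule o)
qed

lemma injective_resolution_quasi_isomorphism:
  fixes F :: "('p::order, 'k::field) sheaf"
  assumes F: "sheaf_on P F" and R: "injective_resolution P F \<epsilon> I"
  shows "\<exists>f. quasi_isomorphism P (concentrated F) I f"
proof -
  let ?K = "concentrated F"
  define f where "f = (\<lambda>n s. if n = 0 then \<epsilon> s else 0\<^sub>m (stalk_dim (obj I n) s) 0)"
  note cK = complex_on_concentrated[OF F]
  have cI: "complex_on P I" and mono: "sheaf_mono P F (obj I 0) \<epsilon>"
    and neg: "\<And>n s. n < 0 \<Longrightarrow> s \<in> P \<Longrightarrow> stalk_dim (obj I n) s = 0"
    and ex0: "\<And>s. s \<in> P \<Longrightarrow> mat_image (\<epsilon> s) = mat_kernel (diff I 0 s)"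
    and ex: "\<And>n s. n \<ge> 0 \<Longrightarrow> s \<in> P \<Longrightarrow> mat_image (diff I n s) = mat_kernel (diff I (n + 1) s)"
    using R by (auto simp: injective_resolution_def zero_sheaf_on_def)
  have \<epsilon>: "sheaf_hom P F (obj I 0) \<epsilon>" using mono by (simp add: sheaf_mono_def)
  note IS = complex_onD(1)[OF cI] and IH = sheaf_homD[OF complex_onD(2)[OF cI]]
  note KS = complex_onD(1)[OF cK] and KH = sheaf_homD[OF complex_onD(2)[OF cK]]
  have oK: "obj ?K 0 = F" "\<And>n s. n \<noteq> 0 \<Longrightarrow> stalk_dim (obj ?K n) s = 0"
    by (auto simp: concentrated_def)
  have dK: "act (diff ?K n s) x = 0" for n s x by (simp add: concentrated_def act_zero)
  have f: "f n s \<in> carrier_mat (stalk_dim (obj I n) s) (stalk_dim (obj ?K n) s)" if "s \<in> P" for n s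
    using sheaf_homD(1)[OF \<epsilon> that] by (auto simp: f_def oK)
  have f0: "n \<noteq> 0 \<Longrightarrow> act (f n s) x = 0" for n s x by (simp add: f_def act_zero)
  have d\<epsilon>: "act (diff I 0 s) (act (\<epsilon> s) x) = 0" if s: "s \<in> P" and x: "x \<in> stalk F s" for s x
  proof -
    obtain v where v: "v \<in> carrier_vec (stalk_dim F s)" "x = seq_of_vec v" using kn_seq_of_vecE[OF x] .
    note c = sheaf_homD(1)[OF \<epsilon> s]
    have "\<epsilon> s *\<^sub>v v \<in> mat_kernel (diff I 0 s)" using ex0[OF s] v(1) c by (auto simp: mat_image_def)
    then show ?thesis
      using mat_kernel_iff[OF IH(1)[OF s, of 0] mult_mat_vec_carrier[OF c v(1)]] act_seq_of_vec[OF c v(1)] v(2) by simp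
  qed
  have zero_in: "0\<^sub>v n \<in> mat_image A" if A: "A \<in> carrier_mat n m" for n m and A :: "'k mat"
    using mat_image_iff[OF A, of "0\<^sub>v n"] lin_zero[OF lin_act[of A]] fd_zero[OF fd_kn] by (metis imageI seq_of_vec_zero zero_carrier_vec)
  have "chain_map P ?K I f"
    unfolding chain_map_def
  proof (intro conjI allI ballI)
    fix n
    show "sheaf_hom P (obj ?K n) (obj I n) (f n)"
    proof (cases "n = 0")
      case True
      moreover have "f 0 = \<epsilon>" by (simp add: f_def)
      ultimately show ?thesis using \<epsilon> by (simp only: oK)
    next
      case False
      then show ?thesis using f f0 lin_zero[OF lin_act] by (intro sheaf_homI[OF KS IS]) auto
    qed
    fix s assume s: "s \<in> P"
    note c1 = mult_carrier_mat[OF f[OF s, of "n + 1"] KH(1)[OF s, of n]]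
    note c2 = mult_carrier_mat[OF IH(1)[OF s, of n] f[OF s, of n]]
    show "f (n + 1) s * diff ?K n s = diff I n s * f n s"
    proof (rule act_mat_eqI[OF c1 c2])
      fix x assume x: "x \<in> stalk (obj ?K n) s"
      have "act (diff I n s) (act (f n s) x) = 0"
        using d\<epsilon>[OF s] x f0 lin_zero[OF lin_act] by (cases "n = 0") (auto simp: f_def oK)
      then show "act (f (n + 1) s * diff ?K n s) x = act (diff I n s * f n s) x"
        by (simp add: act_mult[OF f[OF s] KH(1)[OF s]] act_mult[OF IH(1)[OF s] f[OF s]] dK lin_zero[OF lin_act])
    qed
  qed
  moreover have "v \<in> mat_image (diff ?K (n - 1) s)"
    if s: "s \<in> P" and v: "v \<in> mat_kernel (diff ?K n s)" "f n s *\<^sub>v v \<in> mat_image (diff I (n - 1) s)" for n s v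
  proof -
    have vc: "v \<in> carrier_vec (stalk_dim (obj ?K n) s)" using v(1) KH(1)[OF s, of n] by (auto simp: mat_kernel_def)
    have cK': "diff ?K (n - 1) s \<in> carrier_mat (stalk_dim (obj ?K n) s) (stalk_dim (obj ?K (n - 1)) s)"
      and cI': "diff I (n - 1) s \<in> carrier_mat (stalk_dim (obj I n) s) (stalk_dim (obj I (n - 1)) s)"
      using KH(1)[OF s, of "n - 1"] IH(1)[OF s, of "n - 1"] by auto
    \<comment> \<open>The source has zero differentials, so injectivity on cohomology amounts to
      \<open>v = 0\<close>. In degree 0 the target has no coboundaries, its stalks in degree -1
      being zero, and \<open>\<epsilon>\<close> is injective.\<close>
    have "v = 0\<^sub>v (stalk_dim (obj ?K n) s)"
    proof (cases "n = 0")
      case True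
      have "act (f n s) (seq_of_vec v) \<in> act (diff I (n - 1) s) ` stalk (obj I (n - 1)) s"
        using v(2) mat_image_iff[OF cI' mult_mat_vec_carrier[OF f[OF s] vc]] act_seq_of_vec[OF f[OF s] vc] by simp
      moreover have "stalk (obj I (n - 1)) s = {0}" using neg[OF _ s, of "n - 1"] True by (auto simp: kn_def)
      ultimately have "act (\<epsilon> s) (seq_of_vec v) = 0" using True lin_zero[OF lin_act] by (auto simp: f_def)
      then have "seq_of_vec v = 0" using mono s seq_of_vec_kn[OF vc] True by (simp add: sheaf_mono_iff oK)
      then show ?thesis using seq_of_vec_inject[OF vc zero_carrier_vec] by simp
    next
      case False
      then show ?thesis using vc by (auto simp: oK)
    qed
    then show ?thesis using zero_in[OF cK'] by simp
  qed
  moreover have "\<exists>v\<in>mat_kernel (diff ?K n s). w - f n s *\<^sub>v v \<in> mat_image (diff I (n - 1) s)"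
    if s: "s \<in> P" and w: "w \<in> mat_kernel (diff I n s)" for n s w
  proof -
    have wc: "w \<in> carrier_vec (stalk_dim (obj I n) s)" using w IH(1)[OF s, of n] by (auto simp: mat_kernel_def)
    have cI': "diff I (n - 1) s \<in> carrier_mat (stalk_dim (obj I n) s) (stalk_dim (obj I (n - 1)) s)"
      using IH(1)[OF s, of "n - 1"] by auto
    have ker: "v \<in> mat_kernel (diff ?K n s)" if "v \<in> carrier_vec (stalk_dim (obj ?K n) s)" for v
      using mat_kernel_iff[OF KH(1)[OF s] that] dK by simp
    show ?thesis
    proof (cases "n = 0")
      case True
      then have "w \<in> mat_image (\<epsilon> s)" using ex0[OF s] w by simp
      then obtain v where v: "v \<in> carrier_vec (stalk_dim F s)" "w = \<epsilon> s *\<^sub>v v"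
        using sheaf_homD(1)[OF \<epsilon> s] by (auto simp: mat_image_def)
      have "w - f n s *\<^sub>v v = 0\<^sub>v (stalk_dim (obj I n) s)" using True v wc by (simp add: f_def)
      then show ?thesis using zero_in[OF cI'] ker[of v] v(1) True by (intro bexI[of _ v]) (auto simp: oK)
    next
      case False
      let ?v = "0\<^sub>v 0 :: 'k vec"
      have vK: "?v \<in> carrier_vec (stalk_dim (obj ?K n) s)" using False by (simp add: oK)
      have "act (f n s) (seq_of_vec ?v) = 0" using f0[OF False] .
      then have "seq_of_vec (w - f n s *\<^sub>v ?v) = seq_of_vec w"
        using act_seq_of_vec[OF f[OF s] vK] seq_of_vec_diff[OF wc mult_mat_vec_carrier[OF f[OF s] vK]] by simp
      then have eq: "w - f n s *\<^sub>v ?v = w"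
        using seq_of_vec_inject[OF minus_carrier_vec[OF wc mult_mat_vec_carrier[OF f[OF s] vK]] wc] by simp
      have "w \<in> mat_image (diff I (n - 1) s)"
      proof (cases "n < 0")
        case True
        then have "w = 0\<^sub>v (stalk_dim (obj I n) s)" using wc neg[OF True s] by auto
        then show ?thesis using zero_in[OF cI'] by simp
      next
        case nn: False
        then show ?thesis using ex[of "n - 1" s] s w False by simp
      qed
      then show ?thesis using eq ker[OF vK] by (intro bexI[of _ ?v]) auto
    qed
  qed
  ultimately show ?thesis unfolding quasi_isomorphism_def by blast
qed

lemma injective_resolution_quasi_isomorphic:
  assumes F: "sheaf_on P F" and R: "injective_resolution P F \<epsilon> I"
  shows "quasi_isomorphic P (concentrated F) I"
  unfolding quasi_isomorphic_def
  using injective_resolution_quasi_isomorphism[OF F R] complex_on_concentrated[OF F] R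
  by (intro r_into_equivclp) (simp add: injective_resolution_def)

lemma quasi_isomorphic_sym: "quasi_isomorphic P C D \<Longrightarrow> quasi_isomorphic P D C"
  and quasi_isomorphic_trans: "quasi_isomorphic P C D \<Longrightarrow> quasi_isomorphic P D E \<Longrightarrow> quasi_isomorphic P C E"
  unfolding quasi_isomorphic_def by (blast intro: equivclp_sym equivclp_trans)+

text \<open>The right-hand side depends on the quasi-isomorphism class only and bounds
  multiplicities from below. The resolution that kills socles attains the bound at every element at
  once, so it is minimal, and any other minimal resolution must attain it as well.\<close>

theorem min_mult_eq_cube_hdim:
  fixes P :: "'v set set" and F :: "('v set, 'k::field) sheaf"
  assumes P: "finite P" "abstract_simplicial_complex P" and F: "sheaf_on P F"
    and \<pi>: "\<pi> \<in> P" and vs: "distinct vs" "set vs = \<Union>P - \<pi>"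
  shows "min_mult P F j \<pi> = cube_hdim P (concentrated F) vs \<pi> (int j)"
proof -
  have finU: "finite (\<Union>P)" using P by (auto simp: abstract_simplicial_complex_def)
  then have "\<exists>vs. distinct vs \<and> set vs = \<Union>P - \<rho>" for \<rho>
    using finite_distinct_list[of "\<Union>P - \<rho>"] by auto
  then obtain ws where ws: "\<And>\<rho>. distinct (ws \<rho>) \<and> set (ws \<rho>) = \<Union>P - \<rho>" by metis
  \<comment> \<open>Minimality involves all elements of \<open>P\<close>, so an enumeration of
    outside vertices is fixed for each of them, agreeing with the given \<open>vs\<close> at
    \<open>\<pi>\<close>.\<close>
  define us where "us = ws(\<pi> := vs)"
  have us: "distinct (us \<rho>)" "set (us \<rho>) = \<Union>P - \<rho>" for \<rho> using ws vs by (auto simp: us_def)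
  define h where "h = (\<lambda>\<rho> n. cube_hdim P (concentrated F) (us \<rho>) \<rho> n)"
  have le: "h \<rho> n \<le> multiplicity_in P (obj J n) \<rho>"
    if "quasi_isomorphic P (concentrated F) J" "complex_on P J" "\<And>i. injective_sheaf P (obj J i)" "\<rho> \<in> P" for J \<rho> n
    using multiplicity_in_cube(1)[OF P that(2,3,4) us] cube_hdim_quasi_isomorphic[OF P(2) that(1)]
    by (simp add: h_def)
  obtain \<epsilon> I where R: "injective_resolution P F \<epsilon> I" and b: "bounded_complex P I"
    and soc: "\<And>n \<pi> x. \<pi> \<in> P \<Longrightarrow> x \<in> socle P (obj I n) \<pi> \<Longrightarrow> act (diff I n \<pi>) x = 0"
    using exists_resolution_socle_zero[OF P(1) F] by blast
  have RD: "complex_on P I" "\<And>i. injective_sheaf P (obj I i)" using R by (auto simp: injective_resolution_def)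
  have q: "quasi_isomorphic P (concentrated F) I" by (rule injective_resolution_quasi_isomorphic[OF F R])
  have eq: "multiplicity_in P (obj I n) \<rho> = h \<rho> n" if "\<rho> \<in> P" for \<rho> n
    using multiplicity_in_cube(2)[OF P RD that us soc[OF that]] cube_hdim_quasi_isomorphic[OF P(2) q]
    by (simp add: h_def)
  have "minimal_injective_resolution P F \<epsilon> I"
    unfolding minimal_injective_resolution_def
  proof (intro conjI allI impI)
    fix n J assume J: "complex_on P J" "bounded_complex P J" "\<forall>i. injective_sheaf P (obj J i)" "quasi_isomorphic P J I"
    then have "quasi_isomorphic P (concentrated F) J" using q quasi_isomorphic_sym quasi_isomorphic_trans by blast
    then show "num_summands P (obj I n) \<le> num_summands P (obj J n)"
      unfolding num_summands_def using le J eq by (intro sum_mono) simp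
  qed (fact R)
  moreover have "multiplicity_in P (obj J (int j)) \<pi> = h \<pi> (int j)"
    if m: "minimal_injective_resolution P F \<delta> J" for \<delta> J
  proof -
    have RJ: "injective_resolution P F \<delta> J" using m by (simp add: minimal_injective_resolution_def)
    have qJ: "quasi_isomorphic P (concentrated F) J" by (rule injective_resolution_quasi_isomorphic[OF F RJ])
    have JD: "complex_on P J" "\<And>i. injective_sheaf P (obj J i)" using RJ by (auto simp: injective_resolution_def)
    have "quasi_isomorphic P I J" using q qJ quasi_isomorphic_sym quasi_isomorphic_trans by blast
    \<comment> \<open>\<open>I\<close> is bounded, hence an admissible competitor for the minimality
      of \<open>J\<close>.\<close>
    then have "num_summands P (obj J (int j)) \<le> num_summands P (obj I (int j))"
      using m RD b by (simp add: minimal_injective_resolution_def)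
    then have s: "(\<Sum>\<rho>\<in>P. multiplicity_in P (obj J (int j)) \<rho>) \<le> (\<Sum>\<rho>\<in>P. h \<rho> (int j))"
      by (simp add: num_summands_def eq)
    show ?thesis
    proof (rule ccontr)
      \<comment> \<open>Each multiplicity of \<open>J\<close> is at least \<open>h\<close>, so one
        strict inequality would push the sum above that of \<open>I\<close>.\<close>
      assume "multiplicity_in P (obj J (int j)) \<pi> \<noteq> h \<pi> (int j)"
      then have "h \<pi> (int j) < multiplicity_in P (obj J (int j)) \<pi>" using le[OF qJ JD \<pi>, of "int j"] by simp
      then have "(\<Sum>\<rho>\<in>P. h \<rho> (int j)) < (\<Sum>\<rho>\<in>P. multiplicity_in P (obj J (int j)) \<rho>)"
        using P(1) \<pi> le[OF qJ JD] by (intro sum_strict_mono_ex1) auto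
      then show False using s by simp
    qed
  qed
  ultimately have "min_mult P F j \<pi> = h \<pi> (int j)"
    unfolding min_mult_def by (intro the_equality) metis+
  then show ?thesis by (simp add: h_def us_def)
qed

section \<open>The constant sheaf\<close>

lemma sheaf_on_constant: "sheaf_on P constant_sheaf"
  by (auto simp: sheaf_on_def constant_sheaf_def)

lemma card_supersets_satisfying:
  assumes U: "finite U" and \<pi>: "\<pi> \<subseteq> U"
  shows "card {S. S \<subseteq> U - \<pi> \<and> int (card S) = n \<and> R (\<pi> \<union> S)} =
    card {\<tau>. \<tau> \<subseteq> U \<and> \<pi> \<subseteq> \<tau> \<and> int (card \<tau>) = int (card \<pi>) + n \<and> R \<tau>}"
proof (rule bij_betw_same_card[of "\<lambda>S. \<pi> \<union> S"], rule bij_betwI[where g = "\<lambda>\<tau>. \<tau> - \<pi>"])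
  have card: "card (\<pi> \<union> S) = card \<pi> + card S" if "S \<subseteq> U - \<pi>" for S
    using that U \<pi> by (intro card_Un_disjoint) (auto intro: finite_subset)
  show "(\<lambda>S. \<pi> \<union> S) \<in> {S. S \<subseteq> U - \<pi> \<and> int (card S) = n \<and> R (\<pi> \<union> S)} \<rightarrow>
      {\<tau>. \<tau> \<subseteq> U \<and> \<pi> \<subseteq> \<tau> \<and> int (card \<tau>) = int (card \<pi>) + n \<and> R \<tau>}"
    using card \<pi> by auto
  show "(\<lambda>\<tau>. \<tau> - \<pi>) \<in> {\<tau>. \<tau> \<subseteq> U \<and> \<pi> \<subseteq> \<tau> \<and> int (card \<tau>) = int (card \<pi>) + n \<and> R \<tau>} \<rightarrow>
      {S. S \<subseteq> U - \<pi> \<and> int (card S) = n \<and> R (\<pi> \<union> S)}"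
  proof
    fix \<tau> assume t: "\<tau> \<in> {\<tau>. \<tau> \<subseteq> U \<and> \<pi> \<subseteq> \<tau> \<and> int (card \<tau>) = int (card \<pi>) + n \<and> R \<tau>}"
    then have sub: "\<tau> - \<pi> \<subseteq> U - \<pi>" and eq: "\<pi> \<union> (\<tau> - \<pi>) = \<tau>" by auto
    from card[OF sub] show "\<tau> - \<pi> \<in> {S. S \<subseteq> U - \<pi> \<and> int (card S) = n \<and> R (\<pi> \<union> S)}"
      using t sub unfolding eq by (auto simp: Un_absorb1)
  qed
qed auto

text \<open>The complex is \<open>k\<close> in degree 0 at each simplex, so the corner of the cube
  at \<open>\<pi> \<union> S\<close> contributes to degree \<open>card S\<close> alone. Degrees are
  integers so that \<open>a (int j - 1)\<close> makes sense, with value 0, at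
  \<open>j = 0\<close>.\<close>

lemma min_mult_constant_bounds:
  fixes P :: "'v set set"
  assumes P: "finite P" "abstract_simplicial_complex P" and \<pi>: "\<pi> \<in> P"
  defines "a \<equiv> \<lambda>n. card {\<tau> \<in> P. \<pi> \<subseteq> \<tau> \<and> int (card \<tau>) = int (card \<pi>) + n}"
  shows "min_mult P (constant_sheaf :: ('v set, 'k::field) sheaf) j \<pi> \<le> a (int j)"
    "a (int j) \<le> min_mult P (constant_sheaf :: ('v set, 'k) sheaf) j \<pi> + a (int j - 1) + a (int j + 1)"
proof -
  let ?F = "constant_sheaf :: ('v set, 'k) sheaf"
  let ?C = "concentrated ?F"
  have finU: "finite (\<Union>P)" using P by (auto simp: abstract_simplicial_complex_def)
  then obtain vs where vs: "distinct vs" "set vs = \<Union>P - \<pi>"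
    using finite_distinct_list[of "\<Union>P - \<pi>"] by auto
  have D: "diagram (cube_obj P ?C) (cube_diff P ?C) (cube_res P ?C)"
    by (rule diagram_cube[OF P(2) complex_on_concentrated[OF sheaf_on_constant]])
  have dim: "V.dim (cube_obj P ?C s n) = (if s \<in> P \<and> n = 0 then 1 else 0)" for s n
  proof -
    have "cube_obj P ?C s n = kn (if s \<in> P \<and> n = 0 then 1 else 0)"
      by (auto simp: cube_obj_def concentrated_def constant_sheaf_def kn_def)
    then show ?thesis by (simp add: dim_kn)
  qed
  have dim_tot: "V.dim (tot_obj vs (cube_obj P ?C) \<pi> n) = a n" for n
  proof -
    have "V.dim (tot_obj vs (cube_obj P ?C) \<pi> n) = card {S. S \<subseteq> set vs \<and> int (card S) = n \<and> \<pi> \<union> S \<in> P}"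
      by (rule dim_tot_obj[OF D dim vs(1)]) (use vs in auto)
    also have "\<dots> = card {\<tau>. \<tau> \<subseteq> \<Union>P \<and> \<pi> \<subseteq> \<tau> \<and> int (card \<tau>) = int (card \<pi>) + n \<and> \<tau> \<in> P}"
      unfolding vs(2) by (rule card_supersets_satisfying[OF finU]) (use \<pi> in auto)
    also have "\<dots> = a n" unfolding a_def by (rule arg_cong[of _ _ card]) auto
    finally show ?thesis .
  qed
  have c: "cpx (tot_obj vs (cube_obj P ?C) \<pi>) (tot_diff vs (cube_diff P ?C) (cube_res P ?C) \<pi>)"
    by (rule diagramD(1)[OF diagram_tot[OF D]])
  have m: "min_mult P ?F j \<pi> = hdim (tot_obj vs (cube_obj P ?C) \<pi>) (tot_diff vs (cube_diff P ?C) (cube_res P ?C) \<pi>) (int j)"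
    using min_mult_eq_cube_hdim[OF P sheaf_on_constant \<pi> vs, of j] by (simp add: cube_hdim_def)
  show "min_mult P ?F j \<pi> \<le> a (int j)" using hdim_le[OF c, of "int j"] by (simp add: m dim_tot)
  show "a (int j) \<le> min_mult P ?F j \<pi> + a (int j - 1) + a (int j + 1)"
    using dim_le_hdim[OF c, of "int j"] by (simp add: m dim_tot)
qed

section \<open>Counting simplices\<close>

lemma card_supersets:
  assumes X: "finite X" and \<pi>: "\<pi> \<subseteq> X"
  shows "card {\<tau>. \<tau> \<subseteq> X \<and> \<pi> \<subseteq> \<tau> \<and> card \<tau> = card \<pi> + k} = (card X - card \<pi>) choose k"
proof -
  have fin: "finite \<pi>" using X \<pi> by (rule rev_finite_subset)
  have "card {\<tau>. \<tau> \<subseteq> X \<and> \<pi> \<subseteq> \<tau> \<and> card \<tau> = card \<pi> + k} = card {S. S \<subseteq> X - \<pi> \<and> card S = k}"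
    using card_supersets_satisfying[OF X \<pi>, of "int k" "\<lambda>_. True"] by (simp flip: of_nat_add)
  also have "\<dots> = card (X - \<pi>) choose k" using X by (intro n_subsets) auto
  also have "card (X - \<pi>) = card X - card \<pi>" by (rule card_Diff_subset[OF fin \<pi>])
  finally show ?thesis .
qed

lemma binomial_mono_upper: "m \<le> n \<Longrightarrow> m choose k \<le> n choose k"
  by (induction rule: dec_induct) (cases k; simp)+

text \<open>Complements in \<open>\<tau>\<close> embed these faces into the \<open>j\<close>-element
  subsets of \<open>\<tau> - \<sigma>\<close>.\<close>

lemma card_subsets_codim_le:
  assumes t: "finite \<tau>" and s: "\<sigma> \<subseteq> \<tau>"
  shows "card {\<pi>. \<sigma> \<subseteq> \<pi> \<and> \<pi> \<subseteq> \<tau> \<and> card \<tau> = card \<pi> + j} \<le> (card \<tau> - card \<sigma>) choose j"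
proof -
  have "card {\<pi>. \<sigma> \<subseteq> \<pi> \<and> \<pi> \<subseteq> \<tau> \<and> card \<tau> = card \<pi> + j} \<le> card {S. S \<subseteq> \<tau> - \<sigma> \<and> card S = j}"
  proof (rule card_inj_on_le[of "\<lambda>\<pi>. \<tau> - \<pi>"])
    show "inj_on (\<lambda>\<pi>. \<tau> - \<pi>) {\<pi>. \<sigma> \<subseteq> \<pi> \<and> \<pi> \<subseteq> \<tau> \<and> card \<tau> = card \<pi> + j}"
      by (rule inj_onI) blast
    show "(\<lambda>\<pi>. \<tau> - \<pi>) ` {\<pi>. \<sigma> \<subseteq> \<pi> \<and> \<pi> \<subseteq> \<tau> \<and> card \<tau> = card \<pi> + j} \<subseteq> {S. S \<subseteq> \<tau> - \<sigma> \<and> card S = j}"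
      using t by (auto simp: card_Diff_subset finite_subset)
    show "finite {S. S \<subseteq> \<tau> - \<sigma> \<and> card S = j}" using t by simp
  qed
  also have "\<dots> = card (\<tau> - \<sigma>) choose j" using t by (intro n_subsets) auto
  also have "card (\<tau> - \<sigma>) = card \<tau> - card \<sigma>"
    using t s by (intro card_Diff_subset) (auto intro: finite_subset)
  finally show ?thesis .
qed

text \<open>The bound \<open>d\<close> is stated through cardinalities so that it covers both the
  dimension of the star and the skeleton degree.\<close>

lemma star_complexity_le:
  fixes P :: "'v set set"
  assumes P: "finite P" "abstract_simplicial_complex P" and \<sigma>: "\<sigma> \<in> P"
    and d: "\<And>\<tau>. \<tau> \<in> star P \<sigma> \<Longrightarrow> card \<tau> \<le> card \<sigma> + d"
  shows "star_complexity TYPE('k::field) P j \<sigma> \<le> real (d choose j)"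
proof -
  let ?S = "star P \<sigma>" and ?F = "constant_sheaf :: ('v set, 'k) sheaf"
  have finS: "finite ?S" using P(1) by (simp add: star_def)
  have SP: "\<tau> \<in> P" "\<sigma> \<subseteq> \<tau>" "finite \<tau>" if "\<tau> \<in> ?S" for \<tau>
    using that P(2) by (auto simp: star_def abstract_simplicial_complex_def)
  define c where "c = (\<lambda>\<pi> \<tau> :: 'v set. \<pi> \<subseteq> \<tau> \<and> card \<tau> = card \<pi> + j)"
  have "(\<Sum>\<pi>\<in>?S. min_mult P ?F j \<pi>) \<le> (\<Sum>\<pi>\<in>?S. card {\<tau> \<in> ?S. c \<pi> \<tau>})"
  proof (rule sum_mono)
    fix \<pi> assume \<pi>: "\<pi> \<in> ?S"
    have "min_mult P ?F j \<pi> \<le> card {\<tau> \<in> P. \<pi> \<subseteq> \<tau> \<and> int (card \<tau>) = int (card \<pi>) + int j}"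
      by (rule min_mult_constant_bounds(1)[OF P SP(1)[OF \<pi>]])
    also have "{\<tau> \<in> P. \<pi> \<subseteq> \<tau> \<and> int (card \<tau>) = int (card \<pi>) + int j} = {\<tau> \<in> ?S. c \<pi> \<tau>}"
      using SP(2)[OF \<pi>] by (auto simp: star_def c_def)
    finally show "min_mult P ?F j \<pi> \<le> card {\<tau> \<in> ?S. c \<pi> \<tau>}" .
  qed
  \<comment> \<open>Double counting: grouped by \<open>\<tau>\<close>, each group is bounded by a
    binomial coefficient that depends on \<open>\<tau>\<close> only through its cardinality.\<close>
  also have "\<dots> = (\<Sum>\<tau>\<in>?S. card {\<pi> \<in> ?S. c \<pi> \<tau>})"
    unfolding card_eq_sum using finS by (rule sum.swap_restrict[OF _ finS])
  also have "\<dots> \<le> (\<Sum>\<tau>\<in>?S. d choose j)"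
  proof (rule sum_mono)
    fix \<tau> assume \<tau>: "\<tau> \<in> ?S"
    have "card {\<pi> \<in> ?S. c \<pi> \<tau>} \<le> card {\<pi>. \<sigma> \<subseteq> \<pi> \<and> \<pi> \<subseteq> \<tau> \<and> card \<tau> = card \<pi> + j}"
      using SP(3)[OF \<tau>] by (intro card_mono) (auto simp: star_def c_def intro: finite_subset[of _ "Pow \<tau>"])
    also have "\<dots> \<le> (card \<tau> - card \<sigma>) choose j" by (rule card_subsets_codim_le[OF SP(3)[OF \<tau>] SP(2)[OF \<tau>]])
    also have "\<dots> \<le> d choose j" using d[OF \<tau>] by (intro binomial_mono_upper) simp
    finally show "card {\<pi> \<in> ?S. c \<pi> \<tau>} \<le> d choose j" .
  qed
  finally have "(\<Sum>\<pi>\<in>?S. min_mult P ?F j \<pi>) \<le> card ?S * (d choose j)" by simp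
  then have "real (\<Sum>\<pi>\<in>?S. min_mult P ?F j \<pi>) \<le> real (card ?S) * real (d choose j)"
    by (metis of_nat_le_iff of_nat_mult)
  moreover have "card ?S > 0" using \<sigma> finS by (auto simp: card_gt_0_iff star_def)
  ultimately show ?thesis unfolding star_complexity_def by (simp add: divide_le_eq mult.commute)
qed

lemma star_complexity_nonneg: "0 \<le> star_complexity TYPE('k::field) P j \<sigma>"
  by (auto simp: star_complexity_def intro!: divide_nonneg_nonneg sum_nonneg)

section \<open>Skeleta of simplices\<close>

lemma skeleton_simplex_eq:
  "skeleton d (standard_simplex n) = {\<tau>. \<tau> \<subseteq> {0..n} \<and> \<tau> \<noteq> {} \<and> card \<tau> \<le> Suc d}"
  by (auto simp: skeleton_def standard_simplex_def simplex_dim_def)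

lemma finite_skeleton_simplex: "finite (skeleton d (standard_simplex n))"
  unfolding skeleton_simplex_eq by (rule finite_subset[of _ "Pow {0..n}"]) auto

lemma complex_skeleton_simplex: "abstract_simplicial_complex (skeleton d (standard_simplex n))"
  unfolding abstract_simplicial_complex_def skeleton_simplex_eq
  by (auto intro: finite_subset) (meson card_mono finite_atLeastAtMost finite_subset le_trans)

text \<open>Besides \<open>v\<close> there are \<open>n\<close> further vertices, and a simplex of
  dimension \<open>i\<close> through \<open>v\<close> is a choice of \<open>i\<close> of
  them.\<close>

lemma card_star_skeleton:
  assumes "v \<le> n"
  shows "card (star (skeleton d (standard_simplex n)) {v}) = (\<Sum>i\<le>d. n choose i)"
proof -
  let ?A = "\<lambda>i. {\<tau>. \<tau> \<subseteq> {0..n} \<and> {v} \<subseteq> \<tau> \<and> card \<tau> = card {v} + i}"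
  have "star (skeleton d (standard_simplex n)) {v} = (\<Union>i\<le>d. ?A i)"
  proof (intro equalityI subsetI)
    fix \<tau> assume t: "\<tau> \<in> star (skeleton d (standard_simplex n)) {v}"
    then have "finite \<tau>" "v \<in> \<tau>" by (auto simp: star_def skeleton_simplex_eq intro: finite_subset)
    then have "card \<tau> > 0" by (auto simp: card_gt_0_iff)
    then show "\<tau> \<in> (\<Union>i\<le>d. ?A i)" using t
      by (auto simp: star_def skeleton_simplex_eq intro!: bexI[of _ "card \<tau> - 1"])
  qed (auto simp: star_def skeleton_simplex_eq)
  also have "card \<dots> = (\<Sum>i\<le>d. card (?A i))"
    by (rule card_UN_disjoint) (auto intro: finite_subset[of _ "Pow {0..n}"])
  also have "\<dots> = (\<Sum>i\<le>d. n choose i)"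
    using assms card_supersets[of "{0..n}" "{v}"] by simp
  finally show ?thesis .
qed

text \<open>Only the \<open>\<pi>\<close> of dimension \<open>d - j\<close> are kept in the sum.
  Each has \<open>Suc (d - j)\<close> of the \<open>n + 1\<close> vertices, so \<open>m\<close> is
  the number of vertices outside it.\<close>

lemma sum_min_mult_skeleton_ge:
  assumes v: "v \<le> n" and j: "j \<le> d"
  defines "P \<equiv> skeleton d (standard_simplex n)"
  defines "m \<equiv> n - (d - j)"
  shows "real (n choose (d - j)) * (real (m choose j) - (if j = 0 then 0 else real (m choose (j - 1))))
    \<le> real (\<Sum>\<pi>\<in>star P {v}. min_mult P (constant_sheaf :: (nat set, 'k::field) sheaf) j \<pi>)"
proof -
  let ?F = "constant_sheaf :: (nat set, 'k) sheaf"
  note P = finite_skeleton_simplex[of d n, folded P_def] complex_skeleton_simplex[of d n, folded P_def]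
  have Pmem: "\<tau> \<in> P \<longleftrightarrow> \<tau> \<subseteq> {0..n} \<and> \<tau> \<noteq> {} \<and> card \<tau> \<le> Suc d" for \<tau>
    by (simp add: P_def skeleton_simplex_eq)
  define A where "A = {\<pi>. \<pi> \<subseteq> {0..n} \<and> {v} \<subseteq> \<pi> \<and> card \<pi> = card {v} + (d - j)}"
  have cardA: "card A = n choose (d - j)"
    unfolding A_def using v card_supersets[of "{0..n}" "{v}" "d - j"] by simp
  have AS: "A \<subseteq> star P {v}" using j by (auto simp: A_def star_def Pmem)
  let ?b = "real (m choose j) - (if j = 0 then 0 else real (m choose (j - 1)))"
  have b: "?b \<le> real (min_mult P ?F j \<pi>)" if \<pi>: "\<pi> \<in> A" for \<pi>
  proof -
    have \<pi>D: "\<pi> \<subseteq> {0..n}" "\<pi> \<noteq> {}" "card \<pi> = Suc (d - j)" "\<pi> \<in> P"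
      using \<pi> AS by (auto simp: A_def star_def)
    define a where "a = (\<lambda>k. card {\<tau> \<in> P. \<pi> \<subseteq> \<tau> \<and> int (card \<tau>) = int (card \<pi>) + k})"
    have ak: "a (int k) = m choose k" if "k \<le> j" for k
    proof -
      have "{\<tau> \<in> P. \<pi> \<subseteq> \<tau> \<and> int (card \<tau>) = int (card \<pi>) + int k} =
          {\<tau>. \<tau> \<subseteq> {0..n} \<and> \<pi> \<subseteq> \<tau> \<and> card \<tau> = card \<pi> + k}"
        using \<pi>D that j by (auto simp: Pmem)
      then show ?thesis using card_supersets[OF _ \<pi>D(1), of k] \<pi>D(3) by (simp add: a_def m_def)
    qed
    \<comment> \<open>A coface of codimension \<open>j + 1\<close> would have dimension
      \<open>d + 1\<close>, beyond the skeleton.\<close>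
    have up: "a (int j + 1) = 0"
    proof -
      have "{\<tau> \<in> P. \<pi> \<subseteq> \<tau> \<and> int (card \<tau>) = int (card \<pi>) + (int j + 1)} = {}"
        using \<pi>D(3) j by (auto simp: Pmem)
      then show ?thesis by (simp only: a_def card.empty)
    qed
    \<comment> \<open>At \<open>j = 0\<close> the degree is -1, and no coface has fewer vertices
      than \<open>\<pi>\<close>; the truncated \<open>j - 1\<close> would wrongly give 1.\<close>
    have down: "a (int j - 1) = (if j = 0 then 0 else m choose (j - 1))"
    proof (cases "j = 0")
      case True
      have "card \<pi> \<le> card \<tau>" if "\<tau> \<in> P" "\<pi> \<subseteq> \<tau>" for \<tau>
        using that by (intro card_mono) (auto simp: Pmem intro: finite_subset)
      then have "{\<tau> \<in> P. \<pi> \<subseteq> \<tau> \<and> int (card \<tau>) = int (card \<pi>) + (int j - 1)} = {}"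
        using True by fastforce
      then have "a (int j - 1) = 0" by (simp only: a_def card.empty)
      then show ?thesis using True by simp
    next
      case False
      then have "int j - 1 = int (j - 1)" by simp
      then show ?thesis using ak[of "j - 1"] False by simp
    qed
    have "a (int j) \<le> min_mult P ?F j \<pi> + a (int j - 1) + a (int j + 1)"
      unfolding a_def by (rule min_mult_constant_bounds(2)[OF P \<pi>D(4)])
    then have "m choose j \<le> min_mult P ?F j \<pi> + (if j = 0 then 0 else m choose (j - 1))"
      using ak[of j] up down by simp
    then have "real (m choose j) \<le> real (min_mult P ?F j \<pi> + (if j = 0 then 0 else m choose (j - 1)))"
      by (simp only: of_nat_le_iff)
    then show ?thesis by (cases "j = 0") simp_all
  qed
  have "real (n choose (d - j)) * ?b = (\<Sum>\<pi>\<in>A. ?b)" by (simp add: cardA)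
  also have "\<dots> \<le> (\<Sum>\<pi>\<in>A. real (min_mult P ?F j \<pi>))" by (rule sum_mono) (rule b)
  also have "\<dots> \<le> (\<Sum>\<pi>\<in>star P {v}. real (min_mult P ?F j \<pi>))"
    using P(1) AS by (intro sum_mono2) (auto simp: star_def)
  finally show ?thesis by simp
qed

section \<open>Asymptotics of binomial coefficients\<close>

lemma binomial_over_power_tendsto:
  assumes "k \<le> m"
  shows "(\<lambda>n. real ((n - c) choose k) / real n ^ m) \<longlonglongrightarrow> (if k = m then 1 / fact k else 0)"
proof -
  \<comment> \<open>The binomial coefficient over \<open>n^k\<close> is a product of
    \<open>k\<close> such factors divided by \<open>fact k\<close>. The natural number
    \<open>n - c\<close> is the true difference only once \<open>n\<close> exceeds \<open>c\<close>,
    hence the eventual equality.\<close>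
  have 1: "(\<lambda>n. (real (n - c) - real i) / real n) \<longlonglongrightarrow> 1" for i
  proof -
    have "(\<lambda>n. 1 - (real c + real i) / real n) \<longlonglongrightarrow> 1 - 0"
      by (intro tendsto_diff tendsto_const lim_const_over_n)
    moreover have "eventually (\<lambda>n. 1 - (real c + real i) / real n = (real (n - c) - real i) / real n) sequentially"
      using eventually_gt_at_top[of c] by eventually_elim (auto simp: field_simps of_nat_diff)
    ultimately show ?thesis by (simp add: tendsto_cong)
  qed
  have "(\<lambda>n. (\<Prod>i\<in>{0..<k}. (real (n - c) - real i) / real n) / fact k) \<longlonglongrightarrow> (\<Prod>i\<in>{0..<k}. 1) / fact k"
    by (intro tendsto_divide tendsto_prod 1 tendsto_const) simp
  moreover have "(\<Prod>i\<in>{0..<k}. (real (n - c) - real i) / real n) / fact k = real ((n - c) choose k) / real n ^ k" for n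
    by (simp add: binomial_gbinomial gbinomial_prod_rev prod_dividef)
  ultimately have k: "(\<lambda>n. real ((n - c) choose k) / real n ^ k) \<longlonglongrightarrow> 1 / fact k" by simp
  show ?thesis
  proof (cases "k = m")
    case True
    then show ?thesis using k by simp
  next
    case False
    have "(\<lambda>n. (1 / real n) ^ (m - k)) \<longlonglongrightarrow> 0 ^ (m - k)"
      by (intro tendsto_power lim_const_over_n)
    then have "(\<lambda>n. real ((n - c) choose k) / real n ^ k * (1 / real n) ^ (m - k)) \<longlonglongrightarrow> 1 / fact k * 0"
      using False assms by (intro tendsto_mult k) (simp add: power_0_left)
    moreover have "real ((n - c) choose k) / real n ^ k * (1 / real n) ^ (m - k) = real ((n - c) choose k) / real n ^ m" for n
      using assms by (simp add: power_one_over flip: power_add)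
    ultimately show ?thesis using False by simp
  qed
qed

text \<open>Both sides of the fraction are of order \<open>n^d\<close>. After division by it the
  numerator tends to \<open>1 / (fact (d - j) * fact j)\<close>, the term with \<open>j - 1\<close>
  being of lower order, and the denominator to \<open>1 / fact d\<close>.\<close>

lemma skeleton_ratio_tendsto:
  assumes j: "j \<le> d"
  shows "(\<lambda>n. real (n choose (d - j)) * (real ((n - (d - j)) choose j) -
      (if j = 0 then 0 else real ((n - (d - j)) choose (j - 1)))) / real (\<Sum>i\<le>d. n choose i))
    \<longlonglongrightarrow> real (d choose j)"
proof -
  let ?e = "d - j"
  let ?num = "\<lambda>n. real (n choose ?e) * (real ((n - ?e) choose j) - (if j = 0 then 0 else real ((n - ?e) choose (j - 1))))"
  have "(\<lambda>n. (if j = 0 then 0 else real ((n - ?e) choose (j - 1)) / real n ^ j)) \<longlonglongrightarrow> 0"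
    using binomial_over_power_tendsto[of "j - 1" j ?e] by (cases j) (simp_all del: lambda_zero)
  then have "(\<lambda>n. real ((n - 0) choose ?e) / real n ^ ?e * (real ((n - ?e) choose j) / real n ^ j -
      (if j = 0 then 0 else real ((n - ?e) choose (j - 1)) / real n ^ j))) \<longlonglongrightarrow> 1 / fact ?e * (1 / fact j - 0)"
    using binomial_over_power_tendsto[of ?e ?e 0] binomial_over_power_tendsto[of j j ?e]
    by (intro tendsto_mult tendsto_diff) auto
  moreover have "real ((n - 0) choose ?e) / real n ^ ?e * (real ((n - ?e) choose j) / real n ^ j -
      (if j = 0 then 0 else real ((n - ?e) choose (j - 1)) / real n ^ j)) = ?num n / real n ^ d" for n
  proof -
    have pow: "real n ^ d = real n ^ ?e * real n ^ j" using j by (simp flip: power_add)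
    have "x / a * (y / b - z / b) = x * (y - z) / (a * b)" for x y z a b :: real
      by (simp flip: diff_divide_distrib)
    from this[of _ _ "real ((n - ?e) choose j)" _ "if j = 0 then 0 else real ((n - ?e) choose (j - 1))"]
    show ?thesis unfolding pow by (cases "j = 0") simp_all
  qed
  ultimately have num: "(\<lambda>n. ?num n / real n ^ d) \<longlonglongrightarrow> 1 / (fact ?e * fact j)" by simp
  have "(\<lambda>n. \<Sum>i\<le>d. real ((n - 0) choose i) / real n ^ d) \<longlonglongrightarrow> (\<Sum>i\<le>d. if i = d then 1 / fact i else 0)"
    by (intro tendsto_sum binomial_over_power_tendsto) auto
  then have den: "(\<lambda>n. real (\<Sum>i\<le>d. n choose i) / real n ^ d) \<longlonglongrightarrow> 1 / fact d"
    by (simp add: sum_divide_distrib)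
  have "(\<lambda>n. (?num n / real n ^ d) / (real (\<Sum>i\<le>d. n choose i) / real n ^ d)) \<longlonglongrightarrow> 1 / (fact ?e * fact j) / (1 / fact d)"
    by (rule tendsto_divide[OF num den]) simp
  moreover have "eventually (\<lambda>n. (?num n / real n ^ d) / (real (\<Sum>i\<le>d. n choose i) / real n ^ d) =
      ?num n / real (\<Sum>i\<le>d. n choose i)) sequentially"
    using eventually_gt_at_top[of 0] by eventually_elim simp
  moreover have "1 / (fact ?e * fact j) / (1 / fact d) = real (d choose j)"
    using binomial_fact[OF j, where 'a = real] by (simp add: mult.commute)
  ultimately show ?thesis by (simp only: tendsto_cong)
qed

text \<open>The skeleta vary with \<open>n\<close>, so the vertex is given as a sequence; the bounds
  proved for each \<open>n\<close> take the same value at every vertex.\<close>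

theorem proposition4p26:
  shows "(\<forall>(P :: 'v set set) \<sigma> d j.
            finite P \<longrightarrow> abstract_simplicial_complex P \<longrightarrow> \<sigma> \<in> P \<longrightarrow>
            d = star_dim P \<sigma> - simplex_dim \<sigma> \<longrightarrow>
            star_complexity TYPE('k::field) P j \<sigma> \<le> real (d choose j))
       \<and> (\<forall>d j (v :: nat \<Rightarrow> nat).
            (\<forall>n. {v n} \<in> skeleton d (standard_simplex n)) \<longrightarrow>
            (\<lambda>n. star_complexity TYPE('k) (skeleton d (standard_simplex n)) j {v n})
              \<longlonglongrightarrow> real (d choose j))"
proof (intro conjI allI impI)
  fix P :: "'v set set" and \<sigma> d j
  assume P: "finite P" "abstract_simplicial_complex P" and \<sigma>: "\<sigma> \<in> P"
    and d: "d = star_dim P \<sigma> - simplex_dim \<sigma>"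
  show "star_complexity TYPE('k) P j \<sigma> \<le> real (d choose j)"
  proof (rule star_complexity_le[OF P \<sigma>])
    fix \<tau> assume "\<tau> \<in> star P \<sigma>"
    then have "simplex_dim \<tau> \<le> star_dim P \<sigma>"
      unfolding star_dim_def using P(1) by (intro Max_ge) (auto simp: star_def)
    \<comment> \<open>Non-emptiness of \<open>\<sigma>\<close> makes the truncated
      \<open>card \<sigma> - 1\<close> exact, so the comparison of dimensions becomes one of
      cardinalities.\<close>
    moreover have "card \<sigma> > 0" using P(2) \<sigma> by (auto simp: abstract_simplicial_complex_def card_gt_0_iff)
    ultimately show "card \<tau> \<le> card \<sigma> + d" unfolding d simplex_dim_def by linarith
  qed
next
  fix d j and v :: "nat \<Rightarrow> nat"
  assume v: "\<forall>n. {v n} \<in> skeleton d (standard_simplex n)"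
  let ?P = "\<lambda>n. skeleton d (standard_simplex n)"
  let ?SC = "\<lambda>n. star_complexity TYPE('k) (?P n) j {v n}"
  have le: "?SC n \<le> real (d choose j)" for n
    by (rule star_complexity_le[OF finite_skeleton_simplex complex_skeleton_simplex])
      (use v in \<open>auto simp: star_def skeleton_simplex_eq\<close>)
  show "?SC \<longlonglongrightarrow> real (d choose j)"
  proof (cases "j \<le> d")
    case False
    \<comment> \<open>For \<open>j > d\<close> the upper bound is 0, so the complexity, being
      nonnegative, is constantly 0.\<close>
    then have z: "real (d choose j) = 0" by simp
    then have "?SC n = 0" for n
      using le[of n] star_complexity_nonneg[where 'k = 'k, of "?P n" j "{v n}"] by linarith
    then show ?thesis unfolding z by (simp del: lambda_zero)
  next
    case True
    have vn: "v n \<le> n" for n using v by (auto simp: skeleton_simplex_eq)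
    show ?thesis
    proof (rule tendsto_sandwich[OF always_eventually always_eventually skeleton_ratio_tendsto[OF True] tendsto_const])
      show "\<forall>n. ?SC n \<le> real (d choose j)" using le by blast
      show "\<forall>n. real (n choose (d - j)) * (real ((n - (d - j)) choose j) -
          (if j = 0 then 0 else real ((n - (d - j)) choose (j - 1)))) / real (\<Sum>i\<le>d. n choose i) \<le> ?SC n"
        unfolding star_complexity_def card_star_skeleton[OF vn]
        by (intro allI divide_right_mono sum_min_mult_skeleton_ge vn True)
          (simp add: sum_nonneg)
    qed
  qed
qed

end
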